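(* Let $N\ge1$, $\gamma>1$, $\gamma'=\gamma/(\gamma-1)$ and $H(p)=\frac1\gamma|p|^\gamma$ for $p\in\mathbb{R}^N$. Let $\alpha,C_f>0$ and let $f:[0,\infty)\to\mathbb{R}$, $f\in C^1((0,\infty))$, satisfy $0\le f(m)\le C_f(m^\alpha+1)$ for all $m\ge 0$. Set $F(m)=\int_0^m f(s)\,ds$ and suppose that $$(N-\gamma')f(m)m-NF(m)>0\qquad\text{for all }m>0 .$$ Then the system $$\begin{cases}-\Delta u+\frac1\gamma|\nabla u|^\gamma+\lambda=-f(m(x)) & \text{in }\mathbb{R}^N,\\ -\Delta m-\mathrm{div}(|\nabla u|^{\gamma-2}\nabla u\,m)=0 & \text{in }\mathbb{R}^N,\\ \int_{\mathbb{R}^N}m\,dx=1,\quad m>0,\end{cases}$$ has no solutions $(u,\lambda,m)\in C^2(\mathbb{R}^N)\times\mathbb{R}\times W^{1,1}(\mathbb{R}^N)$ satisfying both $$\int_{\mathbb{R}^N}|\nabla u|^\gamma m\,dx<\infty,\qquad\int_{\mathbb{R}^N}m^{\alpha+1}\,dx<\infty,\qquad\int_{\mathbb{R}^N}|\nabla u|\,|\nabla m|\,dx<\infty$$ and $$u(x)\to+\infty\ \text{ as }|x|\to\infty,\qquad\exists\,c,\eta>0\ \text{ such that }\ |\nabla u(x)|\le c(|x|^\eta+1)\ \text{ for all }x\in\mathbb{R}^N .$$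
   Context: The first equation is satisfied in the classical sense; the second equation is satisfied weakly, i.e. $\int_{\mathbb{R}^N}\big(\nabla m\cdot\nabla\varphi+m|\nabla u|^{\gamma-2}\nabla u\cdot\nabla\varphi\big)\,dx=0$ for all $\varphi\in C_c^\infty(\mathbb{R}^N)$. The vector $|p|^{\gamma-2}p$ is understood to be $0$ at $p=0$. *)

theory Defs
  imports "HOL-Analysis.Analysis"
begin

definition partial_deriv :: "'n::finite \<Rightarrow> (real ^ 'n \<Rightarrow> real) \<Rightarrow> real ^ 'n \<Rightarrow> real" where
  "partial_deriv i f x = deriv (\<lambda>t. f (x + t *\<^sub>R axis i 1)) 0"

definition grad :: "(real ^ 'n::finite \<Rightarrow> real) \<Rightarrow> real ^ 'n \<Rightarrow> real ^ 'n" where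
  "grad f x = (\<chi> i. partial_deriv i f x)"

definition laplacian :: "(real ^ 'n::finite \<Rightarrow> real) \<Rightarrow> real ^ 'n \<Rightarrow> real" where
  "laplacian f x = (\<Sum>i\<in>UNIV. partial_deriv i (partial_deriv i f) x)"

primrec Ck :: "nat \<Rightarrow> (real ^ 'n::finite \<Rightarrow> real) \<Rightarrow> bool" where
  "Ck 0 f \<longleftrightarrow> continuous_on UNIV f"
| "Ck (Suc k) f \<longleftrightarrow> (\<forall>x. f differentiable (at x)) \<and> (\<forall>i. Ck k (partial_deriv i f))"

definition test_function :: "(real ^ 'n::finite \<Rightarrow> real) \<Rightarrow> bool" where
  "test_function \<phi> \<longleftrightarrow> (\<forall>k. Ck k \<phi>) \<and> compact (closure {x. \<phi> x \<noteq> 0})"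

text \<open>\<open>W11 m Dm\<close>: the function \<open>m\<close> represents an element of \<open>W\<^sup>1\<^sup>,\<^sup>1\<close> of the whole space,
  and \<open>Dm\<close> is its weak gradient. The weak gradient is determined only almost everywhere, so it is
  kept as an argument; every condition in which it occurs is insensitive to null sets.\<close>

definition W11 :: "(real ^ 'n::finite \<Rightarrow> real) \<Rightarrow> (real ^ 'n \<Rightarrow> real ^ 'n) \<Rightarrow> bool" where
  "W11 m Dm \<longleftrightarrow> integrable lebesgue m \<and> integrable lebesgue Dm \<and>
     (\<forall>\<phi> i. test_function \<phi> \<longrightarrow>
        (LINT x|lebesgue. m x * partial_deriv i \<phi> x) = - (LINT x|lebesgue. Dm x $ i * \<phi> x))"

text \<open>The first equation and \<open>m > 0\<close> hold at every point for the representative \<open>m\<close>, the second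
  equation holds weakly. At \<open>grad u x = 0\<close> the drift term \<open>norm (grad u x) powr (\<gamma> - 2) *\<^sub>R grad u x\<close>
  is \<open>0\<close>, also when \<open>\<gamma> < 2\<close>. Its product with \<open>m\<close> and the gradient of a test function is integrable
  as \<open>grad u\<close> is continuous, so the integral below takes no default value.\<close>

definition mfg_solution ::
  "real \<Rightarrow> (real \<Rightarrow> real) \<Rightarrow> (real ^ 'n::finite \<Rightarrow> real) \<Rightarrow> real \<Rightarrow>
   (real ^ 'n \<Rightarrow> real) \<Rightarrow> (real ^ 'n \<Rightarrow> real ^ 'n) \<Rightarrow> bool" where
  "mfg_solution \<gamma> f u lam m Dm \<longleftrightarrow>
     Ck 2 u \<and> W11 m Dm \<and>
     (\<forall>x. - laplacian u x + 1 / \<gamma> * norm (grad u x) powr \<gamma> + lam = - f (m x)) \<and>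
     (\<forall>\<phi>. test_function \<phi> \<longrightarrow>
        (LINT x|lebesgue. Dm x \<bullet> grad \<phi> x
           + m x * ((norm (grad u x) powr (\<gamma> - 2) *\<^sub>R grad u x) \<bullet> grad \<phi> x)) = 0) \<and>
     (LINT x|lebesgue. m x) = 1 \<and>
     (\<forall>x. m x > 0)"

end

theory Submission
  imports Defs
begin

text \<open>
  The idea is a Pohozaev identity. Write \<open>B\<close> for the integral of \<open>|\<nabla>u|\<^sup>\<gamma> m\<close>, \<open>S\<close> for that of \<open>f(m) m\<close> and
  \<open>I\<close> for that of \<open>F(m)\<close>. Testing the first equation with \<open>m\<close> and the second one with truncations of \<open>u\<close>
  (which have compact support up to a constant because \<open>u\<close> is coercive) gives \<open>\<lambda> = B/\<gamma>' - S\<close>. Testing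
  the first equation with \<open>x \<bullet> \<nabla>m\<close> and the second one with \<open>x \<bullet> \<nabla>u\<close> gives \<open>B = N (S - I)\<close>; the
  third derivatives of \<open>u\<close> do not enter, since the second-order terms combine to the integral of \<open>\<nabla>m\<close>
  against the divergence of an antisymmetric tensor. The hypothesis on \<open>f\<close> then says \<open>B > \<gamma>' S\<close>, that
  is \<open>\<lambda> > 0\<close>. But \<open>\<Delta>u \<ge> |\<nabla>u|\<^sup>\<gamma>/\<gamma> + \<lambda>\<close> on the whole space forces \<open>\<lambda> \<le> 0\<close>: test with a cutoff at
  scale \<open>R\<close>, use Young's inequality and let \<open>R\<close> tend to infinity.

  All integrations by parts only need test functions of class \<open>C\<^sup>1\<close> with compact support, because \<open>m\<close> and
  the flux \<open>\<nabla>m + m |\<nabla>u|\<^sup>\<gamma>\<^sup>-\<^sup>2 \<nabla>u\<close> are globally integrable and can be mollified.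
\<close>

section \<open>Gradients of C1 functions\<close>

text \<open>Regularity is the obstacle. For \<gamma> < 2 the drift |p|^(\<gamma>-2) p need not be
  differentiable where the gradient vanishes, so only |p|^\<gamma>/\<gamma> is ever differentiated,
  and that is C1 for every \<gamma> > 1. Neither continuity of \<open>m\<close> nor continuity of
  \<open>f\<close> at 0 is assumed; yet the first equation holds pointwise and so makes
  \<open>f (m x)\<close> a continuous function of \<open>x\<close>. This is what makes the product
  of \<open>f (m x)\<close> and the weak gradient locally integrable. The truncations are dictated
  by the available integrability. Where \<open>u\<close> itself would appear undifferentiated, the
  cut is made along its level sets. Elsewhere the cutoff (1 - |x|^2/R^2)_+^k is used: its gradient
  is a scalar multiple of \<open>x\<close>, and that scalar times |x|^2 is at most 2k for every R.
  The errors caused by the unbounded dilation field are therefore dominated by functions already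
  known to be integrable, and they vanish pointwise, so no decay rate is required.\<close>

text \<open>The gradient is an explicit argument, so that the product and chain rules compute it as
  a formula without going through \<open>partial_deriv\<close>.\<close>

definition is_grad :: "(real ^ 'n::finite \<Rightarrow> real) \<Rightarrow> (real ^ 'n \<Rightarrow> real ^ 'n) \<Rightarrow> bool" where
  "is_grad f G \<longleftrightarrow> (\<forall>x. (f has_derivative (\<lambda>h. G x \<bullet> h)) (at x)) \<and> continuous_on UNIV G"

lemma is_gradI:
  assumes "\<And>x. (f has_derivative (\<lambda>h. G x \<bullet> h)) (at x)" "continuous_on UNIV G"
  shows "is_grad f G"
  using assms by (simp add: is_grad_def)

lemma is_grad_derivD: "is_grad f G \<Longrightarrow> (f has_derivative (\<lambda>h. G x \<bullet> h)) (at x)"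
  by (simp add: is_grad_def)

lemma is_grad_continuous: "is_grad f G \<Longrightarrow> continuous_on UNIV G"
  by (simp add: is_grad_def)

lemma is_grad_imp_continuous: "is_grad f G \<Longrightarrow> continuous_on UNIV f"
  by (meson continuous_at_imp_continuous_on has_derivative_continuous is_grad_derivD)

lemma is_grad_along_line:
  assumes "is_grad f G"
  shows "((\<lambda>t. f (x + t *\<^sub>R v)) has_real_derivative G (x + t *\<^sub>R v) \<bullet> v) (at t)"
proof -
  have "((\<lambda>t. x + t *\<^sub>R v) has_derivative (\<lambda>s. s *\<^sub>R v)) (at t)"
    by (auto intro!: derivative_eq_intros)
  from has_derivative_compose[OF this is_grad_derivD[OF assms]]
  show ?thesis
    by (simp add: has_field_derivative_def mult.commute mult_commute_abs)
qed

lemma is_grad_partial_deriv: "is_grad f G \<Longrightarrow> partial_deriv i f x = G x $ i"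
  using is_grad_along_line[of f G x "axis i 1" 0]
  by (simp add: partial_deriv_def DERIV_imp_deriv inner_axis)

lemma is_grad_grad: "is_grad f G \<Longrightarrow> grad f = G"
  by (auto simp: grad_def is_grad_partial_deriv vec_eq_iff)

text \<open>Differentiability makes the derivative linear, so it is determined by its values on the
  axes, which are the partial derivatives; their continuity makes the gradient continuous.\<close>

lemma Ck_Suc_is_grad:
  assumes "\<And>x. f differentiable (at x)" "\<And>i. continuous_on UNIV (partial_deriv i f)"
  shows "is_grad f (grad f)"
proof (rule is_gradI)
  fix x
  obtain f' where f': "(f has_derivative f') (at x)"
    using assms(1)[of x] by (auto simp: differentiable_def)
  then interpret bounded_linear f' by (rule has_derivative_bounded_linear)
  have pd: "partial_deriv i f x = f' (axis i 1)" for i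
  proof -
    have "((\<lambda>t. x + t *\<^sub>R axis i 1) has_derivative (\<lambda>s. s *\<^sub>R axis i 1)) (at 0)"
      by (auto intro!: derivative_eq_intros)
    moreover have "(f has_derivative f') (at (x + 0 *\<^sub>R axis i 1))" using f' by simp
    ultimately have "((\<lambda>t. f (x + t *\<^sub>R axis i 1)) has_derivative (\<lambda>s. f' (s *\<^sub>R axis i 1))) (at 0)"
      by (rule has_derivative_compose)
    hence "((\<lambda>t. f (x + t *\<^sub>R axis i 1)) has_real_derivative f' (axis i 1)) (at 0)"
      by (simp add: has_field_derivative_def scaleR mult_commute_abs)
    thus ?thesis by (simp add: partial_deriv_def DERIV_imp_deriv)
  qed
  have "f' h = grad f x \<bullet> h" for h
  proof -
    have "f' h = f' (\<Sum>i\<in>UNIV. (h $ i) *\<^sub>R axis i 1)"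
      by (simp add: basis_expansion flip: scalar_mult_eq_scaleR)
    also have "\<dots> = (\<Sum>i\<in>UNIV. h $ i * f' (axis i 1))" by (simp add: sum scaleR)
    finally show ?thesis by (simp add: inner_vec_def grad_def pd mult.commute)
  qed
  hence "f' = (\<lambda>h. grad f x \<bullet> h)" by (rule ext)
  with f' show "(f has_derivative (\<lambda>h. grad f x \<bullet> h)) (at x)" by simp
next
  show "continuous_on UNIV (grad f)"
    unfolding grad_def by (intro continuous_on_vec_lambda assms(2))
qed

lemma is_grad_const: "is_grad (\<lambda>x. c) (\<lambda>x. 0)"
  by (rule is_gradI) auto

lemma is_grad_coord: "is_grad (\<lambda>x. x $ i) (\<lambda>x. axis i 1)"
  by (rule is_gradI) (auto simp: inner_axis' intro!: bounded_linear_imp_has_derivative bounded_linear_vec_nth)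

lemma is_grad_add: "is_grad f F \<Longrightarrow> is_grad g G \<Longrightarrow> is_grad (\<lambda>x. f x + g x) (\<lambda>x. F x + G x)"
  unfolding is_grad_def
  by (auto intro!: derivative_eq_intros continuous_intros simp: inner_add_left)

lemma is_grad_mult:
  assumes "is_grad f F" "is_grad g G"
  shows "is_grad (\<lambda>x. f x * g x) (\<lambda>x. f x *\<^sub>R G x + g x *\<^sub>R F x)"
proof (rule is_gradI)
  show "((\<lambda>x. f x * g x) has_derivative (\<lambda>h. (f x *\<^sub>R G x + g x *\<^sub>R F x) \<bullet> h)) (at x)" for x
    using has_derivative_mult[OF is_grad_derivD[OF assms(1)] is_grad_derivD[OF assms(2)], of x]
    by (simp add: inner_add_left mult.commute mult.left_commute)
qed (intro continuous_intros is_grad_imp_continuous[OF assms(1)] is_grad_imp_continuous[OF assms(2)]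
    is_grad_continuous[OF assms(1)] is_grad_continuous[OF assms(2)])

lemma is_grad_cmult: "is_grad f F \<Longrightarrow> is_grad (\<lambda>x. c * f x) (\<lambda>x. c *\<^sub>R F x)"
  using is_grad_mult[OF is_grad_const, of f F c] by simp

lemma is_grad_diff: "is_grad f F \<Longrightarrow> is_grad g G \<Longrightarrow> is_grad (\<lambda>x. f x - g x) (\<lambda>x. F x - G x)"
  using is_grad_add[OF _ is_grad_cmult, of f F g G "-1"] by simp

lemma is_grad_sum:
  "finite I \<Longrightarrow> (\<And>i. i \<in> I \<Longrightarrow> is_grad (f i) (F i)) \<Longrightarrow> is_grad (\<lambda>x. \<Sum>i\<in>I. f i x) (\<lambda>x. \<Sum>i\<in>I. F i x)"
  by (induction I rule: finite_induct) (auto intro: is_grad_const is_grad_add)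

lemma is_grad_compose:
  assumes "is_grad f F" "\<And>t. (g has_real_derivative g' t) (at t)" "continuous_on UNIV g'"
  shows "is_grad (\<lambda>x. g (f x)) (\<lambda>x. g' (f x) *\<^sub>R F x)"
proof (rule is_gradI)
  show "((\<lambda>x. g (f x)) has_derivative (\<lambda>h. (g' (f x) *\<^sub>R F x) \<bullet> h)) (at x)" for x
    using has_derivative_compose[OF is_grad_derivD[OF assms(1)], of g "\<lambda>h. g' (f x) * h" x] assms(2)
    by (simp add: has_field_derivative_def)
  show "continuous_on UNIV (\<lambda>x. g' (f x) *\<^sub>R F x)"
    using assms by (intro continuous_intros is_grad_continuous continuous_on_compose2[of UNIV g' UNIV f])
      (auto intro: is_grad_imp_continuous)
qed

lemma is_grad_norm_sq: "is_grad (\<lambda>x. (norm x)\<^sup>2) (\<lambda>x. 2 *\<^sub>R x)"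
  unfolding power2_norm_eq_inner
  by (rule is_gradI) (auto intro!: derivative_eq_intros continuous_intros simp: inner_commute)

lemma is_grad_reflect:
  assumes "is_grad f F"
  shows "is_grad (\<lambda>y. f (x - y)) (\<lambda>y. - F (x - y))"
proof (rule is_gradI)
  fix y
  have "((\<lambda>y. x - y) has_derivative (\<lambda>h. - h)) (at y)"
    by (auto intro!: derivative_eq_intros)
  from has_derivative_compose[OF this is_grad_derivD[OF assms]]
  show "((\<lambda>y. f (x - y)) has_derivative (\<lambda>h. - F (x - y) \<bullet> h)) (at y)" by simp
next
  show "continuous_on UNIV (\<lambda>y. - F (x - y))"
    by (intro continuous_intros continuous_on_compose2[OF is_grad_continuous[OF assms]]) auto
qed

lemma is_grad_eq: "is_grad f F \<Longrightarrow> (\<And>x. f x = g x) \<Longrightarrow> (\<And>x. F x = G x) \<Longrightarrow> is_grad g G"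
  by (metis ext)

section \<open>Symmetry of second derivatives\<close>

text \<open>The mean value theorem is used twice on a square of side \<open>t\<close>, first along
  axis \<open>i\<close>, then along axis \<open>j\<close>. The double difference does not change
  when \<open>i\<close> and \<open>j\<close> are exchanged, while the derivative on the right
  does.\<close>

lemma second_difference_mean_value:
  assumes u: "is_grad u p" and p: "is_grad (\<lambda>x. p x $ i) Di" and t: "t > 0"
  shows "\<exists>y. norm (y - x) \<le> 2 * t \<and>
    u (x + t *\<^sub>R axis i 1 + t *\<^sub>R axis j 1) - u (x + t *\<^sub>R axis i 1) - u (x + t *\<^sub>R axis j 1) + u x = t\<^sup>2 * Di y $ j"
proof -
  let ?ei = "axis i (1::real)" and ?ej = "axis j (1::real)"
  let ?h = "\<lambda>s. u (x + t *\<^sub>R ?ej + s *\<^sub>R ?ei) - u (x + s *\<^sub>R ?ei)"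
  have "\<exists>s>0. s < t \<and> ?h t - ?h 0 = (t - 0) * (p (x + t *\<^sub>R ?ej + s *\<^sub>R ?ei) $ i - p (x + s *\<^sub>R ?ei) $ i)"
    using is_grad_along_line[OF u, where v = ?ei] t
    by (intro MVT2) (auto intro!: DERIV_diff simp: inner_axis)
  then obtain s where s: "0 < s" "s < t"
    "?h t - ?h 0 = t * (p (x + t *\<^sub>R ?ej + s *\<^sub>R ?ei) $ i - p (x + s *\<^sub>R ?ei) $ i)" by auto
  let ?k = "\<lambda>r. p (x + s *\<^sub>R ?ei + r *\<^sub>R ?ej) $ i"
  have "\<exists>r>0. r < t \<and> ?k t - ?k 0 = (t - 0) * Di (x + s *\<^sub>R ?ei + r *\<^sub>R ?ej) $ j"
    using is_grad_along_line[OF p, where v = ?ej] t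
    by (intro MVT2) (auto simp: inner_axis)
  then obtain r where r: "0 < r" "r < t" "?k t - ?k 0 = t * Di (x + s *\<^sub>R ?ei + r *\<^sub>R ?ej) $ j" by auto
  have "norm (s *\<^sub>R ?ei + r *\<^sub>R ?ej) \<le> s + r"
    using norm_triangle_ineq[of "s *\<^sub>R ?ei" "r *\<^sub>R ?ej"] s r by simp
  hence "norm ((x + s *\<^sub>R ?ei + r *\<^sub>R ?ej) - x) \<le> 2 * t" using s r by (simp add: add.assoc)
  moreover have "p (x + t *\<^sub>R ?ej + s *\<^sub>R ?ei) = p (x + s *\<^sub>R ?ei + t *\<^sub>R ?ej)"
    by (simp add: add.commute add.left_commute)
  hence "?h t - ?h 0 = t\<^sup>2 * Di (x + s *\<^sub>R ?ei + r *\<^sub>R ?ej) $ j"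
    using s(3) r(3) by (simp add: power2_eq_square)
  moreover have "x + t *\<^sub>R ?ej + t *\<^sub>R ?ei = x + t *\<^sub>R ?ei + t *\<^sub>R ?ej" by simp
  ultimately show ?thesis
    by (intro exI[of _ "x + s *\<^sub>R ?ei + r *\<^sub>R ?ej"]) (auto simp: algebra_simps)
qed

text \<open>The double difference over t^2 is a value of \<open>D i _ $ j\<close> and also one of
  \<open>D j _ $ i\<close>, both at distance at most 2t from \<open>x\<close>. Continuity identifies
  the limits as t tends to 0.\<close>

theorem hessian_symmetric:
  assumes u: "is_grad u p" and p: "\<And>i. is_grad (\<lambda>x. p x $ i) (D i)"
  shows "D i x $ j = D j x $ i"
proof -
  define t where "t n = 1 / real (Suc n)" for n
  have t: "t n > 0" for n by (simp add: t_def)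
  have t0: "t \<longlonglongrightarrow> 0" unfolding t_def by (rule LIMSEQ_Suc[OF lim_1_over_n])
  have swap: "x + a *\<^sub>R axis i (1::real) + a *\<^sub>R axis j 1 = x + a *\<^sub>R axis j 1 + a *\<^sub>R axis i 1" for a
    by (simp add: add.commute add.left_commute)
  have "\<exists>y. norm (y - x) \<le> 2 * t n \<and> (\<exists>z. norm (z - x) \<le> 2 * t n \<and> D i y $ j = D j z $ i)" for n
  proof -
    obtain y where y: "norm (y - x) \<le> 2 * t n"
      "u (x + t n *\<^sub>R axis i 1 + t n *\<^sub>R axis j 1) - u (x + t n *\<^sub>R axis i 1) - u (x + t n *\<^sub>R axis j 1) + u x = (t n)\<^sup>2 * D i y $ j"
      using second_difference_mean_value[OF u p[of i] t[of n], of x j] by blast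
    obtain z where z: "norm (z - x) \<le> 2 * t n"
      "u (x + t n *\<^sub>R axis j 1 + t n *\<^sub>R axis i 1) - u (x + t n *\<^sub>R axis j 1) - u (x + t n *\<^sub>R axis i 1) + u x = (t n)\<^sup>2 * D j z $ i"
      using second_difference_mean_value[OF u p[of j] t[of n], of x i] by blast
    have "u (x + t n *\<^sub>R axis i 1 + t n *\<^sub>R axis j 1) = u (x + t n *\<^sub>R axis j 1 + t n *\<^sub>R axis i 1)"
      by (rule arg_cong[OF swap])
    hence "(t n)\<^sup>2 * D i y $ j = (t n)\<^sup>2 * D j z $ i"
      using y(2) z(2) by linarith
    with y z t[of n] show ?thesis by auto
  qed
  then obtain y z where yz: "\<And>n. norm (y n - x) \<le> 2 * t n" "\<And>n. norm (z n - x) \<le> 2 * t n"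
    "\<And>n. D i (y n) $ j = D j (z n) $ i" by metis
  have "(\<lambda>n. 2 * t n) \<longlonglongrightarrow> 0" using tendsto_mult_right_zero[OF t0] .
  moreover have "v \<longlonglongrightarrow> x" if "(\<lambda>n. 2 * t n) \<longlonglongrightarrow> 0" "\<And>n. norm (v n - x) \<le> 2 * t n" for v
    by (rule LIM_zero_cancel, rule Lim_null_comparison[OF _ that(1)]) (use that(2) in auto)
  ultimately have "y \<longlonglongrightarrow> x" "z \<longlonglongrightarrow> x" using yz(1,2) by blast+
  moreover have "isCont (D k) x" for k
    using is_grad_continuous[OF p] by (auto simp: continuous_on_eq_continuous_at)
  ultimately have "(\<lambda>n. D i (y n) $ j) \<longlonglongrightarrow> D i x $ j" "(\<lambda>n. D j (z n) $ i) \<longlonglongrightarrow> D j x $ i"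
    using tendsto_vec_nth[OF isCont_tendsto_compose] by blast+
  thus ?thesis using yz(3) LIMSEQ_unique by fastforce
qed

section \<open>Compactly supported functions\<close>

text \<open>Vanishing outside a ball is immediately stable under products, and the radius is at hand
  wherever an indicator of a ball has to dominate.\<close>

definition compsupp :: "('a::real_normed_vector \<Rightarrow> 'b::zero) \<Rightarrow> bool" where
  "compsupp f \<longleftrightarrow> (\<exists>r. \<forall>x. norm x > r \<longrightarrow> f x = 0)"

lemma compsupp_mult_left: "compsupp f \<Longrightarrow> compsupp (\<lambda>x. f x * (g x :: real))"
  by (auto simp: compsupp_def)

lemma compsupp_mult_right: "compsupp g \<Longrightarrow> compsupp (\<lambda>x. f x * (g x :: real))"
  by (auto simp: compsupp_def)

lemma compsupp_obtain_pos:
  assumes "compsupp f"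
  obtains r where "r > 0" "\<And>x. norm x > r \<Longrightarrow> f x = 0"
proof -
  from assms obtain r where "\<And>x. norm x > r \<Longrightarrow> f x = 0" by (auto simp: compsupp_def)
  thus ?thesis by (intro that[of "max r 1"]) auto
qed

lemma compsupp_bounded:
  fixes f :: "'a::euclidean_space \<Rightarrow> 'b::real_normed_vector"
  assumes "continuous_on UNIV f" "compsupp f"
  obtains B where "B \<ge> 0" "\<And>x. norm (f x) \<le> B"
proof -
  from assms(2) obtain r where r: "r > 0" "\<And>x. norm x > r \<Longrightarrow> f x = 0" by (rule compsupp_obtain_pos) blast
  have "compact (f ` cball 0 r)"
    by (intro compact_continuous_image continuous_on_subset[OF assms(1)]) auto
  then obtain B where B: "\<And>x. x \<in> cball 0 r \<Longrightarrow> norm (f x) \<le> B"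
    by (meson compact_imp_bounded bounded_iff imageI)
  show ?thesis
  proof (rule that[of "max B 0"])
    show "norm (f x) \<le> max B 0" for x
      using B[of x] r(2)[of x] by (cases "norm x > r") auto
  qed auto
qed

lemma continuous_lebesgue_measurable:
  fixes f :: "'a::euclidean_space \<Rightarrow> 'b::{real_normed_vector, second_countable_topology}"
  shows "continuous_on UNIV f \<Longrightarrow> f \<in> borel_measurable lebesgue"
  by (rule measurable_completion) (simp add: borel_measurable_continuous_onI)

lemma integrable_indicator_cball: "integrable lebesgue (indicator (cball a r) :: 'a::euclidean_space \<Rightarrow> real)"
  using emeasure_lborel_cball_finite[of a r] by (auto simp: integrable_indicator_iff top.not_eq_extremum)

lemma integrable_compsupp_mult:
  fixes f g :: "'a::euclidean_space \<Rightarrow> real"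
  assumes "continuous_on UNIV f" "compsupp f" "integrable lebesgue g"
  shows "integrable lebesgue (\<lambda>x. f x * g x)"
proof -
  obtain B where B: "B \<ge> 0" "\<And>x. norm (f x) \<le> B" using assms compsupp_bounded by blast
  show ?thesis
  proof (rule Bochner_Integration.integrable_bound)
    show "integrable lebesgue (\<lambda>x. B * g x)" using assms by simp
    show "(\<lambda>x. f x * g x) \<in> borel_measurable lebesgue"
      by (rule borel_measurable_times[OF continuous_lebesgue_measurable[OF assms(1)] borel_measurable_integrable[OF assms(3)]])
    show "AE x in lebesgue. norm (f x * g x) \<le> norm (B * g x)"
      using B by (auto simp: abs_mult intro!: mult_right_mono AE_I2)
  qed
qed

lemma integrable_compsupp:
  fixes f :: "'a::euclidean_space \<Rightarrow> real"
  assumes "continuous_on UNIV f" "compsupp f"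
  shows "integrable lebesgue f"
proof -
  obtain r where r: "\<And>x. norm x > r \<Longrightarrow> f x = 0" using assms(2) by (auto simp: compsupp_def)
  have "integrable lebesgue (indicator (cball 0 r) :: 'a \<Rightarrow> real)"
    by (rule integrable_indicator_cball)
  from integrable_compsupp_mult[OF assms this] show ?thesis
    by (rule Bochner_Integration.integrable_cong[THEN iffD1, rotated -1]) (use r in \<open>auto simp: indicator_def\<close>)
qed

text \<open>The strict inequality in \<open>compsupp\<close> makes the exterior region open, so the
  derivative of the zero function can be transferred there and the radius is kept.\<close>

lemma is_grad_compsupp:
  assumes "is_grad w W" "compsupp w"
  shows "compsupp W"
proof -
  obtain r where r: "\<And>x. norm x > r \<Longrightarrow> w x = 0" using assms(2) by (auto simp: compsupp_def)
  have "W x = 0" if "norm x > r" for x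
  proof -
    have "open {x::real^'a. norm x > r}" by (intro open_Collect_less continuous_intros)
    hence "(w has_derivative (\<lambda>h. 0)) (at x)"
      by (rule has_derivative_transform_within_open[OF has_derivative_const, of "{x. norm x > r}" _ 0])
        (use r that in auto)
    hence "(\<lambda>h. W x \<bullet> h) = (\<lambda>h. 0)"
      by (rule has_derivative_unique[OF is_grad_derivD[OF assms(1)]])
    thus ?thesis by (metis inner_eq_zero_iff)
  qed
  thus ?thesis by (auto simp: compsupp_def)
qed

lemma integral_lebesgue_translate:
  fixes f :: "'a::euclidean_space \<Rightarrow> real"
  assumes "continuous_on UNIV f"
  shows "(LINT x|lebesgue. f (x + a)) = (LINT x|lebesgue. f x)"
proof -
  have [measurable]: "f \<in> borel_measurable borel" using assms by (rule borel_measurable_continuous_onI)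
  have "(LINT x|lborel. f x) = (LINT x|distr lborel borel ((+) a). f x)" by (simp add: lborel_distr_plus)
  also have "\<dots> = (LINT x|lborel. f (a + x))" by (subst integral_distr) auto
  finally show ?thesis by (simp add: integral_completion add.commute)
qed

text \<open>This takes the place of the divergence theorem. By translation invariance every
  difference quotient has integral zero; for steps at most 1 the quotients live in one ball and are
  bounded by the mean value theorem, so dominated convergence yields the derivative.\<close>

theorem integral_gradient_eq_0:
  assumes w: "is_grad w W" "compsupp w"
  shows "has_bochner_integral lebesgue (\<lambda>x. W x $ i) 0"
proof -
  have cW: "continuous_on UNIV (\<lambda>x. W x $ i)"
    by (intro continuous_intros is_grad_continuous[OF w(1)])
  have sW: "compsupp (\<lambda>x. W x $ i)" using is_grad_compsupp[OF w] unfolding compsupp_def by (metis zero_index)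
  have cw: "continuous_on UNIV w" by (rule is_grad_imp_continuous[OF w(1)])
  obtain r where r: "r > 0" "\<And>x. norm x > r \<Longrightarrow> w x = 0" by (rule compsupp_obtain_pos[OF w(2)]) blast
  obtain M where M: "M \<ge> 0" "\<And>x. \<bar>W x $ i\<bar> \<le> M" using compsupp_bounded[OF cW sW] by auto
  define t where "t n = 1 / real (Suc n)" for n
  have t: "t n > 0" "t n \<le> 1" for n by (auto simp: t_def)
  have t0: "t \<longlonglongrightarrow> 0" unfolding t_def by (rule LIMSEQ_Suc[OF lim_1_over_n])
  let ?s = "\<lambda>n x. (w (x + t n *\<^sub>R axis i 1) - w x) / t n"
  have ct: "continuous_on UNIV (\<lambda>x. w (x + t n *\<^sub>R axis i 1))" for n
    by (intro continuous_on_compose2[OF cw] continuous_intros) auto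
  have st: "compsupp (\<lambda>x. w (x + t n *\<^sub>R axis i 1))" for n
    unfolding compsupp_def
  proof (intro exI allI impI)
    fix x :: "real ^ 'a" assume "norm x > r + 1"
    moreover have "norm x \<le> norm (x + t n *\<^sub>R axis i 1) + norm (t n *\<^sub>R axis i (1::real))"
      using norm_triangle_ineq4[of "x + t n *\<^sub>R axis i 1" "t n *\<^sub>R axis i 1"] by simp
    ultimately have "norm (x + t n *\<^sub>R axis i 1) > r" using t[of n] by simp
    thus "w (x + t n *\<^sub>R axis i 1) = 0" by (rule r)
  qed
  have "(LINT x|lebesgue. ?s n x) = 0" for n
    using integral_lebesgue_translate[OF cw, of "t n *\<^sub>R axis i 1"] integrable_compsupp[OF ct st] integrable_compsupp[OF cw w(2)]
    by (simp add: Bochner_Integration.integral_diff)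
  moreover have "(\<lambda>n. LINT x|lebesgue. ?s n x) \<longlonglongrightarrow> (LINT x|lebesgue. W x $ i)"
  proof (rule integral_dominated_convergence[where w = "\<lambda>x. M * indicator (cball 0 (r + 1)) x"])
    show "(\<lambda>x. W x $ i) \<in> borel_measurable lebesgue" using cW by (rule continuous_lebesgue_measurable)
    show "?s n \<in> borel_measurable lebesgue" for n
      using t[of n] by (intro continuous_lebesgue_measurable continuous_intros ct cw) auto
    show "integrable lebesgue (\<lambda>x. M * indicator (cball 0 (r + 1)) (x::real^'a))"
      by (intro integrable_mult_right integrable_indicator_cball)
    show "AE x in lebesgue. (\<lambda>n. ?s n x) \<longlonglongrightarrow> W x $ i"
    proof (rule AE_I2)
      fix x
      have "((\<lambda>s. w (x + s *\<^sub>R axis i 1)) has_real_derivative W x $ i) (at 0)"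
        using is_grad_along_line[OF w(1), of x "axis i 1" 0] by (simp add: inner_axis)
      hence "((\<lambda>h. (w (x + h *\<^sub>R axis i 1) - w x) / h) \<longlongrightarrow> W x $ i) (at 0)"
        by (simp add: DERIV_def)
      moreover have "filterlim t (at 0) sequentially"
        using t0 t by (auto simp: filterlim_at intro!: always_eventually less_imp_neq[symmetric])
      ultimately show "(\<lambda>n. ?s n x) \<longlonglongrightarrow> W x $ i" by (rule filterlim_compose)
    qed
    show "AE x in lebesgue. norm (?s n x) \<le> M * indicator (cball 0 (r + 1)) x" for n
    proof (rule AE_I2)
      fix x :: "real ^ 'a"
      show "norm (?s n x) \<le> M * indicator (cball 0 (r + 1)) x"
      proof (cases "norm x > r + 1")
        case True
        moreover have "norm x \<le> norm (x + t n *\<^sub>R axis i 1) + norm (t n *\<^sub>R axis i (1::real))"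
          using norm_triangle_ineq4[of "x + t n *\<^sub>R axis i 1" "t n *\<^sub>R axis i 1"] by simp
        ultimately have "norm (x + t n *\<^sub>R axis i 1) > r" using t[of n] by simp
        with True show ?thesis using r M by simp
      next
        case False
        have "\<exists>s>0. s < t n \<and> w (x + t n *\<^sub>R axis i 1) - w (x + 0 *\<^sub>R axis i 1) = (t n - 0) * (W (x + s *\<^sub>R axis i 1) $ i)"
          using is_grad_along_line[OF w(1), where v = "axis i 1"] t[of n]
          by (intro MVT2) (auto simp: inner_axis)
        then obtain s where "w (x + t n *\<^sub>R axis i 1) - w x = t n * (W (x + s *\<^sub>R axis i 1) $ i)" by auto
        hence "?s n x = W (x + s *\<^sub>R axis i 1) $ i" using t[of n] by simp
        thus ?thesis using M(2) False by simp
      qed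
    qed
  qed
  ultimately have "(LINT x|lebesgue. W x $ i) = 0" by (simp only: LIMSEQ_const_iff)
  thus ?thesis using integrable_compsupp[OF cW sW] by (simp add: has_bochner_integral_iff)
qed

section \<open>A smooth mollifier\<close>

text \<open>\<open>flat 0\<close> is the classical function exp(-1/t) extended by zero. The powers
  of \<open>inverse t\<close> are included so that the derivative of a member is a linear
  combination of members.\<close>

definition flat :: "nat \<Rightarrow> real \<Rightarrow> real" where
  "flat n t = (if t > 0 then exp (- inverse t) * inverse t ^ n else 0)"

lemma flat_tendsto_0: "(flat n \<longlongrightarrow> 0) (at 0)"
proof -
  have "((\<lambda>t. inverse t ^ n / exp (inverse t)) \<longlongrightarrow> (0::real)) (at_right 0)"
    by (rule filterlim_compose[OF tendsto_power_div_exp_0 filterlim_inverse_at_top_right])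
  moreover have "\<forall>\<^sub>F t in at_right 0. inverse t ^ n / exp (inverse t) = flat n (t::real)"
    by (auto simp: eventually_at_right_field flat_def exp_minus field_simps intro!: exI[of _ 1])
  ultimately have "(flat n \<longlongrightarrow> 0) (at_right 0)"
    by (rule Lim_transform_eventually)
  moreover have "(flat n \<longlongrightarrow> 0) (at_left 0)"
    by (rule Lim_transform_eventually[OF tendsto_const])
      (auto simp: eventually_at_left_field flat_def intro!: exI[of _ "-1"])
  ultimately show ?thesis by (simp add: filterlim_split_at)
qed

lemma flat_has_derivative: "(flat n has_real_derivative flat (n + 2) t - real n * flat (n + 1) t) (at t)"
proof -
  consider "t < 0" | "t = 0" | "t > 0" by linarith
  thus ?thesis
  proof cases
    case 1
    have "((\<lambda>t. 0) has_real_derivative 0) (at t)" by simp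
    hence "(flat n has_real_derivative 0) (at t)"
      by (rule has_field_derivative_transform_within_open[of _ _ _ "{..<0}"]) (use 1 in \<open>auto simp: flat_def\<close>)
    thus ?thesis using 1 by (simp add: flat_def)
  next
    case 2
    \<comment> \<open>Dividing by \<open>h\<close> raises the exponent by one: the difference
      quotient at 0 belongs to the family, and its limit is known from
      \<open>flat_tendsto_0\<close>.\<close>
    have "(\<lambda>h. (flat n (0 + h) - flat n 0) / h) = flat (n + 1)"
      by (auto simp: flat_def divide_inverse fun_eq_iff)
    thus ?thesis using flat_tendsto_0[of "n + 1"] 2 by (simp add: DERIV_def flat_def)
  next
    case 3
    have "((\<lambda>t. exp (- inverse t) * inverse t ^ n) has_real_derivative flat (n + 2) t - real n * flat (n + 1) t) (at t)"
      using 3 by (auto intro!: derivative_eq_intros simp: flat_def power2_eq_square algebra_simps)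
        (cases n; simp add: algebra_simps)
    thus ?thesis
      by (rule has_field_derivative_transform_within_open[of _ _ _ "{0<..}"]) (use 3 in \<open>auto simp: flat_def\<close>)
  qed
qed

lemma flat_continuous: "continuous_on UNIV (flat n)"
  using flat_has_derivative DERIV_continuous continuous_at_imp_continuous_on by blast

text \<open>An algebra of functions that is closed under partial derivatives and contains a bump function
  supported in the ball of radius \<open>r\<close> around \<open>a\<close>.\<close>

inductive bump_alg :: "real ^ 'n::finite \<Rightarrow> real \<Rightarrow> (real ^ 'n \<Rightarrow> real) \<Rightarrow> bool" for a r where
  const: "bump_alg a r (\<lambda>x. c)"
| coord: "bump_alg a r (\<lambda>x. x $ i)"
| flat: "bump_alg a r (\<lambda>x. flat n (r\<^sup>2 - (norm (x - a))\<^sup>2))"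
| add: "bump_alg a r f \<Longrightarrow> bump_alg a r g \<Longrightarrow> bump_alg a r (\<lambda>x. f x + g x)"
| mult: "bump_alg a r f \<Longrightarrow> bump_alg a r g \<Longrightarrow> bump_alg a r (\<lambda>x. f x * g x)"

lemma bump_alg_grad:
  "bump_alg a r f \<Longrightarrow> \<exists>G. is_grad f G \<and> (\<forall>i. bump_alg a r (\<lambda>x. G x $ i))"
proof (induction rule: bump_alg.induct)
  case (const c)
  show ?case by (rule exI[of _ "\<lambda>x. 0"]) (simp add: is_grad_const bump_alg.const)
next
  case (coord i)
  show ?case by (rule exI[of _ "\<lambda>x. axis i 1"]) (simp add: is_grad_coord bump_alg.const)
next
  case (flat n)
  have "is_grad (\<lambda>x. r\<^sup>2 - (norm (x - a))\<^sup>2) (\<lambda>x. - 2 *\<^sub>R (x - a))"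
    unfolding power2_norm_eq_inner
    by (rule is_gradI) (auto intro!: derivative_eq_intros continuous_intros simp: inner_commute inner_diff_left inner_diff_right algebra_simps)
  hence "is_grad (\<lambda>x. flat n (r\<^sup>2 - (norm (x - a))\<^sup>2))
    (\<lambda>x. (flat (n + 2) (r\<^sup>2 - (norm (x - a))\<^sup>2) - real n * flat (n + 1) (r\<^sup>2 - (norm (x - a))\<^sup>2)) *\<^sub>R (- 2 *\<^sub>R (x - a)))"
    by (rule is_grad_compose[OF _ flat_has_derivative]) (intro continuous_intros flat_continuous)
  \<comment> \<open>The algebra has only sums and products as operations, so the differences in the
    gradient are written with negative constants here and matched afterwards.\<close>
  moreover have "bump_alg a r (\<lambda>x. (flat (n + 2) (r\<^sup>2 - (norm (x - a))\<^sup>2) + (- real n) * flat (n + 1) (r\<^sup>2 - (norm (x - a))\<^sup>2))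
      * (- 2 * x $ i + 2 * a $ i))" for i
    by (intro bump_alg.intros)
  moreover have "(c * (- 2 * x $ i + 2 * a $ i)) = (c *\<^sub>R (- 2 *\<^sub>R (x - a))) $ i" for c x i
    by (simp add: algebra_simps)
  ultimately show ?case by (simp only: add_uminus_conv_diff mult_minus_left) blast
next
  case (add f g)
  then obtain F G where "is_grad f F" "\<forall>i. bump_alg a r (\<lambda>x. F x $ i)" "is_grad g G" "\<forall>i. bump_alg a r (\<lambda>x. G x $ i)" by blast
  thus ?case by (intro exI[of _ "\<lambda>x. F x + G x"]) (auto intro: is_grad_add bump_alg.add)
next
  case (mult f g)
  then obtain F G where "is_grad f F" "\<forall>i. bump_alg a r (\<lambda>x. F x $ i)" "is_grad g G" "\<forall>i. bump_alg a r (\<lambda>x. G x $ i)" by blast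
  thus ?case by (intro exI[of _ "\<lambda>x. f x *\<^sub>R G x + g x *\<^sub>R F x"])
    (auto intro!: is_grad_mult bump_alg.add bump_alg.mult simp: mult.hyps)
qed

lemma bump_alg_Ck: "bump_alg a r f \<Longrightarrow> Ck k f"
proof (induction k arbitrary: f)
  case 0
  thus ?case using bump_alg_grad is_grad_imp_continuous by fastforce
next
  case (Suc k)
  obtain G where G: "is_grad f G" "\<And>i. bump_alg a r (\<lambda>x. G x $ i)" using bump_alg_grad[OF Suc.prems] by blast
  have "partial_deriv i f = (\<lambda>x. G x $ i)" for i by (rule ext, rule is_grad_partial_deriv[OF G(1)])
  thus ?case using Suc.IH[OF G(2)] G(1) by (auto simp: is_grad_def differentiable_def)
qed

text \<open>Each extra property has its use: evenness turns the reflected kernel into a translate,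
  the second gradients give mollified functions a Hessian, and testing the weak equations with the
  reflected kernel turns them into pointwise statements about convolutions.\<close>

theorem mollifier_exists:
  fixes r :: real
  assumes r: "r > 0"
  obtains \<rho> :: "real ^ 'n::finite \<Rightarrow> real" and G H
  where "\<And>x. \<rho> x \<ge> 0" "\<And>x. \<rho> (- x) = \<rho> x" "\<And>x. norm x > r \<Longrightarrow> \<rho> x = 0" "has_bochner_integral lebesgue \<rho> 1"
    "is_grad \<rho> G" "\<And>i. is_grad (\<lambda>x. G x $ i) (H i)" "\<And>x. test_function (\<lambda>y. \<rho> (x - y))"
proof -
  let ?f = "\<lambda>x::real^'n. flat 0 (r\<^sup>2 - (norm x)\<^sup>2)"
  define c where "c = (LINT x|lebesgue. ?f x)"
  have alg: "bump_alg 0 r ?f" using bump_alg.flat[of 0 r 0] by simp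
  have supp: "?f x = 0" if "norm x \<ge> r" for x
  proof -
    have "r\<^sup>2 \<le> (norm x)\<^sup>2" using that r by (intro power_mono) auto
    thus ?thesis by (simp add: flat_def)
  qed
  have f0: "?f x \<ge> 0" for x by (auto simp: flat_def)
  have pos: "?f x > 0" if "x \<in> ball 0 r" for x
    using that r power_strict_mono[of "norm x" r 2] by (auto simp: flat_def)
  have cont: "continuous_on UNIV ?f" using bump_alg_Ck[OF alg, of 0] by simp
  have "compsupp ?f" using supp by (auto simp: compsupp_def intro!: exI[of _ r])
  hence int: "integrable lebesgue ?f" using cont by (intro integrable_compsupp)
  have "c \<noteq> 0"
  proof
    assume "c = 0"
    hence "AE x in lebesgue. ?f x = 0"
      using integral_nonneg_eq_0_iff_AE[OF int] f0 unfolding c_def by auto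
    note ae = this
    have nb: "x \<notin> ball 0 r" if "?f x = 0" for x using pos[of x] that by force
    from ae have "AE x in lebesgue. (x::real^'n) \<notin> ball 0 r"
      by (elim AE_mp) (intro AE_I2 impI nb)
    hence "ball (0::real^'n) r \<in> null_sets lebesgue"
      by (simp add: AE_iff_null_sets)
    hence "negligible (ball (0::real^'n) r)" by (simp add: negligible_iff_null_sets)
    thus False using open_not_negligible[of "ball (0::real^'n) r"] r by auto
  qed
  moreover have "c \<ge> 0" unfolding c_def using f0 by simp
  ultimately have c: "c > 0" by simp
  define \<rho> where "\<rho> x = inverse c * ?f x" for x
  have alg\<rho>: "bump_alg 0 r \<rho>" unfolding \<rho>_def by (intro bump_alg.mult bump_alg.const alg)
  then obtain G where G: "is_grad \<rho> G" "\<And>i. bump_alg 0 r (\<lambda>x. G x $ i)" using bump_alg_grad by blast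
  have "\<forall>i. \<exists>H. is_grad (\<lambda>x. G x $ i) H" using bump_alg_grad[OF G(2)] by blast
  then obtain H where H: "\<And>i. is_grad (\<lambda>x. G x $ i) (H i)" by metis
  have test: "test_function (\<lambda>y. \<rho> (x - y))" for x
    unfolding test_function_def
  proof
    have "bump_alg x r (\<lambda>y. inverse c * flat 0 (r\<^sup>2 - (norm (y - x))\<^sup>2))"
      by (intro bump_alg.intros)
    moreover have "(\<lambda>y. inverse c * flat 0 (r\<^sup>2 - (norm (y - x))\<^sup>2)) = (\<lambda>y. \<rho> (x - y))"
      by (simp add: \<rho>_def norm_minus_commute)
    ultimately show "\<forall>k. Ck k (\<lambda>y. \<rho> (x - y))" using bump_alg_Ck by metis
    have "{y. \<rho> (x - y) \<noteq> 0} \<subseteq> cball x r"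
      using supp by (force simp: \<rho>_def dist_norm)
    thus "compact (closure {y. \<rho> (x - y) \<noteq> 0})"
      using bounded_subset bounded_cball by (auto simp: compact_closure)
  qed
  show ?thesis
  proof (rule that[OF _ _ _ _ G(1) H test])
    show "\<rho> (- x) = \<rho> x" for x by (simp add: \<rho>_def)
    show "\<rho> x \<ge> 0" for x using c f0 by (simp add: \<rho>_def)
    show "\<rho> x = 0" if "norm x > r" for x using supp that by (simp add: \<rho>_def)
    show "has_bochner_integral lebesgue \<rho> 1"
      using int c unfolding \<rho>_def by (auto simp: has_bochner_integral_iff c_def)
  qed
qed

section \<open>Mollification\<close>

text \<open>All dependence on \<open>x\<close> sits in the kernel, so smoothness comes from
  \<open>\<phi>\<close> while \<open>g\<close> need only be integrable.\<close>

definition mol :: "('a::euclidean_space \<Rightarrow> real) \<Rightarrow> ('a \<Rightarrow> real) \<Rightarrow> 'a \<Rightarrow> real" where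
  "mol \<phi> g x = (LINT y|lebesgue. \<phi> (x - y) * g y)"

lemma compsupp_reflect:
  fixes \<phi> :: "'a::real_normed_vector \<Rightarrow> 'b::zero"
  assumes "compsupp \<phi>"
  shows "compsupp (\<lambda>y. \<phi> (x - y))"
proof -
  obtain r where r: "\<And>x. norm x > r \<Longrightarrow> \<phi> x = 0" using assms by (auto simp: compsupp_def)
  have "\<phi> (x - y) = 0" if "norm y > r + norm x" for y
    using r[of "x - y"] that norm_triangle_ineq2[of y x] by (simp add: norm_minus_commute)
  thus ?thesis by (auto simp: compsupp_def)
qed

lemma continuous_reflect: "continuous_on UNIV \<phi> \<Longrightarrow> continuous_on UNIV (\<lambda>y. \<phi> (x - y))"
  for x :: "'a::real_normed_vector"
  by (rule continuous_on_compose2[of UNIV \<phi>]) (auto intro!: continuous_intros)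

lemma mol_integrand_integrable:
  fixes \<phi> :: "'a::euclidean_space \<Rightarrow> real"
  assumes "continuous_on UNIV \<phi>" "compsupp \<phi>" "integrable lebesgue g"
  shows "integrable lebesgue (\<lambda>y. \<phi> (x - y) * g y)"
  by (intro integrable_compsupp_mult continuous_reflect compsupp_reflect assms)

lemma mol_continuous:
  fixes \<phi> :: "'a::euclidean_space \<Rightarrow> real"
  assumes \<phi>: "continuous_on UNIV \<phi>" "compsupp \<phi>" and g: "integrable lebesgue g"
  shows "continuous_on UNIV (mol \<phi> g)"
proof (intro continuous_at_imp_continuous_on ballI)
  obtain B where B: "B \<ge> 0" "\<And>x. norm (\<phi> x) \<le> B" using compsupp_bounded[OF \<phi>] by blast
  fix x :: 'a
  show "isCont (mol \<phi> g) x"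
    unfolding continuous_at_sequentially
  proof (intro allI impI)
    fix X assume X: "X \<longlonglongrightarrow> x"
    show "(mol \<phi> g \<circ> X) \<longlonglongrightarrow> mol \<phi> g x"
      unfolding mol_def comp_def
    proof (rule integral_dominated_convergence[where w = "\<lambda>y. B * \<bar>g y\<bar>"])
      show "AE y in lebesgue. (\<lambda>n. \<phi> (X n - y) * g y) \<longlonglongrightarrow> \<phi> (x - y) * g y"
      proof (rule AE_I2)
        fix y
        have "isCont \<phi> (x - y)" using \<phi>(1) by (simp add: continuous_on_eq_continuous_at)
        moreover have "(\<lambda>n. X n - y) \<longlonglongrightarrow> x - y" by (intro tendsto_intros X)
        ultimately have "(\<lambda>n. \<phi> (X n - y)) \<longlonglongrightarrow> \<phi> (x - y)" by (rule isCont_tendsto_compose)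
        thus "(\<lambda>n. \<phi> (X n - y) * g y) \<longlonglongrightarrow> \<phi> (x - y) * g y" by (intro tendsto_intros)
      qed
      show "integrable lebesgue (\<lambda>y. B * \<bar>g y\<bar>)" using g by auto
      show "AE y in lebesgue. norm (\<phi> (X n - y) * g y) \<le> B * \<bar>g y\<bar>" for n
        using B by (auto simp: abs_mult intro!: mult_right_mono AE_I2)
    qed (use mol_integrand_integrable[OF \<phi> g] in \<open>auto intro: borel_measurable_integrable\<close>)
  qed
qed

lemma is_grad_lipschitz:
  assumes "is_grad \<phi> \<Phi>" "\<And>x. norm (\<Phi> x) \<le> B"
  shows "\<bar>\<phi> a - \<phi> b\<bar> \<le> B * norm (a - b)"
proof -
  have "onorm (\<lambda>h. \<Phi> x \<bullet> h) \<le> B" for x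
    using assms(2)[of x] order_trans[OF norm_ge_zero assms(2)[of x]]
    by (intro onorm_bound) (auto intro!: order_trans[OF Cauchy_Schwarz_ineq2] mult_right_mono)
  from differentiable_bound[of UNIV \<phi> "\<lambda>x h. \<Phi> x \<bullet> h" B a b, OF _ _ this]
  show ?thesis using is_grad_derivD[OF assms(1)] by auto
qed

text \<open>Differentiation under the integral. The first-order remainder of the kernel over the
  length of the increment is at most twice a bound for its gradient, which gives the majorant
  \<open>2 * B * \<bar>g y\<bar>\<close>; the limit is taken along sequences so that dominated
  convergence applies.\<close>

theorem mol_is_grad:
  assumes \<phi>: "is_grad \<phi> \<Phi>" "compsupp \<phi>" and g: "integrable lebesgue g"
  shows "is_grad (mol \<phi> g) (\<lambda>x. \<chi> i. mol (\<lambda>z. \<Phi> z $ i) g x)"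
proof (rule is_gradI)
  have c\<phi>: "continuous_on UNIV \<phi>" by (rule is_grad_imp_continuous[OF \<phi>(1)])
  have s\<Phi>: "compsupp \<Phi>" by (rule is_grad_compsupp[OF \<phi>])
  have c\<Phi>: "continuous_on UNIV \<Phi>" by (rule is_grad_continuous[OF \<phi>(1)])
  have ci: "continuous_on UNIV (\<lambda>z. \<Phi> z $ i)" for i
    by (intro continuous_intros c\<Phi>)
  have si: "compsupp (\<lambda>z. \<Phi> z $ i)" for i
    using s\<Phi> unfolding compsupp_def by (metis zero_index)
  show "continuous_on UNIV (\<lambda>x. \<chi> i. mol (\<lambda>z. \<Phi> z $ i) g x)"
    by (intro continuous_on_vec_lambda mol_continuous ci si g)
  obtain B where B: "B \<ge> 0" "\<And>x. norm (\<Phi> x) \<le> B" using compsupp_bounded[OF c\<Phi> s\<Phi>] by blast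
  fix x
  let ?D = "\<lambda>h. (\<chi> i. mol (\<lambda>z. \<Phi> z $ i) g x) \<bullet> h"
  have D: "?D h = (LINT y|lebesgue. (\<Phi> (x - y) \<bullet> h) * g y)" for h
  proof -
    have "?D h = (\<Sum>i\<in>UNIV. LINT y|lebesgue. h $ i * (\<Phi> (x - y) $ i * g y))"
      by (simp add: inner_vec_def mol_def mult.commute)
    also have "\<dots> = (LINT y|lebesgue. (\<Sum>i\<in>UNIV. h $ i * (\<Phi> (x - y) $ i * g y)))"
      by (rule Bochner_Integration.integral_sum[symmetric])
        (intro integrable_mult_right mol_integrand_integrable[OF ci si g])
    finally show ?thesis
      by (simp add: inner_vec_def sum_distrib_left sum_distrib_right algebra_simps)
  qed
  have intD: "integrable lebesgue (\<lambda>y. (\<Phi> (x - y) \<bullet> h) * g y)" for h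
  proof (rule mol_integrand_integrable[where \<phi> = "\<lambda>z. \<Phi> z \<bullet> h"])
    show "continuous_on UNIV (\<lambda>z. \<Phi> z \<bullet> h)" by (intro continuous_intros c\<Phi>)
    show "compsupp (\<lambda>z. \<Phi> z \<bullet> h)" using s\<Phi> unfolding compsupp_def by (metis inner_zero_left)
  qed (rule g)
  note int\<phi> = mol_integrand_integrable[OF c\<phi> \<phi>(2) g]
  show "(mol \<phi> g has_derivative ?D) (at x)"
    unfolding has_derivative_iff_norm tendsto_at_iff_sequentially
  proof (intro conjI allI impI)
    show "bounded_linear ?D" by (rule bounded_linear_inner_right)
    fix X :: "nat \<Rightarrow> real ^ 'a" assume Xn: "\<forall>i. X i \<in> UNIV - {x}" and X: "X \<longlonglongrightarrow> x"
    have ne: "norm (X n - x) > 0" for n using Xn by auto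
    let ?q = "\<lambda>n y. (\<phi> (X n - y) - \<phi> (x - y) - \<Phi> (x - y) \<bullet> (X n - x)) / norm (X n - x) * g y"
    have q: "?q n y = (\<phi> (X n - y) * g y - \<phi> (x - y) * g y - (\<Phi> (x - y) \<bullet> (X n - x)) * g y) / norm (X n - x)" for n y
      by (simp add: algebra_simps diff_divide_distrib)
    have "(mol \<phi> g (X n) - mol \<phi> g x - ?D (X n - x)) / norm (X n - x) = (LINT y|lebesgue. ?q n y)" for n
    proof -
      have "mol \<phi> g (X n) - mol \<phi> g x - ?D (X n - x)
        = (LINT y|lebesgue. \<phi> (X n - y) * g y - \<phi> (x - y) * g y - (\<Phi> (x - y) \<bullet> (X n - x)) * g y)"
        unfolding D by (simp add: mol_def Bochner_Integration.integral_diff int\<phi> intD)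
      thus ?thesis unfolding q by (simp only: integral_divide_zero)
    qed
    moreover have "(\<lambda>n. LINT y|lebesgue. ?q n y) \<longlonglongrightarrow> (LINT y|lebesgue. 0 * g y)"
    proof (rule integral_dominated_convergence[where w = "\<lambda>y. 2 * B * \<bar>g y\<bar>"])
      show "integrable lebesgue (\<lambda>y. 2 * B * \<bar>g y\<bar>)" using g by auto
      have "integrable lebesgue (\<lambda>y. (\<phi> (X n - y) * g y - \<phi> (x - y) * g y - (\<Phi> (x - y) \<bullet> (X n - x)) * g y) / norm (X n - x))" for n
        by (intro Bochner_Integration.integrable_diff integrable_divide int\<phi> intD)
      thus "?q n \<in> borel_measurable lebesgue" for n
        unfolding q by (rule borel_measurable_integrable)
      show "AE y in lebesgue. (\<lambda>n. ?q n y) \<longlonglongrightarrow> 0 * g y"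
      proof (rule AE_I2)
        fix y
        have "((\<lambda>z. norm (\<phi> z - \<phi> (x - y) - \<Phi> (x - y) \<bullet> (z - (x - y))) / norm (z - (x - y))) \<longlongrightarrow> 0) (at (x - y))"
          using is_grad_derivD[OF \<phi>(1), of "x - y"] unfolding has_derivative_iff_norm by blast
        moreover have "filterlim (\<lambda>n. X n - y) (at (x - y)) sequentially"
          unfolding filterlim_at using Xn by (auto intro!: tendsto_intros X always_eventually)
        ultimately have "(\<lambda>n. norm (\<phi> (X n - y) - \<phi> (x - y) - \<Phi> (x - y) \<bullet> ((X n - y) - (x - y))) / norm ((X n - y) - (x - y))) \<longlonglongrightarrow> 0"
          by (rule filterlim_compose)
        hence "(\<lambda>n. norm ((\<phi> (X n - y) - \<phi> (x - y) - \<Phi> (x - y) \<bullet> (X n - x)) / norm (X n - x))) \<longlonglongrightarrow> 0"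
          by (simp add: norm_divide)
        hence "(\<lambda>n. (\<phi> (X n - y) - \<phi> (x - y) - \<Phi> (x - y) \<bullet> (X n - x)) / norm (X n - x)) \<longlonglongrightarrow> 0"
          by (rule tendsto_norm_zero_cancel)
        thus "(\<lambda>n. ?q n y) \<longlonglongrightarrow> 0 * g y" by (rule tendsto_mult_right)
      qed
      show "AE y in lebesgue. norm (?q n y) \<le> 2 * B * \<bar>g y\<bar>" for n
      proof (rule AE_I2)
        fix y
        have "\<bar>\<phi> (X n - y) - \<phi> (x - y)\<bar> \<le> B * norm (X n - x)"
          using is_grad_lipschitz[OF \<phi>(1) B(2), of "X n - y" "x - y"] by simp
        moreover have "\<bar>\<Phi> (x - y) \<bullet> (X n - x)\<bar> \<le> B * norm (X n - x)"
          using Cauchy_Schwarz_ineq2[of "\<Phi> (x - y)" "X n - x"] mult_right_mono[OF B(2)[of "x - y"], of "norm (X n - x)"] by simp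
        ultimately have "\<bar>\<phi> (X n - y) - \<phi> (x - y) - \<Phi> (x - y) \<bullet> (X n - x)\<bar> \<le> 2 * B * norm (X n - x)" by linarith
        hence "\<bar>\<phi> (X n - y) - \<phi> (x - y) - \<Phi> (x - y) \<bullet> (X n - x)\<bar> / norm (X n - x) \<le> 2 * B"
          using ne[of n] by (simp add: pos_divide_le_eq)
        from mult_right_mono[OF this abs_ge_zero[of "g y"]]
        show "norm (?q n y) \<le> 2 * B * \<bar>g y\<bar>" by (simp add: abs_mult)
      qed
    qed auto
    moreover have "(LINT y|lebesgue. 0 * g y) = 0" by simp
    ultimately have "(\<lambda>n. (mol \<phi> g (X n) - mol \<phi> g x - ?D (X n - x)) / norm (X n - x)) \<longlonglongrightarrow> 0"
      by (simp only:)
    from tendsto_norm_zero[OF this]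
    show "((\<lambda>y. norm (mol \<phi> g y - mol \<phi> g x - ?D (y - x)) / norm (y - x)) \<circ> X) \<longlonglongrightarrow> 0"
      by (simp add: comp_def norm_divide)
  qed
qed

section \<open>Mollification in L1\<close>

text \<open>Tonelli will be applied on \<open>lborel\<close>, where the integrand must be measurable
  for the product of Borel algebras; a Lebesgue measurable function achieves this after a change on
  a null set.\<close>

lemma integrable_lebesgue_borel_representative:
  fixes g :: "'a::euclidean_space \<Rightarrow> real"
  assumes "integrable lebesgue g"
  obtains h where "h \<in> borel_measurable borel" "AE x in lebesgue. g x = h x"
proof -
  obtain h where h: "h \<in> borel_measurable lborel" "AE x in lborel. g x = h x"
    using completion_ex_borel_measurable_real[OF borel_measurable_integrable[OF assms]] by blast
  thus ?thesis by (intro that[of h]) (auto intro: AE_completion)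
qed

text \<open>Pointwise, the mollification is at most the mollification of the absolute value. Tonelli
  then exchanges the integrals, and the translated kernel has mass one in its other
  variable.\<close>

theorem mol_L1_bound:
  fixes \<rho> g :: "'a::euclidean_space \<Rightarrow> real"
  assumes c: "continuous_on UNIV \<rho>" "compsupp \<rho>" and \<rho>0: "\<And>x. \<rho> x \<ge> 0"
    and \<rho>1: "has_bochner_integral lebesgue \<rho> 1" and g: "integrable lebesgue g"
  shows "integrable lebesgue (mol \<rho> g)" "(LINT x|lebesgue. \<bar>mol \<rho> g x\<bar>) \<le> (LINT x|lebesgue. \<bar>g x\<bar>)"
proof -
  obtain h where h[measurable]: "h \<in> borel_measurable borel" and gh: "AE x in lebesgue. g x = h x"
    using integrable_lebesgue_borel_representative[OF g] by blast
  have [measurable]: "\<rho> \<in> borel_measurable borel" using c(1) by (rule borel_measurable_continuous_onI)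
  have mm: "mol \<rho> g \<in> borel_measurable borel"
    by (rule borel_measurable_continuous_onI[OF mol_continuous[OF c g]])
  have one: "(\<integral>\<^sup>+x. ennreal (\<rho> (x - y)) \<partial>lborel) = 1" for y
  proof -
    have ct: "continuous_on UNIV (\<lambda>x. \<rho> (x - y))"
      by (rule continuous_on_compose2[OF c(1)]) (auto intro!: continuous_intros)
    have "compsupp (\<lambda>x. \<rho> (x - y))"
    proof -
      obtain r where r: "\<And>x. norm x > r \<Longrightarrow> \<rho> x = 0" using c(2) by (auto simp: compsupp_def)
      have "\<rho> (x - y) = 0" if "norm x > r + norm y" for x
        using r[of "x - y"] that norm_triangle_ineq2[of x y] by simp
      thus ?thesis by (auto simp: compsupp_def)
    qed
    with ct have "integrable lebesgue (\<lambda>x. \<rho> (x - y))" by (rule integrable_compsupp)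
    hence i: "integrable lborel (\<lambda>x. \<rho> (x - y))" by (subst (asm) integrable_completion) auto
    have "(LINT x|lebesgue. \<rho> (x - y)) = 1"
      using integral_lebesgue_translate[OF c(1), of "- y"] \<rho>1 by (simp add: has_bochner_integral_iff)
    hence "(LINT x|lborel. \<rho> (x - y)) = 1" by (simp add: integral_completion)
    thus ?thesis using nn_integral_eq_integral[OF i] \<rho>0 by simp
  qed
  have pt: "ennreal \<bar>mol \<rho> g x\<bar> \<le> (\<integral>\<^sup>+y. ennreal (\<rho> (x - y)) * ennreal \<bar>h y\<bar> \<partial>lborel)" for x
  proof -
    have i: "integrable lebesgue (\<lambda>y. \<rho> (x - y) * g y)" by (rule mol_integrand_integrable[OF c g])
    have "ennreal \<bar>mol \<rho> g x\<bar> \<le> (\<integral>\<^sup>+y. ennreal \<bar>\<rho> (x - y) * g y\<bar> \<partial>lebesgue)"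
      using integral_norm_bound_ennreal[OF i] by (simp add: mol_def)
    also have "\<dots> = (\<integral>\<^sup>+y. ennreal (\<rho> (x - y)) * ennreal \<bar>h y\<bar> \<partial>lebesgue)"
      by (rule nn_integral_cong_AE) (use gh in \<open>auto elim!: eventually_mono simp: abs_mult \<rho>0 ennreal_mult\<close>)
    also have "\<dots> = (\<integral>\<^sup>+y. ennreal (\<rho> (x - y)) * ennreal \<bar>h y\<bar> \<partial>lborel)"
      by (rule nn_integral_completion)
    finally show ?thesis .
  qed
  have "(\<integral>\<^sup>+x. ennreal \<bar>mol \<rho> g x\<bar> \<partial>lborel)
      \<le> (\<integral>\<^sup>+x. \<integral>\<^sup>+y. ennreal (\<rho> (x - y)) * ennreal \<bar>h y\<bar> \<partial>lborel \<partial>lborel)"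
    by (rule nn_integral_mono) (rule pt)
  also have "\<dots> = (\<integral>\<^sup>+y. \<integral>\<^sup>+x. ennreal (\<rho> (x - y)) * ennreal \<bar>h y\<bar> \<partial>lborel \<partial>lborel)"
    by (rule lborel_pair.Fubini') measurable
  also have "\<dots> = (\<integral>\<^sup>+y. ennreal \<bar>h y\<bar> \<partial>lborel)"
    by (simp add: nn_integral_multc one)
  also have "\<dots> = (\<integral>\<^sup>+y. ennreal \<bar>h y\<bar> \<partial>lebesgue)" by (simp add: nn_integral_completion)
  also have "\<dots> = (\<integral>\<^sup>+y. ennreal \<bar>g y\<bar> \<partial>lebesgue)"
    by (rule nn_integral_cong_AE) (use gh in \<open>auto elim!: eventually_mono\<close>)
  also have "\<dots> = ennreal (LINT y|lebesgue. \<bar>g y\<bar>)"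
    by (rule nn_integral_eq_integral) (use g in auto)
  finally have le: "(\<integral>\<^sup>+x. ennreal \<bar>mol \<rho> g x\<bar> \<partial>lborel) \<le> ennreal (LINT y|lebesgue. \<bar>g y\<bar>)" .
  have "integrable lborel (mol \<rho> g)"
    unfolding integrable_iff_bounded using mm le by (auto intro: le_less_trans)
  thus int: "integrable lebesgue (mol \<rho> g)" by (rule integrable_completion[THEN iffD2, rotated]) (use mm in auto)
  have "ennreal (LINT x|lebesgue. \<bar>mol \<rho> g x\<bar>) = (\<integral>\<^sup>+x. ennreal \<bar>mol \<rho> g x\<bar> \<partial>lebesgue)"
    by (rule nn_integral_eq_integral[symmetric]) (use int in auto)
  also have "\<dots> = (\<integral>\<^sup>+x. ennreal \<bar>mol \<rho> g x\<bar> \<partial>lborel)"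
    by (rule nn_integral_completion)
  finally have "ennreal (LINT x|lebesgue. \<bar>mol \<rho> g x\<bar>) \<le> ennreal (LINT x|lebesgue. \<bar>g x\<bar>)"
    using le by simp
  thus "(LINT x|lebesgue. \<bar>mol \<rho> g x\<bar>) \<le> (LINT x|lebesgue. \<bar>g x\<bar>)"
    by (subst (asm) ennreal_le_iff) auto
qed

text \<open>Two truncations make \<open>g\<close> bounded (\<open>clip\<close>) and compactly
  supported (\<open>cut\<close>) at a small L1 cost. Lebesgue measurability then provides continuous
  functions converging to \<open>g\<close> off a negligible set.\<close>

theorem L1_approx_continuous_compsupp:
  fixes g :: "'a::euclidean_space \<Rightarrow> real"
  assumes g: "integrable lebesgue g" and e: "e > 0"
  obtains w where "continuous_on UNIV w" "compsupp w" "(LINT x|lebesgue. \<bar>g x - w x\<bar>) < e"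
proof -
  have "g measurable_on UNIV"
    using lebesgue_measurable_imp_measurable_on[of g UNIV] borel_measurable_integrable[OF g] by simp
  then obtain N W where N: "negligible N" and W: "\<And>n. continuous_on UNIV (W n)"
    and lim: "\<And>x. x \<notin> N \<Longrightarrow> (\<lambda>n. W n x) \<longlonglongrightarrow> g x"
    unfolding measurable_on_def by auto
  have N0: "AE x in lebesgue. x \<notin> N" using N by (simp add: AE_not_in negligible_iff_null_sets)
  define clip where "clip M s = max (- M) (min M s)" for M s :: real
  define cut where "cut M x = max 0 (min 1 (M + 1 - norm x))" for M :: real and x :: 'a
  have cut01: "0 \<le> cut M x" "cut M x \<le> 1" for M x by (auto simp: cut_def)
  have clipM: "\<bar>clip M s\<bar> \<le> M" if "M \<ge> 0" for M s using that by (auto simp: clip_def)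
  have clips: "\<bar>clip M s\<bar> \<le> \<bar>s\<bar>" if "M \<ge> 0" for M s using that by (auto simp: clip_def)
  have cc: "continuous_on UNIV (cut M)" for M
    unfolding cut_def by (intro continuous_intros)
  have sc: "compsupp (cut M)" for M by (auto simp: compsupp_def cut_def intro!: exI[of _ "M + 1"])
  have gm: "g \<in> borel_measurable lebesgue" using g by auto
  let ?h = "\<lambda>M x. cut (real M) x * clip (real M) (g x)"
  have hm: "?h M \<in> borel_measurable lebesgue" for M
    unfolding clip_def using gm continuous_lebesgue_measurable[OF cc] by auto
  have "(\<lambda>M. LINT x|lebesgue. \<bar>g x - ?h M x\<bar>) \<longlonglongrightarrow> (LINT x|lebesgue. (0::real) * (0 * g x))"
  proof (rule integral_dominated_convergence[where w = "\<lambda>x. 2 * \<bar>g x\<bar>"])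
    show "integrable lebesgue (\<lambda>x. 2 * \<bar>g x\<bar>)" using g by auto
    show "(\<lambda>x. \<bar>g x - ?h M x\<bar>) \<in> borel_measurable lebesgue" for M using hm gm by auto
    show "AE x in lebesgue. (\<lambda>M. \<bar>g x - ?h M x\<bar>) \<longlonglongrightarrow> 0 * (0 * g x)"
    proof (rule AE_I2)
      fix x
      obtain K :: nat where K: "norm x + \<bar>g x\<bar> \<le> real K" using real_arch_simple by blast
      have "\<bar>g x - ?h M x\<bar> = 0" if "M \<ge> K" for M
      proof -
        have "norm x + \<bar>g x\<bar> \<le> real M" using K that by linarith
        hence "cut (real M) x = 1" "clip (real M) (g x) = g x"
          unfolding cut_def clip_def using norm_ge_zero[of x] by linarith+
        thus ?thesis by simp
      qed
      hence "\<forall>\<^sub>F M in sequentially. 0 = \<bar>g x - ?h M x\<bar>" by (auto simp: eventually_sequentially)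
      thus "(\<lambda>M. \<bar>g x - ?h M x\<bar>) \<longlonglongrightarrow> 0 * (0 * g x)" by (auto intro: Lim_transform_eventually[OF tendsto_const])
    qed
    show "AE x in lebesgue. norm \<bar>g x - ?h M x\<bar> \<le> 2 * \<bar>g x\<bar>" for M
    proof (rule AE_I2)
      fix x
      have "\<bar>?h M x\<bar> \<le> 1 * \<bar>g x\<bar>"
        unfolding abs_mult using cut01[of M x] clips[of M "g x"] by (intro mult_mono) auto
      thus "norm \<bar>g x - ?h M x\<bar> \<le> 2 * \<bar>g x\<bar>" by auto
    qed
  qed auto
  hence "(\<lambda>M. LINT x|lebesgue. \<bar>g x - ?h M x\<bar>) \<longlonglongrightarrow> 0" by simp
  hence "\<forall>\<^sub>F M in sequentially. (LINT x|lebesgue. \<bar>g x - ?h M x\<bar>) < e / 2"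
    by (rule order_tendstoD) (use e in simp)
  then obtain M where M: "(LINT x|lebesgue. \<bar>g x - ?h M x\<bar>) < e / 2" by (meson eventually_happens sequentially_bot)
  \<comment> \<open>The continuous approximants come without a common bound. Giving them the same
    truncation as \<open>g\<close> provides the majorant \<open>real M * cut (real M) x\<close> and
    compact support, and preserves pointwise convergence because \<open>clip\<close> is
    continuous.\<close>
  let ?w = "\<lambda>n x. cut (real M) x * clip (real M) (W n x)"
  have cw: "continuous_on UNIV (?w n)" for n
    unfolding clip_def by (intro continuous_intros cc W)
  have sw: "compsupp (?w n)" for n by (rule compsupp_mult_left[OF sc])
  have dom: "integrable lebesgue (\<lambda>x. (real M) * cut (real M) x)"
    using integrable_compsupp[OF cc sc] by auto
  have wb: "\<bar>?w n x\<bar> \<le> real M * cut (real M) x" for n x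
    using cut01[of M x] clipM[of M "W n x"] by (auto simp: abs_mult mult.commute[of "real M"] intro!: mult_left_mono)
  have hb: "\<bar>?h M x\<bar> \<le> real M * cut (real M) x" for x
    using cut01[of M x] clipM[of M "g x"] by (auto simp: abs_mult mult.commute[of "real M"] intro!: mult_left_mono)
  have hi: "integrable lebesgue (?h M)"
    by (rule Bochner_Integration.integrable_bound[OF dom hm]) (use hb in \<open>auto intro!: AE_I2 order_trans[OF _ abs_ge_self]\<close>)
  have "(\<lambda>n. LINT x|lebesgue. \<bar>?h M x - ?w n x\<bar>) \<longlonglongrightarrow> (LINT x|lebesgue. (0::real) * (0 * g x))"
  proof (rule integral_dominated_convergence[where w = "\<lambda>x. 2 * (real M * cut (real M) x)"])
    show "integrable lebesgue (\<lambda>x. 2 * (real M * cut (real M) x))" using dom by (rule integrable_mult_right)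
    show "(\<lambda>x. \<bar>?h M x - ?w n x\<bar>) \<in> borel_measurable lebesgue" for n
      using hm continuous_lebesgue_measurable[OF cw] by auto
    show "AE x in lebesgue. (\<lambda>n. \<bar>?h M x - ?w n x\<bar>) \<longlonglongrightarrow> 0 * (0 * g x)"
      using N0
    proof eventually_elim
      case (elim x)
      have "(\<lambda>n. \<bar>?h M x - ?w n x\<bar>) \<longlonglongrightarrow> \<bar>?h M x - ?h M x\<bar>"
        unfolding clip_def by (intro tendsto_intros lim elim)
      thus ?case by simp
    qed
    show "AE x in lebesgue. norm \<bar>?h M x - ?w n x\<bar> \<le> 2 * (real M * cut (real M) x)" for n
    proof (rule AE_I2)
      fix x show "norm \<bar>?h M x - ?w n x\<bar> \<le> 2 * (real M * cut (real M) x)"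
        using wb[of x n] hb[of x] unfolding real_norm_def abs_abs by linarith
    qed
  qed auto
  hence "(\<lambda>n. LINT x|lebesgue. \<bar>?h M x - ?w n x\<bar>) \<longlonglongrightarrow> 0" by simp
  hence "\<forall>\<^sub>F n in sequentially. (LINT x|lebesgue. \<bar>?h M x - ?w n x\<bar>) < e / 2"
    by (rule order_tendstoD) (use e in simp)
  then obtain n where n: "(LINT x|lebesgue. \<bar>?h M x - ?w n x\<bar>) < e / 2" by (meson eventually_happens sequentially_bot)
  have wi: "integrable lebesgue (?w n)" by (rule integrable_compsupp[OF cw sw])
  have "(LINT x|lebesgue. \<bar>g x - ?w n x\<bar>) \<le> (LINT x|lebesgue. \<bar>g x - ?h M x\<bar> + \<bar>?h M x - ?w n x\<bar>)"
  proof (rule integral_mono)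
    show "integrable lebesgue (\<lambda>x. \<bar>g x - ?w n x\<bar>)" using g wi by auto
    show "integrable lebesgue (\<lambda>x. \<bar>g x - ?h M x\<bar> + \<bar>?h M x - ?w n x\<bar>)" using g wi hi by auto
  qed auto
  also have "\<dots> = (LINT x|lebesgue. \<bar>g x - ?h M x\<bar>) + (LINT x|lebesgue. \<bar>?h M x - ?w n x\<bar>)"
    using g wi hi by (intro Bochner_Integration.integral_add) auto
  also have "\<dots> < e" using M n by simp
  finally show ?thesis by (rule that[OF cw sw])
qed

text \<open>Since mollification does not increase the L1 norm, \<open>g\<close> may be replaced by a
  continuous compactly supported \<open>w\<close>; there uniform continuity makes the error small
  pointwise.\<close>

theorem mol_L1_convergence:
  fixes \<rho> :: "nat \<Rightarrow> 'a::euclidean_space \<Rightarrow> real"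
  assumes c: "\<And>n. continuous_on UNIV (\<rho> n)" and \<rho>0: "\<And>n x. \<rho> n x \<ge> 0"
    and even: "\<And>n x. \<rho> n (- x) = \<rho> n x"
    and \<rho>1: "\<And>n. has_bochner_integral lebesgue (\<rho> n) 1"
    and supp: "\<And>n x. norm x > 1 / real (Suc n) \<Longrightarrow> \<rho> n x = 0"
    and g: "integrable lebesgue g"
  shows "(\<lambda>n. LINT x|lebesgue. \<bar>mol (\<rho> n) g x - g x\<bar>) \<longlonglongrightarrow> 0"
proof (rule LIMSEQ_I)
  have s: "compsupp (\<rho> n)" for n using supp by (auto simp: compsupp_def)
  fix e :: real assume e: "e > 0"
  obtain w where w: "continuous_on UNIV w" "compsupp w" "(LINT x|lebesgue. \<bar>g x - w x\<bar>) < e / 4"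
    using L1_approx_continuous_compsupp[OF g, of "e / 4"] e by auto
  have wi: "integrable lebesgue w" by (rule integrable_compsupp[OF w(1,2)])
  obtain r where r: "r > 0" "\<And>x. norm x > r \<Longrightarrow> w x = 0" by (rule compsupp_obtain_pos[OF w(2)]) blast
  define V where "V = (LINT x|lebesgue. indicator (cball (0::'a) (r + 1)) x :: real)"
  have V: "V \<ge> 0" unfolding V_def by (rule integral_nonneg_AE) auto
  \<comment> \<open>The kernels have radius at most 1, so the error for \<open>w\<close> lives in
    the ball of radius \<open>r + 1\<close>, and the points it compares lie in the ball of radius
    \<open>r + 2\<close>. The volume of the former is \<open>V\<close>; \<open>V + 1\<close> keeps
    the tolerance well defined and positive.\<close>
  have "uniformly_continuous_on (cball 0 (r + 2)) w"
    by (intro compact_uniformly_continuous continuous_on_subset[OF w(1)]) auto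
  moreover have "e / (4 * (V + 1)) > 0" using e V by simp
  ultimately obtain d where d: "d > 0"
    "\<And>x y. x \<in> cball 0 (r + 2) \<Longrightarrow> y \<in> cball 0 (r + 2) \<Longrightarrow> dist y x < d \<Longrightarrow> dist (w y) (w x) < e / (4 * (V + 1))"
    unfolding uniformly_continuous_on_def by metis
  obtain n0 where n0: "1 / real (Suc n0) < d" using d(1) nat_approx_posE by blast
  have "norm ((LINT x|lebesgue. \<bar>mol (\<rho> n) g x - g x\<bar>) - 0) < e" if n: "n \<ge> n0" for n
  proof -
    have nd: "1 / real (Suc n) < d"
      using n n0 by (meson frac_le le_less_trans less_eq_real_def of_nat_0_less_iff of_nat_mono Suc_le_mono zero_le_one zero_less_Suc order_refl)
    have n1: "1 / real (Suc n) \<le> 1" by simp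
    have pt: "\<bar>mol (\<rho> n) w x - w x\<bar> \<le> e / (4 * (V + 1)) * indicator (cball 0 (r + 1)) x" for x
    proof -
      have i1: "integrable lebesgue (\<lambda>y. \<rho> n (x - y) * w y)" by (rule mol_integrand_integrable[OF c s wi])
      have i2: "integrable lebesgue (\<lambda>y. \<rho> n (x - y))"
        by (intro integrable_compsupp continuous_reflect compsupp_reflect c s)
      \<comment> \<open>Evenness replaces the reflection in \<open>y\<close> by a translation, under
        which the integral is invariant.\<close>
      have one: "(LINT y|lebesgue. \<rho> n (x - y)) = 1"
      proof -
        have "(LINT y|lebesgue. \<rho> n (x - y)) = (LINT y|lebesgue. \<rho> n (y + - x))"
          by (rule Bochner_Integration.integral_cong) (use even[of n "x - y" for y] in auto)
        also have "\<dots> = (LINT y|lebesgue. \<rho> n y)" by (rule integral_lebesgue_translate[OF c])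
        finally show ?thesis using \<rho>1[of n] by (simp add: has_bochner_integral_iff)
      qed
      have "mol (\<rho> n) w x - w x = (LINT y|lebesgue. \<rho> n (x - y) * w y - \<rho> n (x - y) * w x)"
        by (simp add: mol_def i1 i2 Bochner_Integration.integral_diff one)
      also have "\<bar>\<dots>\<bar> \<le> (LINT y|lebesgue. \<rho> n (x - y) * (e / (4 * (V + 1)) * indicator (cball 0 (r + 1)) x))"
      proof (rule integral_abs_bound_integral)
        show "integrable lebesgue (\<lambda>y. \<rho> n (x - y) * w y - \<rho> n (x - y) * w x)" using i1 i2 by auto
        show "integrable lebesgue (\<lambda>y. \<rho> n (x - y) * (e / (4 * (V + 1)) * indicator (cball 0 (r + 1)) x))" using i2 by auto
        fix y
        show "\<bar>\<rho> n (x - y) * w y - \<rho> n (x - y) * w x\<bar> \<le> \<rho> n (x - y) * (e / (4 * (V + 1)) * indicator (cball 0 (r + 1)) x)"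
        proof (cases "norm (x - y) > 1 / real (Suc n)")
          case True thus ?thesis by (simp add: supp)
        next
          case False
          hence "norm (x - y) < d" "norm (x - y) \<le> 1" using nd n1 by linarith+
          hence xy: "dist y x < d" "norm (x - y) \<le> 1" by (auto simp: dist_norm norm_minus_commute)
          have "\<bar>w y - w x\<bar> \<le> e / (4 * (V + 1)) * indicator (cball 0 (r + 1)) x"
          proof (cases "norm x \<le> r + 1")
            case True
            hence "norm y \<le> r + 2" using xy norm_triangle_ineq2[of y x] by (simp add: norm_minus_commute)
            thus ?thesis using d(2)[of x y] xy True by (auto simp: dist_real_def)
          next
            case False
            hence "norm y > r" using xy norm_triangle_ineq2[of x y] by simp
            thus ?thesis using False r by auto
          qed
          from mult_left_mono[OF this \<rho>0[of n "x - y"]]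
          show ?thesis by (simp add: abs_mult \<rho>0 right_diff_distrib[symmetric])
        qed
      qed
      also have "\<dots> = e / (4 * (V + 1)) * indicator (cball 0 (r + 1)) x" by (simp add: one)
      finally show ?thesis .
    qed
    have mi: "integrable lebesgue (mol (\<rho> n) w)" by (rule mol_L1_bound(1)[OF c s \<rho>0 \<rho>1 wi])
    have gw: "integrable lebesgue (\<lambda>x. g x - w x)" using g wi by auto
    have md: "mol (\<rho> n) g x - mol (\<rho> n) w x = mol (\<rho> n) (\<lambda>x. g x - w x) x" for x
      unfolding mol_def by (simp add: right_diff_distrib Bochner_Integration.integral_diff mol_integrand_integrable[OF c s] g wi)
    have mgi: "integrable lebesgue (mol (\<rho> n) (\<lambda>x. g x - w x))" by (rule mol_L1_bound(1)[OF c s \<rho>0 \<rho>1 gw])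
    have mg: "integrable lebesgue (mol (\<rho> n) g)" by (rule mol_L1_bound(1)[OF c s \<rho>0 \<rho>1 g])
    have "(LINT x|lebesgue. \<bar>mol (\<rho> n) w x - w x\<bar>) \<le> (LINT x|lebesgue. e / (4 * (V + 1)) * indicator (cball (0::'a) (r + 1)) x)"
      by (rule integral_mono[OF _ integrable_mult_right[OF integrable_indicator_cball] pt]) (use mi wi in auto)
    also have "\<dots> = e / (4 * (V + 1)) * V" by (simp add: V_def)
    also have "\<dots> \<le> e / 4" using e V by (simp add: field_simps)
    finally have b1: "(LINT x|lebesgue. \<bar>mol (\<rho> n) w x - w x\<bar>) \<le> e / 4" .
    have b2: "(LINT x|lebesgue. \<bar>mol (\<rho> n) (\<lambda>x. g x - w x) x\<bar>) < e / 4"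
      using mol_L1_bound(2)[OF c[of n] s[of n] \<rho>0[of n] \<rho>1[of n] gw] w(3) by simp
    have "(LINT x|lebesgue. \<bar>mol (\<rho> n) g x - g x\<bar>)
      \<le> (LINT x|lebesgue. (\<bar>mol (\<rho> n) (\<lambda>x. g x - w x) x\<bar> + \<bar>mol (\<rho> n) w x - w x\<bar>) + \<bar>g x - w x\<bar>)"
    proof (rule integral_mono)
      show "\<bar>mol (\<rho> n) g x - g x\<bar> \<le> (\<bar>mol (\<rho> n) (\<lambda>x. g x - w x) x\<bar> + \<bar>mol (\<rho> n) w x - w x\<bar>) + \<bar>g x - w x\<bar>" for x
        unfolding md[symmetric] by linarith
    qed (use mg g mgi mi wi in auto)
    also have "\<dots> = (LINT x|lebesgue. \<bar>mol (\<rho> n) (\<lambda>x. g x - w x) x\<bar>) + (LINT x|lebesgue. \<bar>mol (\<rho> n) w x - w x\<bar>)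
        + (LINT x|lebesgue. \<bar>g x - w x\<bar>)"
      using g mgi mi wi by (simp add: Bochner_Integration.integral_add)
    also have "\<dots> < e" using b1 b2 w(3) e by linarith
    finally show ?thesis by (simp add: integral_nonneg_AE)
  qed
  thus "\<exists>n0. \<forall>n\<ge>n0. norm ((LINT x|lebesgue. \<bar>mol (\<rho> n) g x - g x\<bar>) - 0) < e" by blast
qed

section \<open>Weak derivatives tested with C1 functions\<close>

lemma test_function_mollifier_sequence:
  obtains \<rho> :: "nat \<Rightarrow> real ^ 'n::finite \<Rightarrow> real" and G H
  where "\<And>n x. \<rho> n x \<ge> 0" "\<And>n x. \<rho> n (- x) = \<rho> n x"
    "\<And>n x. norm x > 1 / real (Suc n) \<Longrightarrow> \<rho> n x = 0" "\<And>n. compsupp (\<rho> n)"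
    "\<And>n. has_bochner_integral lebesgue (\<rho> n) 1"
    "\<And>n. is_grad (\<rho> n) (G n)" "\<And>n i. is_grad (\<lambda>x. G n x $ i) (H n i)"
    "\<And>n x. test_function (\<lambda>y. \<rho> n (x - y))"
proof -
  have "\<forall>n. \<exists>(\<rho> :: real ^ 'n \<Rightarrow> real) G H. (\<forall>x. \<rho> x \<ge> 0) \<and> (\<forall>x. \<rho> (- x) = \<rho> x) \<and>
    (\<forall>x. norm x > 1 / real (Suc n) \<longrightarrow> \<rho> x = 0) \<and> has_bochner_integral lebesgue \<rho> 1 \<and> is_grad \<rho> G \<and>
    (\<forall>i. is_grad (\<lambda>x. G x $ i) (H i)) \<and> (\<forall>x. test_function (\<lambda>y. \<rho> (x - y)))"
  proof
    fix n
    have "1 / real (Suc n) > 0" by simp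
    then obtain \<rho> :: "real ^ 'n \<Rightarrow> real" and G H where
      "\<And>x. \<rho> x \<ge> 0" "\<And>x. \<rho> (- x) = \<rho> x" "\<And>x. norm x > 1 / real (Suc n) \<Longrightarrow> \<rho> x = 0"
      "has_bochner_integral lebesgue \<rho> 1" "is_grad \<rho> G" "\<And>i. is_grad (\<lambda>x. G x $ i) (H i)"
      "\<And>x. test_function (\<lambda>y. \<rho> (x - y))"
      by (rule mollifier_exists) blast
    thus "\<exists>(\<rho> :: real ^ 'n \<Rightarrow> real) G H. (\<forall>x. \<rho> x \<ge> 0) \<and> (\<forall>x. \<rho> (- x) = \<rho> x) \<and>
    (\<forall>x. norm x > 1 / real (Suc n) \<longrightarrow> \<rho> x = 0) \<and> has_bochner_integral lebesgue \<rho> 1 \<and> is_grad \<rho> G \<and>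
    (\<forall>i. is_grad (\<lambda>x. G x $ i) (H i)) \<and> (\<forall>x. test_function (\<lambda>y. \<rho> (x - y)))"
      by (intro exI[of _ \<rho>] exI[of _ G] exI[of _ H]) simp
  qed
  then obtain \<rho> :: "nat \<Rightarrow> real ^ 'n \<Rightarrow> real" and G H where *: "\<And>n. (\<forall>x. \<rho> n x \<ge> 0) \<and> (\<forall>x. \<rho> n (- x) = \<rho> n x) \<and>
    (\<forall>x. norm x > 1 / real (Suc n) \<longrightarrow> \<rho> n x = 0) \<and> has_bochner_integral lebesgue (\<rho> n) 1 \<and> is_grad (\<rho> n) (G n) \<and>
    (\<forall>i. is_grad (\<lambda>x. G n x $ i) (H n i)) \<and> (\<forall>x. test_function (\<lambda>y. \<rho> n (x - y)))"
    by metis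
  moreover have "compsupp (\<rho> n)" for n using *[of n] unfolding compsupp_def by blast
  ultimately show ?thesis by (intro that[of \<rho> G H]) blast+
qed

lemma L1_convergence_mult:
  fixes \<psi> :: "'a::euclidean_space \<Rightarrow> real"
  assumes \<psi>: "continuous_on UNIV \<psi>" "compsupp \<psi>"
    and A: "\<And>n. integrable lebesgue (A n)" and a: "integrable lebesgue a"
    and lim: "(\<lambda>n. LINT x|lebesgue. \<bar>A n x - a x\<bar>) \<longlonglongrightarrow> 0"
  shows "(\<lambda>n. LINT x|lebesgue. \<psi> x * A n x) \<longlonglongrightarrow> (LINT x|lebesgue. \<psi> x * a x)"
proof -
  obtain B where B: "B \<ge> 0" "\<And>x. norm (\<psi> x) \<le> B" using compsupp_bounded[OF \<psi>] by blast
  have "(\<lambda>n. (LINT x|lebesgue. \<psi> x * A n x) - (LINT x|lebesgue. \<psi> x * a x)) \<longlonglongrightarrow> 0"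
  proof (rule Lim_null_comparison[where g = "\<lambda>n. B * (LINT x|lebesgue. \<bar>A n x - a x\<bar>)"])
    show "(\<lambda>n. B * (LINT x|lebesgue. \<bar>A n x - a x\<bar>)) \<longlonglongrightarrow> 0"
      using tendsto_mult_right_zero[OF lim] .
    show "\<forall>\<^sub>F n in sequentially. norm ((LINT x|lebesgue. \<psi> x * A n x) - (LINT x|lebesgue. \<psi> x * a x))
        \<le> B * (LINT x|lebesgue. \<bar>A n x - a x\<bar>)"
    proof (intro always_eventually allI)
      fix n
      have i: "integrable lebesgue (\<lambda>x. \<psi> x * A n x)" "integrable lebesgue (\<lambda>x. \<psi> x * a x)"
        using A a by (auto intro: integrable_compsupp_mult[OF \<psi>])
      have "\<bar>LINT x|lebesgue. \<psi> x * A n x - \<psi> x * a x\<bar> \<le> (LINT x|lebesgue. B * \<bar>A n x - a x\<bar>)"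
      proof (rule integral_abs_bound_integral)
        show "integrable lebesgue (\<lambda>x. B * \<bar>A n x - a x\<bar>)" using A a by auto
        show "\<bar>\<psi> x * A n x - \<psi> x * a x\<bar> \<le> B * \<bar>A n x - a x\<bar>" for x
          using B(2)[of x] by (simp add: right_diff_distrib[symmetric] abs_mult mult_right_mono)
      qed (use i in auto)
      thus "norm ((LINT x|lebesgue. \<psi> x * A n x) - (LINT x|lebesgue. \<psi> x * a x))
        \<le> B * (LINT x|lebesgue. \<bar>A n x - a x\<bar>)" using i by simp
    qed
  qed
  thus ?thesis by (rule LIM_zero_cancel)
qed

lemma integrable_vec_nth: "integrable M f \<Longrightarrow> integrable M (\<lambda>x. (f x :: real ^ 'n::finite) $ i)"
  by (rule integrable_bounded_linear[OF bounded_linear_vec_nth])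

lemma compsupp_vec_nth: "compsupp (f :: _ \<Rightarrow> real ^ 'n::finite) \<Longrightarrow> compsupp (\<lambda>x. f x $ i)"
  unfolding compsupp_def by (metis zero_index)

lemma is_grad_nth_continuous: "is_grad f F \<Longrightarrow> continuous_on UNIV (\<lambda>x. F x $ i)"
  by (intro continuous_intros is_grad_continuous)

text \<open>The gradient of a mollification of \<open>m\<close> is the mollification of
  \<open>Dm\<close>, so both converge in L1 of the whole space. Second gradients are recorded
  because \<open>W11_curl_free\<close> relies on symmetric Hessians.\<close>

theorem W11_smooth_approximation:
  fixes m :: "real ^ 'n::finite \<Rightarrow> real"
  assumes m: "W11 m Dm"
  obtains M DM HM where "\<And>n. is_grad (M n) (DM n)" "\<And>n i. is_grad (\<lambda>x. DM n x $ i) (HM n i)"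
    "\<And>n. integrable lebesgue (M n)" "\<And>n i. integrable lebesgue (\<lambda>x. DM n x $ i)"
    "(\<lambda>n. LINT x|lebesgue. \<bar>M n x - m x\<bar>) \<longlonglongrightarrow> 0"
    "\<And>i. (\<lambda>n. LINT x|lebesgue. \<bar>DM n x $ i - Dm x $ i\<bar>) \<longlonglongrightarrow> 0"
proof -
  obtain \<rho> :: "nat \<Rightarrow> real ^ 'n \<Rightarrow> real" and G H where
    \<rho>: "\<And>n x. \<rho> n x \<ge> 0" "\<And>n x. \<rho> n (- x) = \<rho> n x"
    "\<And>n x. norm x > 1 / real (Suc n) \<Longrightarrow> \<rho> n x = 0" "\<And>n. compsupp (\<rho> n)"
    "\<And>n. has_bochner_integral lebesgue (\<rho> n) 1"
    and G: "\<And>n. is_grad (\<rho> n) (G n)" and H: "\<And>n i. is_grad (\<lambda>x. G n x $ i) (H n i)"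
    and test: "\<And>n x. test_function (\<lambda>y. \<rho> n (x - y))"
    by (rule test_function_mollifier_sequence) blast
  have mi: "integrable lebesgue m" and Di: "integrable lebesgue (\<lambda>x. Dm x $ i)" for i
    using m by (auto simp: W11_def intro: integrable_vec_nth)
  have c: "continuous_on UNIV (\<rho> n)" for n by (rule is_grad_imp_continuous[OF G])
  have sG: "compsupp (\<lambda>x. G n x $ i)" for n i by (intro compsupp_vec_nth is_grad_compsupp[OF G] \<rho>)
  let ?DM = "\<lambda>n x. \<chi> i. mol (\<lambda>z. G n z $ i) m x"
  \<comment> \<open>Two minus signs cancel: one from differentiating the reflected kernel in
    \<open>y\<close>, one from the definition of the weak derivative.\<close>
  have DM: "?DM n x $ i = mol (\<rho> n) (\<lambda>y. Dm y $ i) x" for n x i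
  proof -
    have "(LINT y|lebesgue. m y * partial_deriv i (\<lambda>y. \<rho> n (x - y)) y) = - (LINT y|lebesgue. Dm y $ i * \<rho> n (x - y))"
      using m test unfolding W11_def by blast
    thus ?thesis
      by (simp add: is_grad_partial_deriv[OF is_grad_reflect[OF G]] mol_def mult.commute)
  qed
  show ?thesis
  proof (rule that[of "\<lambda>n. mol (\<rho> n) m" ?DM "\<lambda>n i x. \<chi> j. mol (\<lambda>z. H n i z $ j) m x"])
    show "is_grad (mol (\<rho> n) m) (?DM n)" for n by (rule mol_is_grad[OF G \<rho>(4) mi])
    show "is_grad (\<lambda>x. ?DM n x $ i) (\<lambda>x. \<chi> j. mol (\<lambda>z. H n i z $ j) m x)" for n i
      using mol_is_grad[OF H sG mi] by simp
    show "integrable lebesgue (mol (\<rho> n) m)" for n by (rule mol_L1_bound(1)[OF c \<rho>(4,1,5) mi])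
    show "integrable lebesgue (\<lambda>x. ?DM n x $ i)" for n i
      unfolding DM using mol_L1_bound(1)[OF c \<rho>(4,1,5) Di] by simp
    show "(\<lambda>n. LINT x|lebesgue. \<bar>mol (\<rho> n) m x - m x\<bar>) \<longlonglongrightarrow> 0"
      by (rule mol_L1_convergence[OF c \<rho>(1,2,5,3) mi])
    show "(\<lambda>n. LINT x|lebesgue. \<bar>?DM n x $ i - Dm x $ i\<bar>) \<longlonglongrightarrow> 0" for i
      unfolding DM by (rule mol_L1_convergence[OF c \<rho>(1,2,5,3) Di])
  qed
qed

text \<open>Extends the defining identity of \<open>W11\<close> from smooth to C1 test functions.
  For the smooth approximants the integrand is an exact derivative, and the limit passes because
  \<open>\<phi>\<close> and \<open>\<Phi>\<close> are bounded. Stating it with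
  \<open>has_bochner_integral\<close> carries integrability along, so that such identities can
  simply be added.\<close>

theorem W11_integration_by_parts:
  assumes m: "W11 m Dm" and \<phi>: "is_grad \<phi> \<Phi>" "compsupp \<phi>"
  shows "has_bochner_integral lebesgue (\<lambda>x. m x * \<Phi> x $ i + Dm x $ i * \<phi> x) 0"
proof -
  obtain M DM HM where M: "\<And>n. is_grad (M n) (DM n)" "\<And>n i. is_grad (\<lambda>x. DM n x $ i) (HM n i)"
    and Mi: "\<And>n. integrable lebesgue (M n)" and DMi: "\<And>n i. integrable lebesgue (\<lambda>x. DM n x $ i)"
    and lim: "(\<lambda>n. LINT x|lebesgue. \<bar>M n x - m x\<bar>) \<longlonglongrightarrow> 0"
    "\<And>i. (\<lambda>n. LINT x|lebesgue. \<bar>DM n x $ i - Dm x $ i\<bar>) \<longlonglongrightarrow> 0"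
    by (rule W11_smooth_approximation[OF m]) blast
  have mi: "integrable lebesgue m" and Di: "integrable lebesgue (\<lambda>x. Dm x $ i)" for i
    using m by (auto simp: W11_def intro: integrable_vec_nth)
  note c\<phi> = is_grad_imp_continuous[OF \<phi>(1)]
  note c\<Phi> = is_grad_nth_continuous[OF \<phi>(1), of i]
  note s\<Phi> = compsupp_vec_nth[OF is_grad_compsupp[OF \<phi>], of i]
  have "(\<lambda>n. (LINT x|lebesgue. \<Phi> x $ i * M n x) + (LINT x|lebesgue. \<phi> x * DM n x $ i))
    \<longlonglongrightarrow> (LINT x|lebesgue. \<Phi> x $ i * m x) + (LINT x|lebesgue. \<phi> x * Dm x $ i)"
    by (intro tendsto_add L1_convergence_mult c\<phi> \<phi> c\<Phi> s\<Phi> Mi DMi mi Di lim)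
  moreover have "(LINT x|lebesgue. \<Phi> x $ i * M n x) + (LINT x|lebesgue. \<phi> x * DM n x $ i) = 0" for n
  proof -
    have "has_bochner_integral lebesgue (\<lambda>x. (M n x *\<^sub>R \<Phi> x + \<phi> x *\<^sub>R DM n x) $ i) 0"
      by (intro integral_gradient_eq_0[OF is_grad_mult[OF M(1) \<phi>(1)]] compsupp_mult_right \<phi>)
    thus ?thesis
      using integrable_compsupp_mult[OF c\<Phi> s\<Phi> Mi] integrable_compsupp_mult[OF c\<phi> \<phi>(2) DMi]
      by (simp add: has_bochner_integral_iff mult.commute)
  qed
  ultimately have "(LINT x|lebesgue. \<Phi> x $ i * m x) + (LINT x|lebesgue. \<phi> x * Dm x $ i) = 0"
    by (simp add: LIMSEQ_const_iff)
  thus ?thesis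
    using integrable_compsupp_mult[OF c\<Phi> s\<Phi> mi] integrable_compsupp_mult[OF c\<phi> \<phi>(2) Di]
    by (simp add: has_bochner_integral_iff mult.commute)
qed

text \<open>The weak form of curl grad m = 0. For a smooth approximant M, subtracting the
  i-derivative of T d_j M from the j-derivative of T d_i M cancels the Hessian terms. Only one
  derivative of \<open>T\<close> is used, which is why no third derivatives of \<open>u\<close> will
  appear.\<close>

theorem W11_curl_free:
  assumes m: "W11 m Dm" and T: "is_grad T T'" "compsupp T"
  shows "has_bochner_integral lebesgue (\<lambda>x. Dm x $ i * T' x $ j - Dm x $ j * T' x $ i) 0"
proof -
  obtain M DM HM where M: "\<And>n. is_grad (M n) (DM n)" "\<And>n i. is_grad (\<lambda>x. DM n x $ i) (HM n i)"
    and Mi: "\<And>n. integrable lebesgue (M n)" and DMi: "\<And>n i. integrable lebesgue (\<lambda>x. DM n x $ i)"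
    and lim: "(\<lambda>n. LINT x|lebesgue. \<bar>M n x - m x\<bar>) \<longlonglongrightarrow> 0"
    "\<And>i. (\<lambda>n. LINT x|lebesgue. \<bar>DM n x $ i - Dm x $ i\<bar>) \<longlonglongrightarrow> 0"
    by (rule W11_smooth_approximation[OF m]) blast
  have Di: "integrable lebesgue (\<lambda>x. Dm x $ i)" for i
    using m by (auto simp: W11_def intro: integrable_vec_nth)
  note c = is_grad_nth_continuous[OF T(1)]
  note s = compsupp_vec_nth[OF is_grad_compsupp[OF T]]
  have "(\<lambda>n. (LINT x|lebesgue. T' x $ j * DM n x $ i) - (LINT x|lebesgue. T' x $ i * DM n x $ j))
    \<longlonglongrightarrow> (LINT x|lebesgue. T' x $ j * Dm x $ i) - (LINT x|lebesgue. T' x $ i * Dm x $ j)"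
    by (intro tendsto_diff L1_convergence_mult c s DMi Di lim)
  moreover have "(LINT x|lebesgue. T' x $ j * DM n x $ i) - (LINT x|lebesgue. T' x $ i * DM n x $ j) = 0" for n
  proof -
    have "has_bochner_integral lebesgue (\<lambda>x. (DM n x $ i *\<^sub>R T' x + T x *\<^sub>R HM n i x) $ j) 0"
      "has_bochner_integral lebesgue (\<lambda>x. (DM n x $ j *\<^sub>R T' x + T x *\<^sub>R HM n j x) $ i) 0"
      by (intro integral_gradient_eq_0[OF is_grad_mult[OF M(2) T(1)]] compsupp_mult_right T)+
    from has_bochner_integral_diff[OF this]
    have "has_bochner_integral lebesgue (\<lambda>x. T' x $ j * DM n x $ i - T' x $ i * DM n x $ j) 0"
      by (simp add: hessian_symmetric[OF M(1) M(2), of n i _ j] mult.commute)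
    thus ?thesis
      using integrable_compsupp_mult[OF c s DMi] by (simp add: has_bochner_integral_iff)
  qed
  ultimately have "(LINT x|lebesgue. T' x $ j * Dm x $ i) - (LINT x|lebesgue. T' x $ i * Dm x $ j) = 0"
    by (simp only: LIMSEQ_const_iff)
  thus ?thesis
    using integrable_compsupp_mult[OF c s Di]
    by (simp add: has_bochner_integral_iff mult.commute)
qed

text \<open>\<open>\<Gamma>\<close> is Lipschitz and vanishes at 0, so \<open>\<Gamma> (m x)\<close>
  is integrable and inherits the L1 convergence of the approximants. For the factor \<open>g\<close>
  pointwise convergence is wanted instead, and L1 convergence supplies it almost everywhere along a
  subsequence \<open>\<sigma>\<close>.\<close>

theorem W11_chain_rule:
  fixes g \<Gamma> :: "real \<Rightarrow> real"
  assumes m: "W11 m Dm" and \<psi>: "is_grad \<psi> \<Psi>" "compsupp \<psi>"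
    and \<Gamma>: "\<And>t. (\<Gamma> has_real_derivative g t) (at t)" "\<Gamma> 0 = 0"
    and g: "continuous_on UNIV g" "\<And>t. \<bar>g t\<bar> \<le> K"
  shows "has_bochner_integral lebesgue (\<lambda>x. \<Gamma> (m x) * \<Psi> x $ i + g (m x) * Dm x $ i * \<psi> x) 0"
proof -
  obtain M DM HM where M: "\<And>n. is_grad (M n) (DM n)" "\<And>n i. is_grad (\<lambda>x. DM n x $ i) (HM n i)"
    and Mi: "\<And>n. integrable lebesgue (M n)" and DMi: "\<And>n i. integrable lebesgue (\<lambda>x. DM n x $ i)"
    and lim: "(\<lambda>n. LINT x|lebesgue. \<bar>M n x - m x\<bar>) \<longlonglongrightarrow> 0"
    "\<And>i. (\<lambda>n. LINT x|lebesgue. \<bar>DM n x $ i - Dm x $ i\<bar>) \<longlonglongrightarrow> 0"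
    by (rule W11_smooth_approximation[OF m]) blast
  have mi: "integrable lebesgue m" and Di: "integrable lebesgue (\<lambda>x. Dm x $ i)" for i
    using m by (auto simp: W11_def intro: integrable_vec_nth)
  note c\<psi> = is_grad_imp_continuous[OF \<psi>(1)]
  note c\<Psi> = is_grad_nth_continuous[OF \<psi>(1), of i]
  note s\<Psi> = compsupp_vec_nth[OF is_grad_compsupp[OF \<psi>], of i]
  have K0: "K \<ge> 0" using g(2)[of 0] by linarith
  have lip: "\<bar>\<Gamma> a - \<Gamma> b\<bar> \<le> K * \<bar>a - b\<bar>" for a b
    using field_differentiable_bound[of UNIV \<Gamma> g K a b] \<Gamma>(1) g(2) by simp
  have c\<Gamma>: "continuous_on UNIV \<Gamma>"
    using DERIV_isCont[OF \<Gamma>(1)] by (intro continuous_at_imp_continuous_on) simp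
  have \<Gamma>i: "integrable lebesgue (\<lambda>x. \<Gamma> (h x))" if "integrable lebesgue h" for h :: "real ^ 'a \<Rightarrow> real"
  proof (rule Bochner_Integration.integrable_bound[where f = "\<lambda>x. K * h x"])
    show "(\<lambda>x. \<Gamma> (h x)) \<in> borel_measurable lebesgue"
      using that borel_measurable_continuous_on[OF c\<Gamma>, of h lebesgue] by auto
    show "AE x in lebesgue. norm (\<Gamma> (h x)) \<le> norm (K * h x)"
      using lip[of _ 0] K0 \<Gamma>(2) by (auto intro!: AE_I2 simp: abs_mult)
  qed (use that in auto)
  have gb: "integrable lebesgue (\<lambda>x. g (h x) * k x)" if h: "h \<in> borel_measurable lebesgue" and k: "integrable lebesgue k"
    for h k :: "real ^ 'a \<Rightarrow> real"
  proof (rule Bochner_Integration.integrable_bound[where f = "\<lambda>x. K * k x"])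
    show "(\<lambda>x. g (h x) * k x) \<in> borel_measurable lebesgue"
      using k borel_measurable_continuous_on[OF g(1) h] by auto
    show "AE x in lebesgue. norm (g (h x) * k x) \<le> norm (K * k x)"
      using g(2) K0 by (auto intro!: AE_I2 mult_right_mono simp: abs_mult)
  qed (use k in auto)
  have mm: "m \<in> borel_measurable lebesgue" using mi by auto
  have Mm: "M n \<in> borel_measurable lebesgue" for n using Mi by auto
  obtain \<sigma> :: "nat \<Rightarrow> nat" where \<sigma>: "strict_mono \<sigma>" "AE x in lebesgue. (\<lambda>n. M (\<sigma> n) x - m x) \<longlonglongrightarrow> 0"
    using tendsto_L1_AE_subseq[of lebesgue "\<lambda>n x. M n x - m x"] Mi mi lim(1) by auto
  have \<sigma>lim: "(\<lambda>n. L (\<sigma> n)) \<longlonglongrightarrow> l" if "L \<longlonglongrightarrow> l" for L and l :: real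
    using LIMSEQ_subseq_LIMSEQ[OF that \<sigma>(1)] by (simp add: comp_def)
  let ?N = "\<lambda>n. M (\<sigma> n)" and ?DN = "\<lambda>n x. DM (\<sigma> n) x $ i"
  have \<Gamma>lim: "(\<lambda>n. LINT x|lebesgue. \<bar>\<Gamma> (?N n x) - \<Gamma> (m x)\<bar>) \<longlonglongrightarrow> 0"
  proof (rule Lim_null_comparison[where g = "\<lambda>n. K * (LINT x|lebesgue. \<bar>?N n x - m x\<bar>)"])
    show "(\<lambda>n. K * (LINT x|lebesgue. \<bar>?N n x - m x\<bar>)) \<longlonglongrightarrow> 0"
      by (rule tendsto_mult_right_zero[OF \<sigma>lim[OF lim(1)]])
    show "\<forall>\<^sub>F n in sequentially. norm (LINT x|lebesgue. \<bar>\<Gamma> (?N n x) - \<Gamma> (m x)\<bar>) \<le> K * (LINT x|lebesgue. \<bar>?N n x - m x\<bar>)"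
    proof (intro always_eventually allI)
      fix n
      have "(LINT x|lebesgue. \<bar>\<Gamma> (?N n x) - \<Gamma> (m x)\<bar>) \<le> (LINT x|lebesgue. K * \<bar>?N n x - m x\<bar>)"
        by (rule integral_mono) (use lip \<Gamma>i[OF Mi] \<Gamma>i[OF mi] Mi mi in auto)
      thus "norm (LINT x|lebesgue. \<bar>\<Gamma> (?N n x) - \<Gamma> (m x)\<bar>) \<le> K * (LINT x|lebesgue. \<bar>?N n x - m x\<bar>)"
        by (simp add: integral_nonneg_AE)
    qed
  qed
  have glim: "(\<lambda>n. LINT x|lebesgue. \<bar>g (?N n x) * Dm x $ i - g (m x) * Dm x $ i\<bar>) \<longlonglongrightarrow> (LINT x|lebesgue. 0 * m x)"
  proof (rule integral_dominated_convergence[where w = "\<lambda>x. 2 * K * \<bar>Dm x $ i\<bar>"])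
    show "integrable lebesgue (\<lambda>x. 2 * K * \<bar>Dm x $ i\<bar>)" using Di by auto
    show "(\<lambda>x. \<bar>g (?N n x) * Dm x $ i - g (m x) * Dm x $ i\<bar>) \<in> borel_measurable lebesgue" for n
      using gb[OF Mm Di] gb[OF mm Di] by auto
    show "AE x in lebesgue. (\<lambda>n. \<bar>g (?N n x) * Dm x $ i - g (m x) * Dm x $ i\<bar>) \<longlonglongrightarrow> 0 * m x"
      using \<sigma>(2)
    proof eventually_elim
      case (elim x)
      have "isCont g (m x)" using g(1) by (simp add: continuous_on_eq_continuous_at)
      hence "(\<lambda>n. g (?N n x)) \<longlonglongrightarrow> g (m x)" by (rule isCont_tendsto_compose[OF _ LIM_zero_cancel[OF elim]])
      hence "(\<lambda>n. \<bar>g (?N n x) * Dm x $ i - g (m x) * Dm x $ i\<bar>) \<longlonglongrightarrow> \<bar>g (m x) * Dm x $ i - g (m x) * Dm x $ i\<bar>"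
        by (intro tendsto_intros)
      thus ?case by simp
    qed
    show "AE x in lebesgue. norm \<bar>g (?N n x) * Dm x $ i - g (m x) * Dm x $ i\<bar> \<le> 2 * K * \<bar>Dm x $ i\<bar>" for n
    proof (rule AE_I2)
      fix x
      have "\<bar>g (?N n x) - g (m x)\<bar> \<le> 2 * K" using g(2)[of "?N n x"] g(2)[of "m x"] by linarith
      from mult_right_mono[OF this abs_ge_zero[of "Dm x $ i"]]
      show "norm \<bar>g (?N n x) * Dm x $ i - g (m x) * Dm x $ i\<bar> \<le> 2 * K * \<bar>Dm x $ i\<bar>"
        by (simp add: abs_mult[symmetric] left_diff_distrib)
    qed
  qed (use mm in auto)
  \<comment> \<open>The difference is g(M)(DM - Dm) + (g(M) - g(m)) Dm: the bound \<open>K\<close>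
    handles the first term and \<open>glim\<close> the second.\<close>
  have gDlim: "(\<lambda>n. LINT x|lebesgue. \<bar>g (?N n x) * ?DN n x - g (m x) * Dm x $ i\<bar>) \<longlonglongrightarrow> 0"
  proof (rule Lim_null_comparison[where g = "\<lambda>n. K * (LINT x|lebesgue. \<bar>?DN n x - Dm x $ i\<bar>)
      + (LINT x|lebesgue. \<bar>g (?N n x) * Dm x $ i - g (m x) * Dm x $ i\<bar>)"])
    show "(\<lambda>n. K * (LINT x|lebesgue. \<bar>?DN n x - Dm x $ i\<bar>)
      + (LINT x|lebesgue. \<bar>g (?N n x) * Dm x $ i - g (m x) * Dm x $ i\<bar>)) \<longlonglongrightarrow> 0"
      using tendsto_add[OF tendsto_mult_right_zero[OF \<sigma>lim[OF lim(2)], of K] glim] by simp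
    show "\<forall>\<^sub>F n in sequentially. norm (LINT x|lebesgue. \<bar>g (?N n x) * ?DN n x - g (m x) * Dm x $ i\<bar>)
      \<le> K * (LINT x|lebesgue. \<bar>?DN n x - Dm x $ i\<bar>) + (LINT x|lebesgue. \<bar>g (?N n x) * Dm x $ i - g (m x) * Dm x $ i\<bar>)"
    proof (intro always_eventually allI)
      fix n
      have "(LINT x|lebesgue. \<bar>g (?N n x) * ?DN n x - g (m x) * Dm x $ i\<bar>)
        \<le> (LINT x|lebesgue. K * \<bar>?DN n x - Dm x $ i\<bar> + \<bar>g (?N n x) * Dm x $ i - g (m x) * Dm x $ i\<bar>)"
      proof (rule integral_mono)
        fix x
        have "\<bar>g (?N n x) * (?DN n x - Dm x $ i)\<bar> \<le> K * \<bar>?DN n x - Dm x $ i\<bar>"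
          using g(2) by (simp add: abs_mult mult_right_mono)
        thus "\<bar>g (?N n x) * ?DN n x - g (m x) * Dm x $ i\<bar>
          \<le> K * \<bar>?DN n x - Dm x $ i\<bar> + \<bar>g (?N n x) * Dm x $ i - g (m x) * Dm x $ i\<bar>"
          unfolding right_diff_distrib by linarith
      qed (use gb[OF Mm Di] gb[OF mm Di] gb[OF Mm DMi] DMi Di in auto)
      also have "\<dots> = K * (LINT x|lebesgue. \<bar>?DN n x - Dm x $ i\<bar>) + (LINT x|lebesgue. \<bar>g (?N n x) * Dm x $ i - g (m x) * Dm x $ i\<bar>)"
        using gb[OF Mm Di] gb[OF mm Di] DMi Di by (subst Bochner_Integration.integral_add) auto
      finally show "norm (LINT x|lebesgue. \<bar>g (?N n x) * ?DN n x - g (m x) * Dm x $ i\<bar>)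
        \<le> K * (LINT x|lebesgue. \<bar>?DN n x - Dm x $ i\<bar>) + (LINT x|lebesgue. \<bar>g (?N n x) * Dm x $ i - g (m x) * Dm x $ i\<bar>)"
        by (simp add: integral_nonneg_AE)
    qed
  qed
  have "(\<lambda>n. (LINT x|lebesgue. \<Psi> x $ i * \<Gamma> (?N n x)) + (LINT x|lebesgue. \<psi> x * (g (?N n x) * ?DN n x)))
    \<longlonglongrightarrow> (LINT x|lebesgue. \<Psi> x $ i * \<Gamma> (m x)) + (LINT x|lebesgue. \<psi> x * (g (m x) * Dm x $ i))"
    by (intro tendsto_add L1_convergence_mult c\<psi> \<psi> c\<Psi> s\<Psi> \<Gamma>i Mi mi gb Mm mm DMi Di \<Gamma>lim gDlim)
  moreover have "(LINT x|lebesgue. \<Psi> x $ i * \<Gamma> (?N n x)) + (LINT x|lebesgue. \<psi> x * (g (?N n x) * ?DN n x)) = 0" for n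
  proof -
    have "has_bochner_integral lebesgue (\<lambda>x. (\<Gamma> (?N n x) *\<^sub>R \<Psi> x + \<psi> x *\<^sub>R (g (?N n x) *\<^sub>R DM (\<sigma> n) x)) $ i) 0"
      by (intro integral_gradient_eq_0[OF is_grad_mult[OF is_grad_compose[OF M(1) \<Gamma>(1) g(1)] \<psi>(1)]] compsupp_mult_right \<psi>)
    thus ?thesis
      using integrable_compsupp_mult[OF c\<Psi> s\<Psi> \<Gamma>i[OF Mi]] integrable_compsupp_mult[OF c\<psi> \<psi>(2) gb[OF Mm DMi]]
      by (simp add: has_bochner_integral_iff mult.commute mult.left_commute)
  qed
  ultimately have "(LINT x|lebesgue. \<Psi> x $ i * \<Gamma> (m x)) + (LINT x|lebesgue. \<psi> x * (g (m x) * Dm x $ i)) = 0"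
    by (simp only: LIMSEQ_const_iff)
  thus ?thesis
    using integrable_compsupp_mult[OF c\<Psi> s\<Psi> \<Gamma>i[OF mi]] integrable_compsupp_mult[OF c\<psi> \<psi>(2) gb[OF mm Di]]
    by (simp add: has_bochner_integral_iff mult.commute)
qed

text \<open>The field is mollified, not the test function: the divergence of the mollified field at
  \<open>x\<close> is, up to sign, the weak equation tested with the reflected kernel, hence zero
  everywhere. Against a smooth divergence-free field any C1 test function of compact support is
  admissible.\<close>

theorem divergence_free_test_C1:
  fixes Z :: "real ^ 'n::finite \<Rightarrow> real ^ 'n"
  assumes Z: "integrable lebesgue Z"
    and div: "\<And>\<phi>. test_function \<phi> \<Longrightarrow> (LINT x|lebesgue. Z x \<bullet> grad \<phi> x) = 0"
    and \<phi>: "is_grad \<phi> \<Phi>" "compsupp \<phi>"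
  shows "has_bochner_integral lebesgue (\<lambda>x. Z x \<bullet> \<Phi> x) 0"
proof -
  obtain \<rho> :: "nat \<Rightarrow> real ^ 'n \<Rightarrow> real" and G H where
    \<rho>: "\<And>n x. \<rho> n x \<ge> 0" "\<And>n x. \<rho> n (- x) = \<rho> n x"
    "\<And>n x. norm x > 1 / real (Suc n) \<Longrightarrow> \<rho> n x = 0" "\<And>n. compsupp (\<rho> n)"
    "\<And>n. has_bochner_integral lebesgue (\<rho> n) 1"
    and G: "\<And>n. is_grad (\<rho> n) (G n)" and H: "\<And>n i. is_grad (\<lambda>x. G n x $ i) (H n i)"
    and test: "\<And>n x. test_function (\<lambda>y. \<rho> n (x - y))"
    by (rule test_function_mollifier_sequence) blast
  have Zi: "integrable lebesgue (\<lambda>x. Z x $ i)" for i using Z by (rule integrable_vec_nth)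
  have c: "continuous_on UNIV (\<rho> n)" for n by (rule is_grad_imp_continuous[OF G])
  note cG = is_grad_nth_continuous[OF G]
  have sG: "compsupp (\<lambda>x. G n x $ i)" for n i by (intro compsupp_vec_nth is_grad_compsupp[OF G] \<rho>)
  note c\<phi> = is_grad_imp_continuous[OF \<phi>(1)]
  note c\<Phi> = is_grad_nth_continuous[OF \<phi>(1)]
  note s\<Phi> = compsupp_vec_nth[OF is_grad_compsupp[OF \<phi>]]
  let ?Z = "\<lambda>n i. mol (\<rho> n) (\<lambda>y. Z y $ i)"
  have Zni: "integrable lebesgue (?Z n i)" for n i by (rule mol_L1_bound(1)[OF c \<rho>(4,1,5) Zi])
  have "(\<lambda>n. \<Sum>i\<in>UNIV. LINT x|lebesgue. \<Phi> x $ i * ?Z n i x) \<longlonglongrightarrow> (\<Sum>i\<in>UNIV. LINT x|lebesgue. \<Phi> x $ i * Z x $ i)"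
    by (intro tendsto_sum L1_convergence_mult c\<Phi> s\<Phi> Zni Zi mol_L1_convergence[OF c \<rho>(1,2,5,3)])
  moreover have "(\<Sum>i\<in>UNIV. LINT x|lebesgue. \<Phi> x $ i * ?Z n i x) = 0" for n
  proof -
    let ?D = "\<lambda>i x. mol (\<lambda>z. G n z $ i) (\<lambda>y. Z y $ i) x"
    have "(\<Sum>i\<in>UNIV. ?D i x) = 0" for x
    proof -
      have "(\<Sum>i\<in>UNIV. ?D i x) = (LINT y|lebesgue. (\<Sum>i\<in>UNIV. G n (x - y) $ i * Z y $ i))"
        unfolding mol_def
        by (rule Bochner_Integration.integral_sum[symmetric]) (rule mol_integrand_integrable[OF cG sG Zi])
      also have "\<dots> = - (LINT y|lebesgue. Z y \<bullet> grad (\<lambda>y. \<rho> n (x - y)) y)"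
      proof -
        have "grad (\<lambda>y. \<rho> n (x - y)) = (\<lambda>y. - G n (x - y))" by (rule is_grad_grad[OF is_grad_reflect[OF G]])
        hence "Z y \<bullet> grad (\<lambda>y. \<rho> n (x - y)) y = - (\<Sum>i\<in>UNIV. G n (x - y) $ i * Z y $ i)" for y
          by (simp add: inner_vec_def sum_negf mult.commute)
        thus ?thesis by simp
      qed
      finally show ?thesis using div[OF test[of n x]] by simp
    qed
    moreover have "has_bochner_integral lebesgue (\<lambda>x. \<Phi> x $ i * ?Z n i x + \<phi> x * ?D i x) 0" for i
      using integral_gradient_eq_0[OF is_grad_mult[OF mol_is_grad[OF G \<rho>(4) Zi] \<phi>(1)] compsupp_mult_right[OF \<phi>(2)], of n i i]
      by (simp add: mult.commute)
    hence "has_bochner_integral lebesgue (\<lambda>x. \<Sum>i\<in>UNIV. \<Phi> x $ i * ?Z n i x + \<phi> x * ?D i x) (\<Sum>i\<in>(UNIV :: 'n set). 0)"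
      by (rule has_bochner_integral_sum)
    ultimately have "has_bochner_integral lebesgue (\<lambda>x. \<Sum>i\<in>UNIV. \<Phi> x $ i * ?Z n i x) 0"
      by (simp add: sum.distrib sum_distrib_left[symmetric])
    thus ?thesis
      using integrable_compsupp_mult[OF c\<Phi> s\<Phi> Zni] by (simp add: has_bochner_integral_iff)
  qed
  ultimately have "(\<Sum>i\<in>UNIV. LINT x|lebesgue. \<Phi> x $ i * Z x $ i) = 0"
    by (simp only: LIMSEQ_const_iff)
  thus ?thesis
    using integrable_compsupp_mult[OF c\<Phi> s\<Phi> Zi]
    by (simp add: has_bochner_integral_iff inner_vec_def mult.commute)
qed

text \<open>The bounded chain rule does not apply to \<open>f\<close>, which may jump at 0 and grow
  at infinity. It is applied to cut-down versions \<open>g n\<close> of \<open>f\<close>, whose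
  primitives converge to \<open>F\<close> below the bound C (s^(\<alpha>+1) + s), integrable once
  \<open>m\<close> is inserted.\<close>

theorem W11_chain_rule_primitive:
  fixes m :: "real ^ 'n::finite \<Rightarrow> real" and f F :: "real \<Rightarrow> real"
  assumes m: "W11 m Dm" and pos: "\<And>x. m x > 0"
    and \<alpha>: "\<alpha> > 0" "C > 0"
    and f: "continuous_on {0<..} f" "\<And>s. s \<ge> 0 \<Longrightarrow> 0 \<le> f s \<and> f s \<le> C * (s powr \<alpha> + 1)"
    and F: "\<And>s. s \<ge> 0 \<Longrightarrow> F s = integral {0..s} f"
    and fm: "continuous_on UNIV (\<lambda>x. f (m x))"
    and mi\<alpha>: "integrable lebesgue (\<lambda>x. m x powr (\<alpha> + 1))"
  shows "integrable lebesgue (\<lambda>x. F (m x))"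
    and "is_grad \<psi> \<Psi> \<Longrightarrow> compsupp \<psi> \<Longrightarrow>
      has_bochner_integral lebesgue (\<lambda>x. F (m x) * \<Psi> x $ i + f (m x) * Dm x $ i * \<psi> x) 0"
proof -
  have mi: "integrable lebesgue m" and Di: "integrable lebesgue (\<lambda>x. Dm x $ i)" for i
    using m by (auto simp: W11_def intro: integrable_vec_nth)
  \<comment> \<open>With K = \<open>real (Suc n)\<close>, the plateau function is 0 for s at most
    1/K and for s at least K + 1, and 1 between 2/K and K.\<close>
  define \<zeta> where "\<zeta> n s = max 0 (min 1 (min (real (Suc n) * s - 1) (real (Suc n) + 1 - s)))" for n :: nat and s :: real
  define g where "g n s = (if s > 0 then \<zeta> n s * f s else 0)" for n s
  have \<zeta>01: "0 \<le> \<zeta> n s" "\<zeta> n s \<le> 1" for n s by (auto simp: \<zeta>_def)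
  have \<zeta>lim: "(\<lambda>n. \<zeta> n s) \<longlonglongrightarrow> 1" if "s > 0" for s
  proof -
    obtain N :: nat where N: "2 / s + s \<le> real N" using real_arch_simple by blast
    have "\<zeta> n s = 1" if "n \<ge> N" for n
    proof -
      have n: "2 / s + s \<le> real (Suc n)" using N that by linarith
      hence "2 / s \<le> real (Suc n)" "s \<le> real (Suc n)" using \<open>s > 0\<close> by (auto intro: order_trans[rotated])
      hence "2 \<le> real (Suc n) * s" "s \<le> real (Suc n)" using \<open>s > 0\<close> by (auto simp: field_simps)
      thus ?thesis unfolding \<zeta>_def by linarith
    qed
    hence "\<forall>\<^sub>F n in sequentially. 1 = \<zeta> n s" by (auto simp: eventually_sequentially)
    thus ?thesis by (rule Lim_transform_eventually[OF tendsto_const])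
  qed
  have g0: "0 \<le> g n s" for n s using \<zeta>01 f(2) by (auto simp: g_def)
  have gf: "g n s \<le> f s" if "s \<ge> 0" for n s
    using \<zeta>01[of n s] f(2)[OF that] mult_right_mono[of "\<zeta> n s" 1 "f s"] by (auto simp: g_def)
  have gb: "\<bar>g n s\<bar> \<le> C * ((real (Suc n) + 1) powr \<alpha> + 1)" for n s
  proof (cases "0 < s \<and> s \<le> real (Suc n) + 1")
    case True
    hence "s powr \<alpha> \<le> (real (Suc n) + 1) powr \<alpha>" using \<alpha> by (intro powr_mono2) auto
    thus ?thesis using g0[of n s] gf[of s n] f(2)[of s] True \<alpha>
      by (auto intro!: order_trans[of "g n s" "f s"] order_trans[of "f s" "C * (s powr \<alpha> + 1)"])
  next
    case False
    hence "g n s = 0" by (auto simp: g_def \<zeta>_def)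
    thus ?thesis using \<alpha> by simp
  qed
  \<comment> \<open>Continuity is glued from two overlapping open half-lines: the positive numbers,
    where \<open>f\<close> is continuous, and the numbers below \<open>1 / real (Suc n)\<close>,
    where \<open>g n\<close> vanishes.\<close>
  have gc: "continuous_on UNIV (g n)" for n
  proof -
    have "continuous_on {0<..} (g n)"
    proof -
      have "continuous_on {0<..} (\<lambda>s. \<zeta> n s * f s)"
        unfolding \<zeta>_def by (intro continuous_intros f)
      thus ?thesis by (rule continuous_on_eq) (auto simp: g_def)
    qed
    moreover have "continuous_on {..<1 / real (Suc n)} (g n)"
    proof -
      have "g n s = 0" if "s < 1 / real (Suc n)" for s
      proof -
        have "real (Suc n) * s \<le> 1" using that by (simp add: field_simps)
        hence "\<zeta> n s = 0" unfolding \<zeta>_def by linarith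
        thus ?thesis by (simp add: g_def)
      qed
      thus ?thesis by (intro continuous_on_eq[OF continuous_on_const[of _ 0]]) auto
    qed
    ultimately have "continuous_on ({0<..} \<union> {..<1 / real (Suc n)}) (g n)"
      by (intro continuous_on_open_Un) auto
    moreover have "{0<..} \<union> {..<1 / real (Suc n)} = UNIV"
      by (auto simp: not_less intro: order.strict_trans1[of _ 0])
    ultimately show ?thesis by simp
  qed
  \<comment> \<open>The chain rule wants a primitive on the whole line, including negative
    arguments, because the mollified densities are not known here to be positive.\<close>
  have "\<exists>\<Gamma>. (\<forall>t. (\<Gamma> has_real_derivative g n t) (at t)) \<and> \<Gamma> 0 = 0" for n
  proof -
    have "isCont (g n) x" for x using gc by (simp add: continuous_on_eq_continuous_at)
    from einterval_antiderivative[of "-\<infinity>" "\<infinity>" "g n", OF _ this]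
    obtain \<Gamma> where "\<And>x. (\<Gamma> has_vector_derivative g n x) (at x)" by auto
    hence "((\<lambda>t. \<Gamma> t - \<Gamma> 0) has_real_derivative g n t) (at t)" for t
      by (auto intro!: derivative_eq_intros simp: has_real_derivative_iff_has_vector_derivative)
    thus ?thesis by (intro exI[of _ "\<lambda>t. \<Gamma> t - \<Gamma> 0"]) simp
  qed
  then obtain \<Gamma> where \<Gamma>: "\<And>n t. (\<Gamma> n has_real_derivative g n t) (at t)" "\<And>n. \<Gamma> n 0 = 0" by metis
  have \<Gamma>int: "(g n has_integral \<Gamma> n s) {0..s}" if "s \<ge> 0" for n s
    using fundamental_theorem_of_calculus[of 0 s "\<Gamma> n" "g n"] that \<Gamma>
    by (auto simp: has_real_derivative_iff_has_vector_derivative[symmetric] intro: DERIV_subset)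
  have \<Gamma>b: "0 \<le> \<Gamma> n s" "\<Gamma> n s \<le> C * (s powr (\<alpha> + 1) + s)" if "s \<ge> 0" for n s
  proof -
    show "0 \<le> \<Gamma> n s" using has_integral_nonneg[OF \<Gamma>int[OF that]] g0 by auto
    have "((\<lambda>t. C * (s powr \<alpha> + 1)) has_integral C * (s powr \<alpha> + 1) * (s - 0)) {0..s}"
      using has_integral_const_real[of "C * (s powr \<alpha> + 1)" 0 s] that by (simp add: mult.commute)
    moreover have "g n t \<le> C * (s powr \<alpha> + 1)" if "t \<in> {0..s}" for t
    proof -
      have "t powr \<alpha> \<le> s powr \<alpha>" using that \<alpha> by (intro powr_mono2) auto
      hence "C * (t powr \<alpha> + 1) \<le> C * (s powr \<alpha> + 1)" using \<alpha> by simp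
      thus ?thesis using gf[of t n] f(2)[of t] that by auto
    qed
    ultimately have "\<Gamma> n s \<le> C * (s powr \<alpha> + 1) * (s - 0)"
      using has_integral_le[OF \<Gamma>int[OF that]] by blast
    also have "\<dots> = C * (s powr (\<alpha> + 1) + s)"
      using that by (cases "s = 0") (auto simp: powr_add algebra_simps)
    finally show "\<Gamma> n s \<le> C * (s powr (\<alpha> + 1) + s)" .
  qed
  have \<Gamma>lim: "(\<lambda>n. \<Gamma> n s) \<longlonglongrightarrow> F s" if s: "s > 0" for s
  proof -
    \<comment> \<open>All \<open>g n\<close> vanish at 0 whereas \<open>f 0\<close> may be positive,
      so the pointwise limit differs from \<open>f\<close> at one point; the integral does not see
      it.\<close>
    let ?f = "\<lambda>t. if t = 0 then 0 else f t"
    have "(\<lambda>n. integral {0..s} (g n)) \<longlonglongrightarrow> integral {0..s} ?f"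
    proof (rule dominated_convergence(2)[where h = "\<lambda>t. C * (s powr \<alpha> + 1)"])
      show "g n integrable_on {0..s}" for n using \<Gamma>int[of s n] s by auto
      show "norm (g n t) \<le> C * (s powr \<alpha> + 1)" if "t \<in> {0..s}" for n t
      proof -
        have "t powr \<alpha> \<le> s powr \<alpha>" using that \<alpha> by (intro powr_mono2) auto
        hence "C * (t powr \<alpha> + 1) \<le> C * (s powr \<alpha> + 1)" using \<alpha> by simp
        thus ?thesis using gf[of t n] g0[of n t] f(2)[of t] that by auto
      qed
      show "(\<lambda>n. g n t) \<longlonglongrightarrow> ?f t" if "t \<in> {0..s}" for t
      proof (cases "t = 0")
        case False
        hence "(\<lambda>n. \<zeta> n t * f t) \<longlonglongrightarrow> 1 * f t" using that by (intro tendsto_intros \<zeta>lim) auto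
        thus ?thesis using False that by (simp add: g_def)
      qed (simp add: g_def)
    qed auto
    moreover have "integral {0..s} ?f = integral {0..s} f"
      by (rule integral_spike[of "{0}"]) auto
    moreover have "integral {0..s} (g n) = \<Gamma> n s" for n using \<Gamma>int[of s n] s by (auto intro: integral_unique)
    ultimately show ?thesis using F[of s] s by simp
  qed
  have dom: "integrable lebesgue (\<lambda>x. C * (m x powr (\<alpha> + 1) + m x))"
    using mi mi\<alpha> by auto
  have \<Gamma>m: "(\<lambda>x. \<Gamma> n (m x)) \<in> borel_measurable lebesgue" for n
  proof -
    have "continuous_on UNIV (\<Gamma> n)" using DERIV_isCont[OF \<Gamma>(1)] by (intro continuous_at_imp_continuous_on) simp
    from borel_measurable_continuous_on[OF this, of m lebesgue] show ?thesis using mi by auto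
  qed
  have Fm: "(\<lambda>x. F (m x)) \<in> borel_measurable lebesgue"
    by (rule borel_measurable_LIMSEQ_real[OF \<Gamma>lim[OF pos] \<Gamma>m])
  have Fb: "0 \<le> F (m x)" "F (m x) \<le> C * (m x powr (\<alpha> + 1) + m x)" for x
  proof -
    have mx: "m x \<ge> 0" using pos[of x] by simp
    show "0 \<le> F (m x)" by (rule LIMSEQ_le_const[OF \<Gamma>lim[OF pos]]) (use \<Gamma>b(1)[OF mx] in blast)
    show "F (m x) \<le> C * (m x powr (\<alpha> + 1) + m x)"
      by (rule LIMSEQ_le_const2[OF \<Gamma>lim[OF pos]]) (use \<Gamma>b(2)[OF mx] in blast)
  qed
  show Fi: "integrable lebesgue (\<lambda>x. F (m x))"
    by (rule Bochner_Integration.integrable_bound[OF dom Fm]) (use Fb in \<open>auto intro!: AE_I2 intro: order_trans[OF _ abs_ge_self]\<close>)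
  assume \<psi>: "is_grad \<psi> \<Psi>" "compsupp \<psi>"
  note c\<psi> = is_grad_imp_continuous[OF \<psi>(1)]
  note c\<Psi> = is_grad_nth_continuous[OF \<psi>(1), of i]
  note s\<Psi> = compsupp_vec_nth[OF is_grad_compsupp[OF \<psi>], of i]
  have i1: "integrable lebesgue (\<lambda>x. \<Psi> x $ i * F (m x))" by (rule integrable_compsupp_mult[OF c\<Psi> s\<Psi> Fi])
  \<comment> \<open>This is where continuity of \<open>f (m x)\<close> in \<open>x\<close> enters:
    multiplied by the compactly supported \<open>\<psi>\<close> it is bounded, although
    \<open>m\<close> need not be.\<close>
  have i2: "integrable lebesgue (\<lambda>x. (\<psi> x * f (m x)) * Dm x $ i)"
    by (intro integrable_compsupp_mult continuous_intros c\<psi> fm Di compsupp_mult_left \<psi>)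
  have gm: "(\<lambda>x. g n (m x)) \<in> borel_measurable lebesgue" for n
    by (rule borel_measurable_continuous_on[OF gc]) (use mi in auto)
  have meas: "(\<lambda>x. \<Gamma> n (m x) * \<Psi> x $ i + g n (m x) * Dm x $ i * \<psi> x) \<in> borel_measurable lebesgue" for n
    using \<Gamma>m gm continuous_lebesgue_measurable[OF c\<psi>] continuous_lebesgue_measurable[OF c\<Psi>]
      borel_measurable_integrable[OF Di] by measurable
  have measF: "(\<lambda>x. F (m x) * \<Psi> x $ i + f (m x) * Dm x $ i * \<psi> x) \<in> borel_measurable lebesgue"
    using Fm continuous_lebesgue_measurable[OF fm] continuous_lebesgue_measurable[OF c\<psi>]
      continuous_lebesgue_measurable[OF c\<Psi>] borel_measurable_integrable[OF Di] by measurable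
  have "(\<lambda>n. LINT x|lebesgue. \<Gamma> n (m x) * \<Psi> x $ i + g n (m x) * Dm x $ i * \<psi> x)
      \<longlonglongrightarrow> (LINT x|lebesgue. F (m x) * \<Psi> x $ i + f (m x) * Dm x $ i * \<psi> x)"
  proof (rule integral_dominated_convergence[where w = "\<lambda>x. \<bar>\<Psi> x $ i * (C * (m x powr (\<alpha> + 1) + m x))\<bar> + \<bar>(\<psi> x * f (m x)) * Dm x $ i\<bar>"])
    show "integrable lebesgue (\<lambda>x. \<bar>\<Psi> x $ i * (C * (m x powr (\<alpha> + 1) + m x))\<bar> + \<bar>(\<psi> x * f (m x)) * Dm x $ i\<bar>)"
      by (intro Bochner_Integration.integrable_add Bochner_Integration.integrable_abs i2 integrable_compsupp_mult c\<Psi> s\<Psi> dom)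
    show "AE x in lebesgue. (\<lambda>n. \<Gamma> n (m x) * \<Psi> x $ i + g n (m x) * Dm x $ i * \<psi> x)
        \<longlonglongrightarrow> F (m x) * \<Psi> x $ i + f (m x) * Dm x $ i * \<psi> x"
    proof (rule AE_I2)
      fix x
      have "(\<lambda>n. \<zeta> n (m x) * f (m x)) \<longlonglongrightarrow> 1 * f (m x)" by (intro tendsto_intros \<zeta>lim pos)
      hence "(\<lambda>n. g n (m x)) \<longlonglongrightarrow> f (m x)" using pos by (simp add: g_def)
      thus "(\<lambda>n. \<Gamma> n (m x) * \<Psi> x $ i + g n (m x) * Dm x $ i * \<psi> x)
        \<longlonglongrightarrow> F (m x) * \<Psi> x $ i + f (m x) * Dm x $ i * \<psi> x"
        by (intro tendsto_intros \<Gamma>lim pos)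
    qed
    show "AE x in lebesgue. norm (\<Gamma> n (m x) * \<Psi> x $ i + g n (m x) * Dm x $ i * \<psi> x)
      \<le> \<bar>\<Psi> x $ i * (C * (m x powr (\<alpha> + 1) + m x))\<bar> + \<bar>(\<psi> x * f (m x)) * Dm x $ i\<bar>" for n
    proof (rule AE_I2)
      fix x
      have mx: "m x \<ge> 0" using pos[of x] by simp
      have "\<bar>\<Gamma> n (m x)\<bar> \<le> \<bar>C * (m x powr (\<alpha> + 1) + m x)\<bar>" using \<Gamma>b[OF mx, of n] by linarith
      from mult_right_mono[OF this abs_ge_zero[of "\<Psi> x $ i"]]
      have 1: "\<bar>\<Gamma> n (m x) * \<Psi> x $ i\<bar> \<le> \<bar>\<Psi> x $ i * (C * (m x powr (\<alpha> + 1) + m x))\<bar>"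
        by (simp only: abs_mult mult.commute)
      have "\<bar>g n (m x)\<bar> \<le> \<bar>f (m x)\<bar>" using g0[of n "m x"] gf[OF mx, of n] by linarith
      from mult_right_mono[OF this abs_ge_zero[of "Dm x $ i * \<psi> x"]]
      have 2: "\<bar>g n (m x) * Dm x $ i * \<psi> x\<bar> \<le> \<bar>(\<psi> x * f (m x)) * Dm x $ i\<bar>"
        by (simp add: abs_mult mult.commute mult.left_commute)
      show "norm (\<Gamma> n (m x) * \<Psi> x $ i + g n (m x) * Dm x $ i * \<psi> x)
      \<le> \<bar>\<Psi> x $ i * (C * (m x powr (\<alpha> + 1) + m x))\<bar> + \<bar>(\<psi> x * f (m x)) * Dm x $ i\<bar>"
        unfolding real_norm_def using 1 2 by linarith
    qed
  qed (use meas measF in auto)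
  moreover have "(LINT x|lebesgue. \<Gamma> n (m x) * \<Psi> x $ i + g n (m x) * Dm x $ i * \<psi> x) = 0" for n
    using W11_chain_rule[OF m \<psi> \<Gamma> gc gb] by (simp add: has_bochner_integral_iff)
  ultimately have "(LINT x|lebesgue. F (m x) * \<Psi> x $ i + f (m x) * Dm x $ i * \<psi> x) = 0"
    by (simp only: LIMSEQ_const_iff)
  thus "has_bochner_integral lebesgue (\<lambda>x. F (m x) * \<Psi> x $ i + f (m x) * Dm x $ i * \<psi> x) 0"
    using Bochner_Integration.integrable_add[OF i1 i2] by (simp add: has_bochner_integral_iff mult.commute mult.left_commute)
qed

section \<open>Powers of the norm and cutoff functions\<close>

lemma is_grad_compose_vec:
  fixes p :: "real ^ 'n::finite \<Rightarrow> real ^ 'n"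
  assumes \<Phi>: "is_grad \<Phi> B" and p: "\<And>i. is_grad (\<lambda>x. p x $ i) (D i)"
  shows "is_grad (\<lambda>x. \<Phi> (p x)) (\<lambda>x. \<Sum>i\<in>UNIV. (B (p x) $ i) *\<^sub>R D i x)"
proof (rule is_gradI)
  have cp: "continuous_on UNIV p"
    using continuous_on_vec_lambda[of UNIV "\<lambda>i x. p x $ i"] is_grad_imp_continuous[OF p] by simp
  show "continuous_on UNIV (\<lambda>x. \<Sum>i\<in>UNIV. (B (p x) $ i) *\<^sub>R D i x)"
    by (intro continuous_intros is_grad_continuous[OF p] continuous_on_compose2[OF is_grad_continuous[OF \<Phi>] cp]) auto
  fix x
  have "(p has_derivative (\<lambda>h. \<chi> i. D i x \<bullet> h)) (at x)"
    unfolding has_derivative_componentwise_within[of p]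
    using is_grad_derivD[OF p] by (auto simp: Basis_vec_def inner_axis)
  from has_derivative_compose[OF this is_grad_derivD[OF \<Phi>]]
  show "((\<lambda>x. \<Phi> (p x)) has_derivative (\<lambda>h. (\<Sum>i\<in>UNIV. (B (p x) $ i) *\<^sub>R D i x) \<bullet> h)) (at x)"
    by (simp add: inner_vec_def[of "B (p x)"] inner_sum_left)
qed

text \<open>At \<open>v = 0\<close> both sides are 0 by the convention \<open>0 powr a = 0\<close>,
  whatever the sign of the exponent.\<close>

lemma norm_powr_drift: "norm (norm v powr (\<gamma> - 2) *\<^sub>R v) = norm v powr (\<gamma> - 1)"
  for v :: "'a::real_normed_vector"
proof (cases "v = 0")
  case False
  hence "norm v powr (\<gamma> - 2) * norm v = norm v powr (\<gamma> - 2) * norm v powr 1" by simp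
  also have "\<dots> = norm v powr (\<gamma> - 1)" by (simp only: powr_add[symmetric]) simp
  finally show ?thesis by simp
qed simp

lemma tendsto_norm_powr_0:
  assumes "a > 0"
  shows "((\<lambda>v::'a::real_normed_vector. norm v powr a) \<longlongrightarrow> 0) (at 0)"
  by (rule tendsto_zero_powrI[where b = a]) (use assms in \<open>auto intro!: tendsto_norm_zero tendsto_ident_at\<close>)

text \<open>Only the origin is delicate. There the gradient has norm |v|^(\<gamma>-1), which tends
  to 0 because \<gamma> > 1, even when the factor |v|^(\<gamma>-2) blows up.\<close>

lemma is_grad_norm_powr:
  assumes g: "\<gamma> > 1"
  shows "is_grad (\<lambda>v :: real ^ 'n::finite. 1 / \<gamma> * norm v powr \<gamma>) (\<lambda>v. norm v powr (\<gamma> - 2) *\<^sub>R v)"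
proof (rule is_gradI)
  show "continuous_on UNIV (\<lambda>v :: real ^ 'n. norm v powr (\<gamma> - 2) *\<^sub>R v)"
  proof (intro continuous_at_imp_continuous_on ballI)
    fix v :: "real ^ 'n"
    show "isCont (\<lambda>v. norm v powr (\<gamma> - 2) *\<^sub>R v) v"
    proof (cases "v = 0")
      case False thus ?thesis by (intro continuous_intros) auto
    next
      case True
      have "((\<lambda>v::real ^ 'n. norm v powr (\<gamma> - 2) *\<^sub>R v) \<longlongrightarrow> 0) (at 0)"
        by (rule tendsto_norm_zero_cancel) (use g tendsto_norm_powr_0[of "\<gamma> - 1"] in \<open>simp only: norm_powr_drift\<close>, simp)
      thus ?thesis using True by (simp add: isCont_def)
    qed
  qed
  fix v :: "real ^ 'n"
  show "((\<lambda>v. 1 / \<gamma> * norm v powr \<gamma>) has_derivative (\<lambda>h. (norm v powr (\<gamma> - 2) *\<^sub>R v) \<bullet> h)) (at v)"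
  proof (cases "v = 0")
    case False
    have "((\<lambda>t. 1 / \<gamma> * t powr \<gamma>) has_real_derivative norm v powr (\<gamma> - 1)) (at (norm v))"
      using False g by (auto intro!: derivative_eq_intros)
    hence "((\<lambda>t. 1 / \<gamma> * t powr \<gamma>) has_derivative (\<lambda>h. norm v powr (\<gamma> - 1) * h)) (at (norm v))"
      by (simp add: has_field_derivative_def)
    from has_derivative_compose[OF has_derivative_norm[OF False] this]
    have "((\<lambda>v. 1 / \<gamma> * norm v powr \<gamma>) has_derivative (\<lambda>h. norm v powr (\<gamma> - 1) * (h \<bullet> sgn v))) (at v)"
      by (simp add: inner_commute)
    moreover have "norm v powr (\<gamma> - 1) * (h \<bullet> sgn v) = (norm v powr (\<gamma> - 2) *\<^sub>R v) \<bullet> h" for h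
    proof -
      have "norm v powr (\<gamma> - 1) = norm v powr (\<gamma> - 2) * norm v powr 1"
        by (simp only: powr_add[symmetric]) simp
      thus ?thesis using False by (simp add: sgn_div_norm inner_commute field_simps)
    qed
    ultimately show ?thesis by simp
  next
    case True
    have "((\<lambda>y::real ^ 'n. norm (1 / \<gamma> * norm y powr \<gamma>) / norm y) \<longlongrightarrow> 0) (at 0)"
    proof (rule Lim_transform_eventually)
      show "((\<lambda>y::real ^ 'n. 1 / \<gamma> * norm y powr (\<gamma> - 1)) \<longlongrightarrow> 0) (at 0)"
        using g tendsto_norm_powr_0[of "\<gamma> - 1"] by (intro tendsto_mult_right_zero) simp
      have "1 / \<gamma> * norm y powr (\<gamma> - 1) = norm (1 / \<gamma> * norm y powr \<gamma>) / norm y" if "y \<noteq> 0" for y :: "real ^ 'n"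
        using g that by (simp add: powr_diff abs_mult)
      thus "\<forall>\<^sub>F y::real ^ 'n in at 0. 1 / \<gamma> * norm y powr (\<gamma> - 1) = norm (1 / \<gamma> * norm y powr \<gamma>) / norm y"
        by (auto simp: eventually_at_filter)
    qed
    thus ?thesis using True by (simp add: has_derivative_iff_norm bounded_linear_zero)
  qed
qed

text \<open>An exponent of at least 2 smooths the kink of the positive part: the difference quotient
  at 0 is a positive power of it.\<close>

lemma max_power_has_derivative:
  assumes k: "k \<ge> (2::nat)"
  shows "((\<lambda>t::real. (max 0 t) ^ k) has_real_derivative real k * (max 0 t) ^ (k - 1)) (at t)"
proof -
  consider "t < 0" | "t = 0" | "t > 0" by linarith
  thus ?thesis
  proof cases
    case 1
    have "((\<lambda>t::real. 0) has_real_derivative 0) (at t)" by simp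
    hence "((\<lambda>t::real. (max 0 t) ^ k) has_real_derivative 0) (at t)"
      by (rule has_field_derivative_transform_within_open[of _ _ _ "{..<0}"]) (use 1 k in auto)
    thus ?thesis using 1 k by (simp add: zero_power)
  next
    case 2
    have "((\<lambda>h::real. (max 0 h) ^ (k - 1)) \<longlongrightarrow> (max 0 0) ^ (k - 1)) (at 0)"
      by (intro tendsto_intros)
    moreover have "(max 0 (0 + h) ^ k - max 0 0 ^ k) / h = (max 0 h) ^ (k - 1)" if "h \<noteq> 0" for h :: real
      using k that by (cases k; cases "h > 0") auto
    hence "\<forall>\<^sub>F h in at 0. (max 0 h) ^ (k - 1) = (max 0 (0 + h) ^ k - max 0 0 ^ k) / (h::real)"
      by (simp add: eventually_at_filter)
    ultimately have "((\<lambda>h::real. (max 0 (0 + h) ^ k - max 0 0 ^ k) / h) \<longlongrightarrow> (max 0 0) ^ (k - 1)) (at 0)"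
      by (rule Lim_transform_eventually)
    thus ?thesis using 2 k by (simp add: DERIV_def zero_power)
  next
    case 3
    have "((\<lambda>t::real. t ^ k) has_real_derivative real k * t ^ (k - 1)) (at t)"
      by (auto intro!: derivative_eq_intros)
    hence "((\<lambda>t::real. (max 0 t) ^ k) has_real_derivative real k * t ^ (k - 1)) (at t)"
      by (rule has_field_derivative_transform_within_open[of _ _ _ "{0<..}"]) (use 3 in auto)
    thus ?thesis using 3 by simp
  qed
qed

text \<open>The power \<open>k\<close> is a parameter: 2 suffices for a C1 cutoff, while the Young
  argument for the sign of \<open>lam\<close> needs \<open>k\<close> at least the conjugate exponent
  of \<open>\<gamma>\<close>.\<close>

definition cutoff :: "nat \<Rightarrow> real \<Rightarrow> real ^ 'n::finite \<Rightarrow> real" where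
  "cutoff k R x = (max 0 (1 - (norm x)\<^sup>2 / R\<^sup>2)) ^ k"

text \<open>The scalar s for which the gradient of the cutoff at \<open>x\<close> is - s x. Kept
  apart from the vector \<open>x\<close>, it turns error terms into s |x|^2 or s (x . v)(x .
  w).\<close>

definition cutoff_slope :: "nat \<Rightarrow> real \<Rightarrow> real ^ 'n::finite \<Rightarrow> real" where
  "cutoff_slope k R x = 2 * real k / R\<^sup>2 * (max 0 (1 - (norm x)\<^sup>2 / R\<^sup>2)) ^ (k - 1)"

lemma is_grad_cutoff:
  assumes "k \<ge> 2"
  shows "is_grad (cutoff k R) (\<lambda>x. - cutoff_slope k R x *\<^sub>R x)"
proof -
  have "is_grad (\<lambda>x::real ^ 'a. 1 + (- 1 / R\<^sup>2) * (norm x)\<^sup>2) (\<lambda>x. 0 + (- 1 / R\<^sup>2) *\<^sub>R (2 *\<^sub>R x))"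
    by (intro is_grad_add is_grad_const is_grad_cmult is_grad_norm_sq)
  hence "is_grad (\<lambda>x::real ^ 'a. (max 0 (1 + (- 1 / R\<^sup>2) * (norm x)\<^sup>2)) ^ k)
    (\<lambda>x. (real k * max 0 (1 + (- 1 / R\<^sup>2) * (norm x)\<^sup>2) ^ (k - 1)) *\<^sub>R (0 + (- 1 / R\<^sup>2) *\<^sub>R (2 *\<^sub>R x)))"
    by (rule is_grad_compose[OF _ max_power_has_derivative[OF assms]]) (intro continuous_intros)
  thus ?thesis
    by (rule is_grad_eq) (simp_all add: cutoff_def cutoff_slope_def)
qed

lemma cutoff_bounds: "0 \<le> cutoff k R x" "cutoff k R x \<le> 1"
  unfolding cutoff_def by (auto intro!: power_le_one)

lemma cutoff_slope_nonneg: "0 \<le> cutoff_slope k R x"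
  unfolding cutoff_slope_def by auto

lemma cutoff_outside: "R > 0 \<Longrightarrow> k \<ge> 1 \<Longrightarrow> norm x > R \<Longrightarrow> cutoff k R x = 0"
  using power_strict_mono[of R "norm x" 2] by (simp add: cutoff_def max_def)

lemma compsupp_cutoff: "R > 0 \<Longrightarrow> k \<ge> 1 \<Longrightarrow> compsupp (cutoff k R)"
  using cutoff_outside unfolding compsupp_def by blast

text \<open>On the support |x| is at most R, which absorbs the factor 1/R^2. The first bound is
  scale invariant and serves the dilation field; the second also decays in R.\<close>

lemma cutoff_slope_bound:
  assumes "R > 0" "k \<ge> 2"
  shows "cutoff_slope k R x * (norm x)\<^sup>2 \<le> 2 * real k" and "cutoff_slope k R x * norm x \<le> 2 * real k / R"
proof -
  have R2: "R\<^sup>2 > 0" using assms by simp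
  consider "norm x > R" | "norm x \<le> R" by linarith
  hence "cutoff_slope k R x * (norm x)\<^sup>2 \<le> 2 * real k \<and> cutoff_slope k R x * norm x \<le> 2 * real k / R"
  proof cases
    case 1
    hence "cutoff_slope k R x = 0"
      using assms power_strict_mono[of R "norm x" 2] by (simp add: cutoff_slope_def max_def)
    thus ?thesis using assms by simp
  next
    case 2
    hence sq: "(norm x)\<^sup>2 \<le> R\<^sup>2" by (intro power_mono) auto
    have "(max 0 (1 - (norm x)\<^sup>2 / R\<^sup>2)) ^ (k - 1) \<le> 1" by (auto intro!: power_le_one)
    hence le: "cutoff_slope k R x \<le> 2 * real k / R\<^sup>2"
      unfolding cutoff_slope_def using R2 by (intro mult_left_le) auto
    have "cutoff_slope k R x * (norm x)\<^sup>2 \<le> 2 * real k / R\<^sup>2 * R\<^sup>2"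
      using le sq by (intro mult_mono) auto
    moreover have "cutoff_slope k R x * norm x \<le> 2 * real k / R\<^sup>2 * R"
      using le 2 assms by (intro mult_mono) auto
    ultimately show ?thesis using assms by (simp add: power2_eq_square)
  qed
  thus "cutoff_slope k R x * (norm x)\<^sup>2 \<le> 2 * real k" "cutoff_slope k R x * norm x \<le> 2 * real k / R" by auto
qed

lemma cutoff_tendsto:
  fixes x :: "real ^ 'n::finite"
  assumes "k \<ge> 2"
  shows "(\<lambda>n. cutoff k (real (Suc n)) x) \<longlonglongrightarrow> 1" and "(\<lambda>n. cutoff_slope k (real (Suc n)) x) \<longlonglongrightarrow> 0"
proof -
  have inv: "(\<lambda>n. inverse (real (Suc n))) \<longlonglongrightarrow> 0" by (rule LIMSEQ_inverse_real_of_nat)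
  have "(\<lambda>n. (max 0 (1 - (norm x)\<^sup>2 * (inverse (real (Suc n)))\<^sup>2)) ^ k) \<longlonglongrightarrow> (max 0 (1 - (norm x)\<^sup>2 * 0\<^sup>2)) ^ k"
    by (intro tendsto_intros inv)
  thus "(\<lambda>n. cutoff k (real (Suc n)) x) \<longlonglongrightarrow> 1"
    by (simp add: cutoff_def divide_inverse power_inverse)
  have "(\<lambda>n. 2 * real k * (inverse (real (Suc n)))\<^sup>2 * (max 0 (1 - (norm x)\<^sup>2 * (inverse (real (Suc n)))\<^sup>2)) ^ (k - 1))
      \<longlonglongrightarrow> 2 * real k * 0\<^sup>2 * (max 0 (1 - (norm x)\<^sup>2 * 0\<^sup>2)) ^ (k - 1)"
    by (intro tendsto_intros inv)
  thus "(\<lambda>n. cutoff_slope k (real (Suc n)) x) \<longlonglongrightarrow> 0"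
    by (simp add: cutoff_slope_def divide_inverse power_inverse)
qed

section \<open>The Pohozaev identity and the ergodic constant\<close>

lemma has_bochner_integral_limit_0:
  fixes A :: "nat \<Rightarrow> 'a \<Rightarrow> real"
  assumes A: "\<And>n. has_bochner_integral M (A n) 0"
    and lim: "\<And>x. (\<lambda>n. A n x) \<longlonglongrightarrow> a x"
    and w: "integrable M w" "\<And>n x. \<bar>A n x\<bar> \<le> w x"
  shows "has_bochner_integral M a 0"
proof -
  have mA: "A n \<in> borel_measurable M" for n using A by (auto simp: has_bochner_integral_iff)
  have ma: "a \<in> borel_measurable M" by (rule borel_measurable_LIMSEQ_real[OF lim mA])
  have AE: "AE x in M. (\<lambda>n. A n x) \<longlonglongrightarrow> a x" "\<And>n. AE x in M. norm (A n x) \<le> w x" using lim w(2) by auto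
  have "integrable M a" by (rule integrable_dominated_convergence[OF ma mA w(1) AE])
  moreover have "(\<lambda>n. integral\<^sup>L M (A n)) \<longlonglongrightarrow> integral\<^sup>L M a"
    by (rule integral_dominated_convergence[OF ma mA w(1) AE])
  moreover have "integral\<^sup>L M (A n) = 0" for n using A by (simp add: has_bochner_integral_iff)
  ultimately show ?thesis by (simp add: has_bochner_integral_iff LIMSEQ_const_iff)
qed

lemma has_bochner_integral_sum_0:
  fixes f :: "'i \<Rightarrow> 'a \<Rightarrow> real"
  assumes "\<And>i. i \<in> I \<Longrightarrow> has_bochner_integral M (f i) 0"
  shows "has_bochner_integral M (\<lambda>x. \<Sum>i\<in>I. f i x) 0"
  using has_bochner_integral_sum[of I M f "\<lambda>_. 0"] assms by simp

text \<open>\<open>D i\<close> is the gradient of the i-th component of \<open>p\<close>, so that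
  the trace of \<open>D\<close> is the Laplacian. The nonlinearity enters through the pointwise
  equation, two integrability statements and \<open>chain\<close>; its growth bound is spent before
  the locale is entered.\<close>

locale mfg_pair =
  fixes u :: "real ^ 'n::finite \<Rightarrow> real" and p :: "real ^ 'n \<Rightarrow> real ^ 'n"
    and D :: "'n \<Rightarrow> real ^ 'n \<Rightarrow> real ^ 'n"
    and m :: "real ^ 'n \<Rightarrow> real" and Dm :: "real ^ 'n \<Rightarrow> real ^ 'n"
    and f F :: "real \<Rightarrow> real" and \<gamma> lam :: real
  assumes gamma: "\<gamma> > 1"
    and u: "is_grad u p" and p: "\<And>i. is_grad (\<lambda>x. p x $ i) (D i)"
    and m: "W11 m Dm" and pos: "\<And>x. m x > 0"
    and hjb: "\<And>x. (\<Sum>i\<in>UNIV. D i x $ i) = 1 / \<gamma> * norm (p x) powr \<gamma> + lam + f (m x)"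
    and kfp: "\<And>\<phi>. test_function \<phi> \<Longrightarrow> (LINT x|lebesgue. Dm x \<bullet> grad \<phi> x
        + m x * ((norm (p x) powr (\<gamma> - 2) *\<^sub>R p x) \<bullet> grad \<phi> x)) = 0"
    and mass: "(LINT x|lebesgue. m x) = 1"
    and kinetic: "integrable lebesgue (\<lambda>x. norm (p x) powr \<gamma> * m x)"
    and cross: "integrable lebesgue (\<lambda>x. norm (p x) * norm (Dm x))"
    and fm: "integrable lebesgue (\<lambda>x. f (m x) * m x)"
    and Fm: "integrable lebesgue (\<lambda>x. F (m x))"
    and chain: "\<And>\<psi> \<Psi> i. is_grad \<psi> \<Psi> \<Longrightarrow> compsupp \<psi> \<Longrightarrow>
      has_bochner_integral lebesgue (\<lambda>x. F (m x) * \<Psi> x $ i + f (m x) * Dm x $ i * \<psi> x) 0"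
    and coercive: "filterlim u at_top at_infinity"
begin

text \<open>\<open>P\<close> is H evaluated at the gradient of \<open>u\<close>, and
  \<open>b\<close> is the gradient of H there. \<open>P\<close> is C1 by the chain rule;
  \<open>b\<close> is used only as a continuous field.\<close>

definition b :: "real ^ 'n \<Rightarrow> real ^ 'n" where "b x = norm (p x) powr (\<gamma> - 2) *\<^sub>R p x"
definition P :: "real ^ 'n \<Rightarrow> real" where "P x = 1 / \<gamma> * norm (p x) powr \<gamma>"
definition lap :: "real ^ 'n \<Rightarrow> real" where "lap x = (\<Sum>i\<in>UNIV. D i x $ i)"

lemma mi: "integrable lebesgue m" and Dmi: "integrable lebesgue Dm"
  using m by (auto simp: W11_def)

lemma lap_eq: "lap x = P x + lam + f (m x)"
  by (simp add: lap_def P_def hjb)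

lemma m_nonneg: "m x \<ge> 0" using pos[of x] by simp

lemma norm_b: "norm (b x) = norm (p x) powr (\<gamma> - 1)"
  unfolding b_def by (rule norm_powr_drift)

lemma norm_b_p: "norm (b x) * norm (p x) = norm (p x) powr \<gamma>"
proof (cases "p x = 0")
  case False
  hence "norm (b x) * norm (p x) = norm (p x) powr (\<gamma> - 1) * norm (p x) powr 1" by (simp add: norm_b)
  thus ?thesis by (simp only: powr_add[symmetric]) simp
qed (use gamma in simp)

lemma b_p: "b x \<bullet> p x = norm (p x) powr \<gamma>"
proof -
  have "b x \<bullet> p x = norm (b x) * norm (p x)"
    by (simp add: b_def power2_norm_eq_inner[symmetric] power2_eq_square)
  thus ?thesis by (simp add: norm_b_p)
qed

text \<open>Controls the powers \<open>\<gamma> - 1\<close> and 1 of the gradient, weighted with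
  \<open>m\<close>, by the mass and the kinetic energy.\<close>

lemma powr_le_1_plus: "0 < a \<Longrightarrow> a \<le> \<gamma> \<Longrightarrow> s \<ge> 0 \<Longrightarrow> s powr a \<le> 1 + s powr \<gamma>" for s a :: real
proof (cases "s \<le> 1")
  case True
  assume "0 < a" "s \<ge> 0"
  hence "s powr a \<le> 1 powr a" using True by (intro powr_mono2) auto
  moreover have "s powr \<gamma> \<ge> 0" by simp
  ultimately show ?thesis unfolding powr_one_eq_one by linarith
next
  case False
  assume "a \<le> \<gamma>"
  hence "s powr a \<le> s powr \<gamma>" using False by (intro powr_mono) auto
  thus ?thesis by linarith
qed

lemma p_continuous: "continuous_on UNIV p" by (rule is_grad_continuous[OF u])

lemma is_grad_P: "is_grad P (\<lambda>x. \<Sum>k\<in>UNIV. (b x $ k) *\<^sub>R D k x)"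
  using is_grad_compose_vec[OF is_grad_norm_powr[OF gamma] p] unfolding P_def b_def .

lemma b_continuous: "continuous_on UNIV b"
  unfolding b_def
  by (rule continuous_on_compose2[OF is_grad_continuous[OF is_grad_norm_powr[OF gamma]] p_continuous]) auto

lemma kinetic': "integrable lebesgue (\<lambda>x. m x * norm (p x) powr \<gamma>)"
  using kinetic by (simp add: mult.commute)

lemma integrable_mb: "integrable lebesgue (\<lambda>x. m x *\<^sub>R b x)"
proof (rule Bochner_Integration.integrable_bound)
  show "integrable lebesgue (\<lambda>x. m x + m x * norm (p x) powr \<gamma>)" using mi kinetic' by auto
  show "(\<lambda>x. m x *\<^sub>R b x) \<in> borel_measurable lebesgue"
    using mi continuous_lebesgue_measurable[OF b_continuous] by auto
  show "AE x in lebesgue. norm (m x *\<^sub>R b x) \<le> norm (m x + m x * norm (p x) powr \<gamma>)"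
  proof (rule AE_I2)
    fix x
    have "norm (b x) \<le> 1 + norm (p x) powr \<gamma>" unfolding norm_b using gamma by (intro powr_le_1_plus) auto
    from mult_left_mono[OF this m_nonneg[of x]]
    show "norm (m x *\<^sub>R b x) \<le> norm (m x + m x * norm (p x) powr \<gamma>)"
      using m_nonneg[of x] by (simp add: algebra_simps)
  qed
qed

lemma integrable_mp: "integrable lebesgue (\<lambda>x. m x * norm (p x))"
proof (rule Bochner_Integration.integrable_bound)
  show "integrable lebesgue (\<lambda>x. m x + m x * norm (p x) powr \<gamma>)" using mi kinetic' by auto
  show "(\<lambda>x. m x * norm (p x)) \<in> borel_measurable lebesgue"
    using mi continuous_lebesgue_measurable[OF p_continuous] by auto
  show "AE x in lebesgue. norm (m x * norm (p x)) \<le> norm (m x + m x * norm (p x) powr \<gamma>)"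
  proof (rule AE_I2)
    fix x
    have "norm (p x) powr 1 \<le> 1 + norm (p x) powr \<gamma>" using gamma by (intro powr_le_1_plus) auto
    hence "norm (p x) \<le> 1 + norm (p x) powr \<gamma>" by simp
    from mult_left_mono[OF this m_nonneg[of x]]
    show "norm (m x * norm (p x)) \<le> norm (m x + m x * norm (p x) powr \<gamma>)"
      using m_nonneg[of x] by (simp add: algebra_simps)
  qed
qed

text \<open>The flux: the second equation says that its weak divergence is zero.\<close>

definition Z :: "real ^ 'n \<Rightarrow> real ^ 'n" where "Z x = Dm x + m x *\<^sub>R b x"

lemma Z_test: "is_grad \<phi> \<Phi> \<Longrightarrow> compsupp \<phi> \<Longrightarrow> has_bochner_integral lebesgue (\<lambda>x. Z x \<bullet> \<Phi> x) 0"
proof (rule divergence_free_test_C1)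
  show "integrable lebesgue Z" unfolding Z_def using Dmi integrable_mb by auto
  show "(LINT x|lebesgue. Z x \<bullet> grad \<phi> x) = 0" if "test_function \<phi>" for \<phi>
    using kfp[OF that] by (simp add: Z_def b_def inner_add_left mult.assoc)
qed

lemma Dm_p_integrable: "integrable lebesgue (\<lambda>x. Dm x \<bullet> p x)"
proof (rule Bochner_Integration.integrable_bound[OF cross])
  show "(\<lambda>x. Dm x \<bullet> p x) \<in> borel_measurable lebesgue"
    using Dmi continuous_lebesgue_measurable[OF p_continuous] by auto
  show "AE x in lebesgue. norm (Dm x \<bullet> p x) \<le> norm (norm (p x) * norm (Dm x))"
    using Cauchy_Schwarz_ineq2 by (auto simp: mult.commute abs_mult)
qed

lemma is_grad_x_p: "is_grad (\<lambda>x. x \<bullet> p x) (\<lambda>x. p x + (\<Sum>i\<in>UNIV. x $ i *\<^sub>R D i x))"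
proof -
  have "is_grad (\<lambda>x. \<Sum>i\<in>UNIV. x $ i * p x $ i) (\<lambda>x. \<Sum>i\<in>UNIV. x $ i *\<^sub>R D i x + p x $ i *\<^sub>R axis i 1)"
    by (intro is_grad_sum is_grad_mult is_grad_coord p) auto
  moreover have "(\<Sum>i\<in>UNIV. p x $ i *\<^sub>R axis i 1) = p x" for x
    by (simp add: basis_expansion flip: scalar_mult_eq_scaleR)
  ultimately show ?thesis
    by (elim is_grad_eq) (simp_all add: inner_vec_def sum.distrib add.commute)
qed

lemma u_hessian_symmetric: "D i x $ j = D j x $ i"
  by (rule hessian_symmetric[OF u p])

section \<open>Energy identities\<close>

text \<open>The test function is (n+1-u)_+^2 - (n-u)_+^2. It is C1, vanishes where u is at least
  n+1, hence outside a ball, and its gradient is -2 \<open>?\<tau> n\<close> \<open>p\<close>, with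
  a factor \<open>?\<tau> n\<close> between 0 and 1 that equals 1 where u is at most n. A spatial
  cutoff would leave a term with \<open>u\<close> undifferentiated, for which no integrability is
  given.\<close>

lemma gradient_tested_with_potential: "has_bochner_integral lebesgue (\<lambda>x. Dm x \<bullet> p x + m x * norm (p x) powr \<gamma>) 0"
proof -
  let ?\<tau> = "\<lambda>n x. max 0 (real n + 1 - u x) - max 0 (real n - u x)"
  have lim: "(\<lambda>n. ?\<tau> n x) \<longlonglongrightarrow> 1" for x
  proof -
    obtain N :: nat where "u x \<le> real N" using real_arch_simple by blast
    hence "1 = ?\<tau> n x" if "n \<ge> N" for n using that by auto
    hence "\<forall>\<^sub>F n in sequentially. 1 = ?\<tau> n x" by (auto simp: eventually_sequentially)
    thus ?thesis by (rule Lim_transform_eventually[OF tendsto_const])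
  qed
  have \<tau>: "\<bar>?\<tau> n x\<bar> \<le> 1" for n x by (auto simp: max_def)
  have "has_bochner_integral lebesgue (\<lambda>x. - 2 * (?\<tau> n x * (Dm x \<bullet> p x + m x * norm (p x) powr \<gamma>))) 0" for n
  proof -
    have g: "is_grad (\<lambda>x. (max 0 (k - u x)) ^ 2) (\<lambda>x. (- 2 * max 0 (k - u x)) *\<^sub>R p x)" for k :: real
    proof -
      have "is_grad (\<lambda>x. k - u x) (\<lambda>x. 0 - p x)" by (intro is_grad_diff is_grad_const u)
      hence "is_grad (\<lambda>x. (max 0 (k - u x)) ^ 2) (\<lambda>x. (real 2 * (max 0 (k - u x)) ^ (2 - 1)) *\<^sub>R (0 - p x))"
        by (rule is_grad_compose[OF _ max_power_has_derivative]) (auto intro!: continuous_intros)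
      thus ?thesis by (rule is_grad_eq) simp_all
    qed
    have s: "compsupp (\<lambda>x. (max 0 (real n + 1 - u x)) ^ 2 - (max 0 (real n - u x)) ^ 2)"
    proof -
      have "\<forall>\<^sub>F x in at_infinity. u x \<ge> real n + 1"
        using coercive by (simp add: filterlim_at_top)
      then obtain r where "\<And>x. norm x \<ge> r \<Longrightarrow> u x \<ge> real n + 1" by (auto simp: eventually_at_infinity)
      hence "(max 0 (real n + 1 - u x)) ^ 2 - (max 0 (real n - u x)) ^ 2 = 0" if "norm x > r" for x
      proof -
        have "u x \<ge> real n + 1" using \<open>\<And>x. norm x \<ge> r \<Longrightarrow> u x \<ge> real n + 1\<close>[of x] that by simp
        hence "max 0 (real n + 1 - u x) = 0" "max 0 (real n - u x) = 0" by auto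
        thus ?thesis by simp
      qed
      thus ?thesis unfolding compsupp_def by blast
    qed
    from Z_test[OF is_grad_diff[OF g g] s] show ?thesis
      by (simp add: Z_def inner_diff_right inner_add_left b_p algebra_simps)
  qed
  hence "has_bochner_integral lebesgue (\<lambda>x. - 2 * (1 * (Dm x \<bullet> p x + m x * norm (p x) powr \<gamma>))) 0"
  proof (rule has_bochner_integral_limit_0)
    show "(\<lambda>n. - 2 * (?\<tau> n x * (Dm x \<bullet> p x + m x * norm (p x) powr \<gamma>)))
        \<longlonglongrightarrow> - 2 * (1 * (Dm x \<bullet> p x + m x * norm (p x) powr \<gamma>))" for x
      by (intro tendsto_mult lim tendsto_const)
    show "integrable lebesgue (\<lambda>x. 2 * (1 * \<bar>Dm x \<bullet> p x + m x * norm (p x) powr \<gamma>\<bar>))"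
      using Dm_p_integrable kinetic' by auto
    show "\<bar>- 2 * (?\<tau> n x * (Dm x \<bullet> p x + m x * norm (p x) powr \<gamma>))\<bar> \<le> 2 * (1 * \<bar>Dm x \<bullet> p x + m x * norm (p x) powr \<gamma>\<bar>)" for n x
      using mult_right_mono[OF \<tau>[of n x] abs_ge_zero[of "Dm x \<bullet> p x + m x * norm (p x) powr \<gamma>"]]
      by (simp only: abs_mult) simp
  qed
  from has_bochner_integral_mult_right[OF this, of "- 1 / 2"]
  have "has_bochner_integral lebesgue (\<lambda>x. - 1 / 2 * (- 2 * (1 * (Dm x \<bullet> p x + m x * norm (p x) powr \<gamma>)))) 0" by simp
  moreover have "- 1 / 2 * (- 2 * (1 * t)) = t" for t :: real by simp
  ultimately show ?thesis by (simp only:)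
qed

text \<open>Integration by parts of \<open>m\<close> against the field \<open>\<eta> p\<close>,
  whose divergence contains the Laplacian that the first equation replaces. The cutoff error is a
  slope times m (x . p), bounded by a multiple of m |p|.\<close>

lemma hjb_tested_with_density: "has_bochner_integral lebesgue (\<lambda>x. m x * (P x + lam + f (m x)) + Dm x \<bullet> p x) 0"
proof -
  let ?\<eta> = "\<lambda>n. cutoff 2 (real (Suc n)) :: real ^ 'n \<Rightarrow> real"
  let ?c = "\<lambda>n. cutoff_slope 2 (real (Suc n)) :: real ^ 'n \<Rightarrow> real"
  let ?A = "\<lambda>x. m x * (P x + lam + f (m x)) + Dm x \<bullet> p x"
  have "has_bochner_integral lebesgue (\<lambda>x. ?\<eta> n x * ?A x - ?c n x * (m x * (x \<bullet> p x))) 0" for n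
  proof -
    have "has_bochner_integral lebesgue (\<lambda>x. \<Sum>i\<in>UNIV. m x * (?\<eta> n x *\<^sub>R D i x + p x $ i *\<^sub>R (- ?c n x *\<^sub>R x)) $ i
        + Dm x $ i * (?\<eta> n x * p x $ i)) 0"
      by (intro has_bochner_integral_sum_0 W11_integration_by_parts[OF m is_grad_mult[OF is_grad_cutoff p]]
          compsupp_mult_left compsupp_cutoff) auto
    moreover have "(\<Sum>i\<in>UNIV. m x * (?\<eta> n x *\<^sub>R D i x + p x $ i *\<^sub>R (- ?c n x *\<^sub>R x)) $ i + Dm x $ i * (?\<eta> n x * p x $ i))
      = ?\<eta> n x * (m x * lap x + Dm x \<bullet> p x) - ?c n x * (m x * (x \<bullet> p x))" for x
      by (simp add: lap_def inner_vec_def sum.distrib sum_subtractf sum_distrib_left algebra_simps)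
    ultimately show ?thesis by (simp add: lap_eq)
  qed
  hence "has_bochner_integral lebesgue (\<lambda>x. 1 * ?A x - 0 * (m x * (x \<bullet> p x))) 0"
  proof (rule has_bochner_integral_limit_0)
    show "(\<lambda>n. ?\<eta> n x * ?A x - ?c n x * (m x * (x \<bullet> p x))) \<longlonglongrightarrow> 1 * ?A x - 0 * (m x * (x \<bullet> p x))" for x
      by (intro tendsto_diff tendsto_mult cutoff_tendsto tendsto_const) auto
    have "integrable lebesgue (\<lambda>x. 1 / \<gamma> * (m x * norm (p x) powr \<gamma>) + lam * m x + f (m x) * m x + Dm x \<bullet> p x)"
      by (intro Bochner_Integration.integrable_add integrable_mult_right kinetic' mi fm Dm_p_integrable)
    moreover have "1 / \<gamma> * (m x * norm (p x) powr \<gamma>) + lam * m x + f (m x) * m x + Dm x \<bullet> p x = ?A x" for x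
      by (simp add: P_def algebra_simps)
    ultimately have "integrable lebesgue ?A" by simp
    thus "integrable lebesgue (\<lambda>x. \<bar>?A x\<bar> + 4 * (m x * norm (p x)))" using integrable_mp by auto
    fix n x
    have 1: "\<bar>?\<eta> n x * ?A x\<bar> \<le> \<bar>?A x\<bar>"
      unfolding abs_mult using cutoff_bounds[of 2 "real (Suc n)" x] by (intro mult_left_le_one_le) auto
    have 2: "\<bar>?c n x * (m x * (x \<bullet> p x))\<bar> \<le> 4 * (m x * norm (p x))"
    proof -
      have "\<bar>?c n x * (m x * (x \<bullet> p x))\<bar> \<le> ?c n x * (m x * (norm x * norm (p x)))"
        using cutoff_slope_nonneg[of 2 "real (Suc n)" x] m_nonneg[of x] Cauchy_Schwarz_ineq2[of x "p x"]
        by (simp add: abs_mult mult_left_mono)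
      also have "\<dots> = (?c n x * norm x) * (m x * norm (p x))" by simp
      also have "\<dots> \<le> 4 * (m x * norm (p x))"
      proof (rule mult_right_mono)
        \<comment> \<open>The 4 is 2k with k = 2; the radius \<open>real (Suc n)\<close> is at least
          1.\<close>
        have "?c n x * norm x \<le> 2 * real 2 / real (Suc n)" by (rule cutoff_slope_bound) auto
        also have "\<dots> \<le> 4" by (simp add: field_simps)
        finally show "?c n x * norm x \<le> 4" .
      qed (use m_nonneg in auto)
      finally show ?thesis .
    qed
    show "\<bar>?\<eta> n x * ?A x - ?c n x * (m x * (x \<bullet> p x))\<bar> \<le> \<bar>?A x\<bar> + 4 * (m x * norm (p x))"
      by (rule order_trans[OF abs_triangle_ineq4 add_mono[OF 1 2]])
  qed
  thus ?thesis by simp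
qed

section \<open>The Pohozaev identity by dilations\<close>

lemma inner_sum_coord: "(\<Sum>i\<in>UNIV. (v $ i) * (w $ i)) = v \<bullet> w" for v w :: "real ^ 'n"
  by (simp add: inner_vec_def)

text \<open>The equation for \<open>u\<close> tested with the generator \<open>x \<bullet> Dm\<close> of dilations of \<open>m\<close> and the equation for
  \<open>m\<close> tested with \<open>x \<bullet> p\<close>, the generator of dilations of \<open>u\<close>.\<close>

lemma localized_pohozaev:
  fixes R :: real
  assumes R: "R > 0"
  defines "\<eta> \<equiv> cutoff 2 R :: real ^ 'n \<Rightarrow> real" and "c \<equiv> cutoff_slope 2 R :: real ^ 'n \<Rightarrow> real"
  shows "has_bochner_integral lebesgue (\<lambda>x.
    (m x * (P x + lam) + F (m x)) * (real CARD('n) * \<eta> x - c x * (norm x)\<^sup>2)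
    + (real CARD('n) - 2) * \<eta> x * (Dm x \<bullet> p x) - \<eta> x * (m x * norm (p x) powr \<gamma>)
    - c x * (norm x)\<^sup>2 * (Dm x \<bullet> p x) + c x * (x \<bullet> p x) * (x \<bullet> Dm x) + c x * (x \<bullet> p x) * (x \<bullet> Z x)) 0"
proof -
  let ?N = "real CARD('n)"
  have \<eta>: "is_grad \<eta> (\<lambda>x. - c x *\<^sub>R x)" unfolding \<eta>_def c_def by (rule is_grad_cutoff) simp
  have s: "compsupp \<eta>" unfolding \<eta>_def using R by (intro compsupp_cutoff) auto
  \<comment> \<open>The gradients of the components of the truncated dilation field
    \<open>\<eta> x\<close>; their trace \<open>\<xi>sum\<close> is its divergence.\<close>
  define \<xi> where "\<xi> i x = \<eta> x *\<^sub>R axis i 1 + x $ i *\<^sub>R (- c x *\<^sub>R x)" for i and x :: "real ^ 'n"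
  have \<xi>: "is_grad (\<lambda>x. \<eta> x * x $ i) (\<xi> i)" for i
    unfolding \<xi>_def by (intro is_grad_mult \<eta> is_grad_coord)
  have s\<xi>: "compsupp (\<lambda>x. \<eta> x * x $ i)" for i by (intro compsupp_mult_left s)
  have \<xi>sum: "(\<Sum>i\<in>UNIV. \<xi> i x $ i) = ?N * \<eta> x - c x * (norm x)\<^sup>2" for x
    by (simp add: \<xi>_def sum.distrib sum_subtractf power2_norm_eq_inner inner_vec_def sum_distrib_left ac_simps)
  define Q where "Q x = (\<Sum>k\<in>UNIV. (b x $ k) *\<^sub>R D k x)" for x
  define DX where "DX x = (\<Sum>i\<in>UNIV. x $ i *\<^sub>R D i x)" for x
  \<comment> \<open>Symmetry of the Hessian of \<open>u\<close> as a bilinear form;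
    \<open>DX\<close> and \<open>Q\<close> are the Hessian applied to \<open>x\<close> and to
    \<open>b\<close>.\<close>
  have DXsym: "(\<Sum>i\<in>UNIV. v $ i *\<^sub>R D i x) \<bullet> w = (\<Sum>i\<in>UNIV. w $ i *\<^sub>R D i x) \<bullet> v" for v w x
  proof -
    have "(\<Sum>i\<in>UNIV. v $ i *\<^sub>R D i x) \<bullet> w = (\<Sum>i\<in>UNIV. \<Sum>j\<in>UNIV. v $ i * w $ j * D i x $ j)"
      unfolding inner_sum_left inner_scaleR_left
      by (simp add: inner_vec_def sum_distrib_left mult.commute mult.left_commute)
    also have "\<dots> = (\<Sum>j\<in>UNIV. \<Sum>i\<in>UNIV. v $ i * w $ j * D i x $ j)" by (rule sum.swap)
    also have "\<dots> = (\<Sum>j\<in>UNIV. \<Sum>i\<in>UNIV. w $ j * v $ i * D j x $ i)"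
      by (simp add: u_hessian_symmetric mult.commute)
    also have "\<dots> = (\<Sum>i\<in>UNIV. w $ i *\<^sub>R D i x) \<bullet> v"
      unfolding inner_sum_left inner_scaleR_left
      by (simp add: inner_vec_def sum_distrib_left mult.commute mult.left_commute)
    finally show ?thesis .
  qed

  \<comment> \<open>The second equation tested with \<open>\<eta> (x . p)\<close>.\<close>
  have T1: "has_bochner_integral lebesgue (\<lambda>x. \<eta> x * (Z x \<bullet> p x) + \<eta> x * (Z x \<bullet> DX x) - c x * (x \<bullet> p x) * (x \<bullet> Z x)) 0"
    using Z_test[OF is_grad_mult[OF \<eta> is_grad_x_p] compsupp_mult_left[OF s]]
    by (simp add: DX_def[symmetric] inner_add_right inner_commute[of "Z _" _] algebra_simps)

  \<comment> \<open>\<open>T2\<close>, \<open>T3\<close> and \<open>T4\<close> integrate by parts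
    the products of \<open>\<eta> (x . Dm)\<close> with \<open>P\<close>, \<open>lam\<close> and
    \<open>f (m x)\<close>, the three parts of the right side of the first equation.\<close>
  have T2: "has_bochner_integral lebesgue (\<lambda>x. m x * (\<eta> x * (x \<bullet> Q x) + P x * (?N * \<eta> x - c x * (norm x)\<^sup>2)) + \<eta> x * P x * (x \<bullet> Dm x)) 0"
  proof -
    have "has_bochner_integral lebesgue (\<lambda>x. \<Sum>i\<in>UNIV. m x * ((\<eta> x * x $ i) *\<^sub>R Q x + P x *\<^sub>R \<xi> i x) $ i + Dm x $ i * (\<eta> x * x $ i * P x)) 0"
      unfolding Q_def
      by (intro has_bochner_integral_sum_0 W11_integration_by_parts[OF m is_grad_mult[OF \<xi> is_grad_P]] compsupp_mult_left s)
    moreover have "(\<Sum>i\<in>UNIV. m x * ((\<eta> x * x $ i) *\<^sub>R Q x + P x *\<^sub>R \<xi> i x) $ i + Dm x $ i * (\<eta> x * x $ i * P x))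
      = m x * (\<eta> x * (x \<bullet> Q x) + P x * (\<Sum>i\<in>UNIV. \<xi> i x $ i)) + \<eta> x * P x * (x \<bullet> Dm x)" for x
      by (simp add: inner_vec_def sum.distrib sum_distrib_left algebra_simps)
    ultimately show ?thesis by (simp add: \<xi>sum)
  qed

  have T3: "has_bochner_integral lebesgue (\<lambda>x. lam * (m x * (?N * \<eta> x - c x * (norm x)\<^sup>2) + \<eta> x * (x \<bullet> Dm x))) (lam * 0)"
  proof (rule has_bochner_integral_mult_right)
    have "has_bochner_integral lebesgue (\<lambda>x. \<Sum>i\<in>UNIV. m x * \<xi> i x $ i + Dm x $ i * (\<eta> x * x $ i)) 0"
      by (intro has_bochner_integral_sum_0 W11_integration_by_parts[OF m \<xi>] s\<xi>)
    moreover have "(\<Sum>i\<in>UNIV. m x * \<xi> i x $ i + Dm x $ i * (\<eta> x * x $ i))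
        = m x * (\<Sum>i\<in>UNIV. \<xi> i x $ i) + \<eta> x * (x \<bullet> Dm x)" for x
      by (simp add: inner_vec_def sum.distrib sum_distrib_left algebra_simps)
    ultimately show "has_bochner_integral lebesgue (\<lambda>x. m x * (?N * \<eta> x - c x * (norm x)\<^sup>2) + \<eta> x * (x \<bullet> Dm x)) 0"
      by (simp add: \<xi>sum)
  qed

  have T4: "has_bochner_integral lebesgue (\<lambda>x. F (m x) * (?N * \<eta> x - c x * (norm x)\<^sup>2) + f (m x) * \<eta> x * (x \<bullet> Dm x)) 0"
  proof -
    have "has_bochner_integral lebesgue (\<lambda>x. \<Sum>i\<in>UNIV. F (m x) * \<xi> i x $ i + f (m x) * Dm x $ i * (\<eta> x * x $ i)) 0"
      by (intro has_bochner_integral_sum_0 chain[OF \<xi>] s\<xi>)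
    moreover have "(\<Sum>i\<in>UNIV. F (m x) * \<xi> i x $ i + f (m x) * Dm x $ i * (\<eta> x * x $ i))
        = F (m x) * (\<Sum>i\<in>UNIV. \<xi> i x $ i) + f (m x) * \<eta> x * (x \<bullet> Dm x)" for x
      by (simp add: inner_vec_def sum.distrib sum_distrib_left algebra_simps)
    ultimately show ?thesis by (simp add: \<xi>sum)
  qed

  \<comment> \<open>The curl identity summed over the tensor with entries
    \<open>\<eta> x_j p_i\<close>, whose gradients are \<open>?T i j\<close>. It trades the
    Laplacian term \<open>\<eta> lap (x . Dm)\<close> for \<open>\<eta> (Dm . DX)\<close>, the
    Hessian term in \<open>T1\<close>, plus first-order terms.\<close>
  have T5: "has_bochner_integral lebesgue (\<lambda>x. \<eta> x * (Dm x \<bullet> DX x) + (Dm x \<bullet> p x) * (?N * \<eta> x - c x * (norm x)\<^sup>2)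
      - (\<eta> x * lap x * (x \<bullet> Dm x) + \<eta> x * (Dm x \<bullet> p x) - c x * (x \<bullet> p x) * (x \<bullet> Dm x))) 0"
  proof -
    let ?T = "\<lambda>i j x. (\<eta> x * x $ j) *\<^sub>R D i x + p x $ i *\<^sub>R \<xi> j x"
    have "has_bochner_integral lebesgue (\<lambda>x. \<Sum>i\<in>UNIV. \<Sum>j\<in>UNIV. Dm x $ i * ?T i j x $ j - Dm x $ j * ?T i j x $ i) 0"
      by (intro has_bochner_integral_sum_0 W11_curl_free[OF m is_grad_mult[OF \<xi> p]] compsupp_mult_left s)
    moreover have "(\<Sum>i\<in>UNIV. \<Sum>j\<in>UNIV. Dm x $ i * ?T i j x $ j - Dm x $ j * ?T i j x $ i)
      = \<eta> x * (Dm x \<bullet> DX x) + (Dm x \<bullet> p x) * (?N * \<eta> x - c x * (norm x)\<^sup>2)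
      - (\<eta> x * lap x * (x \<bullet> Dm x) + \<eta> x * (Dm x \<bullet> p x) - c x * (x \<bullet> p x) * (x \<bullet> Dm x))" for x
    proof -
      have 1: "(\<Sum>j\<in>UNIV. Dm x $ i * ?T i j x $ j) = \<eta> x * (Dm x $ i * (D i x \<bullet> x)) + (Dm x $ i * p x $ i) * (\<Sum>j\<in>UNIV. \<xi> j x $ j)" for i
        by (simp add: inner_vec_def sum.distrib sum_distrib_left algebra_simps)
      have 2: "(\<Sum>j\<in>UNIV. Dm x $ j * \<xi> j x $ i) = \<eta> x * Dm x $ i - c x * (x \<bullet> Dm x) * x $ i" for i
      proof -
        have "(\<Sum>j\<in>UNIV. Dm x $ j * axis j 1 $ i) = Dm x $ i"
          by (simp add: axis_def if_distrib[of "\<lambda>z. _ * z"] cong: if_cong)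
        hence "(\<Sum>j\<in>UNIV. \<eta> x * (Dm x $ j * axis j 1 $ i)) = \<eta> x * Dm x $ i" by (simp only: sum_distrib_left[symmetric])
        thus ?thesis
          by (simp add: \<xi>_def inner_vec_def sum_subtractf sum_distrib_left sum_distrib_right algebra_simps)
      qed
      have 3: "(\<Sum>j\<in>UNIV. Dm x $ j * ?T i j x $ i) = \<eta> x * (x \<bullet> Dm x) * D i x $ i + p x $ i * (\<Sum>j\<in>UNIV. Dm x $ j * \<xi> j x $ i)" for i
        by (simp add: inner_vec_def sum.distrib sum_distrib_left sum_distrib_right algebra_simps)
      have "(\<Sum>i\<in>UNIV. Dm x $ i * (D i x \<bullet> x)) = (\<Sum>i\<in>UNIV. Dm x $ i *\<^sub>R D i x) \<bullet> x"
        by (simp add: inner_sum_left)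
      also have "\<dots> = Dm x \<bullet> DX x" unfolding DX_def by (subst DXsym) (rule inner_commute)
      finally have 4: "(\<Sum>i\<in>UNIV. Dm x $ i * (D i x \<bullet> x)) = Dm x \<bullet> DX x" .
      have "(\<Sum>i\<in>UNIV. \<Sum>j\<in>UNIV. Dm x $ i * ?T i j x $ j - Dm x $ j * ?T i j x $ i)
        = (\<Sum>i\<in>UNIV. (\<Sum>j\<in>UNIV. Dm x $ i * ?T i j x $ j)) - (\<Sum>i\<in>UNIV. (\<Sum>j\<in>UNIV. Dm x $ j * ?T i j x $ i))"
        by (simp only: sum_subtractf)
      also have "(\<Sum>i\<in>UNIV. (\<Sum>j\<in>UNIV. Dm x $ i * ?T i j x $ j))
          = \<eta> x * (Dm x \<bullet> DX x) + (Dm x \<bullet> p x) * (?N * \<eta> x - c x * (norm x)\<^sup>2)"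
        unfolding 1 \<xi>sum sum.distrib 4[symmetric] inner_sum_coord[symmetric, of "Dm x" "p x"]
        by (simp add: sum_distrib_left sum_distrib_right)
      also have "(\<Sum>i\<in>UNIV. (\<Sum>j\<in>UNIV. Dm x $ j * ?T i j x $ i))
          = \<eta> x * lap x * (x \<bullet> Dm x) + \<eta> x * (Dm x \<bullet> p x) - c x * (x \<bullet> p x) * (x \<bullet> Dm x)"
      proof -
        have "(\<Sum>i\<in>UNIV. (\<Sum>j\<in>UNIV. Dm x $ j * ?T i j x $ i))
          = (\<Sum>i\<in>UNIV. (\<eta> x * (x \<bullet> Dm x)) * D i x $ i + \<eta> x * (Dm x $ i * p x $ i) - (c x * (x \<bullet> Dm x)) * (x $ i * p x $ i))"
          unfolding 3 2 by (intro sum.cong refl) (simp add: algebra_simps)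
        also have "\<dots> = (\<eta> x * (x \<bullet> Dm x)) * lap x + \<eta> x * (Dm x \<bullet> p x) - (c x * (x \<bullet> Dm x)) * (x \<bullet> p x)"
          by (simp only: sum.distrib sum_subtractf sum_distrib_left[symmetric] lap_def inner_sum_coord)
        finally show ?thesis by (simp add: algebra_simps)
      qed
      finally show ?thesis .
    qed
    ultimately show ?thesis by (simp only:)
  qed

  have xQ: "x \<bullet> Q x = b x \<bullet> DX x" for x
    unfolding Q_def DX_def using DXsym[of "b x" x x] by (simp add: inner_commute)
  \<comment> \<open>In T2 + T3 + T4 + T5 - T1 all second-order terms cancel: those with x . Dm by
    the first equation, \<open>\<eta> (Dm . DX)\<close> between \<open>T5\<close> and
    \<open>T1\<close>, and \<open>m \<eta> (x . Q)\<close> against \<open>T1\<close> by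
    \<open>xQ\<close>. The coefficient N - 2 collects one \<open>Dm . p\<close> each from
    \<open>T5\<close> and \<open>T1\<close>.\<close>
  have "has_bochner_integral lebesgue (\<lambda>x.
      (m x * (\<eta> x * (x \<bullet> Q x) + P x * (?N * \<eta> x - c x * (norm x)\<^sup>2)) + \<eta> x * P x * (x \<bullet> Dm x))
      + lam * (m x * (?N * \<eta> x - c x * (norm x)\<^sup>2) + \<eta> x * (x \<bullet> Dm x))
      + (F (m x) * (?N * \<eta> x - c x * (norm x)\<^sup>2) + f (m x) * \<eta> x * (x \<bullet> Dm x))
      + (\<eta> x * (Dm x \<bullet> DX x) + (Dm x \<bullet> p x) * (?N * \<eta> x - c x * (norm x)\<^sup>2)
        - (\<eta> x * lap x * (x \<bullet> Dm x) + \<eta> x * (Dm x \<bullet> p x) - c x * (x \<bullet> p x) * (x \<bullet> Dm x)))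
      - (\<eta> x * (Z x \<bullet> p x) + \<eta> x * (Z x \<bullet> DX x) - c x * (x \<bullet> p x) * (x \<bullet> Z x))) (0 + lam * 0 + 0 + 0 - 0)"
    by (intro has_bochner_integral_add has_bochner_integral_diff T1 T2 T3 T4 T5)
  thus ?thesis
    unfolding lap_eq xQ Z_def inner_add_left b_p inner_scaleR_left
    by (rule has_bochner_integral_cong[THEN iffD1, rotated -1]) (simp_all add: algebra_simps)
qed

end

context mfg_pair
begin

text \<open>Every cutoff error carries the slope together with two factors of \<open>x\<close>. It
  is therefore bounded by 4 times an integrable function, while for fixed \<open>x\<close> the slope
  tends to 0.\<close>

lemma pohozaev: "has_bochner_integral lebesgue (\<lambda>x. real CARD('n) * (m x * (P x + lam) + F (m x))
    + (real CARD('n) - 2) * (Dm x \<bullet> p x) - m x * norm (p x) powr \<gamma>) 0"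
proof -
  let ?N = "real CARD('n)"
  let ?\<eta> = "\<lambda>n. cutoff 2 (real (Suc n)) :: real ^ 'n \<Rightarrow> real"
  let ?c = "\<lambda>n. cutoff_slope 2 (real (Suc n)) :: real ^ 'n \<Rightarrow> real"
  let ?E = "\<lambda>x. m x * (P x + lam) + F (m x)"
  let ?K = "\<lambda>x. m x * norm (p x) powr \<gamma>"
  let ?d = "\<lambda>x. norm (p x) * norm (Dm x)"
  have "has_bochner_integral lebesgue (\<lambda>x. ?E x * (?N * ?\<eta> n x - ?c n x * (norm x)\<^sup>2)
    + (?N - 2) * ?\<eta> n x * (Dm x \<bullet> p x) - ?\<eta> n x * ?K x
    - ?c n x * (norm x)\<^sup>2 * (Dm x \<bullet> p x) + ?c n x * (x \<bullet> p x) * (x \<bullet> Dm x) + ?c n x * (x \<bullet> p x) * (x \<bullet> Z x)) 0" for n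
    by (rule localized_pohozaev) simp
  hence "has_bochner_integral lebesgue (\<lambda>x. ?E x * (?N * 1 - 0 * (norm x)\<^sup>2)
    + (?N - 2) * 1 * (Dm x \<bullet> p x) - 1 * ?K x
    - 0 * (norm x)\<^sup>2 * (Dm x \<bullet> p x) + 0 * (x \<bullet> p x) * (x \<bullet> Dm x) + 0 * (x \<bullet> p x) * (x \<bullet> Z x)) 0"
  proof (rule has_bochner_integral_limit_0)
    show "(\<lambda>n. ?E x * (?N * ?\<eta> n x - ?c n x * (norm x)\<^sup>2)
      + (?N - 2) * ?\<eta> n x * (Dm x \<bullet> p x) - ?\<eta> n x * ?K x
      - ?c n x * (norm x)\<^sup>2 * (Dm x \<bullet> p x) + ?c n x * (x \<bullet> p x) * (x \<bullet> Dm x) + ?c n x * (x \<bullet> p x) * (x \<bullet> Z x))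
      \<longlonglongrightarrow> ?E x * (?N * 1 - 0 * (norm x)\<^sup>2)
      + (?N - 2) * 1 * (Dm x \<bullet> p x) - 1 * ?K x
      - 0 * (norm x)\<^sup>2 * (Dm x \<bullet> p x) + 0 * (x \<bullet> p x) * (x \<bullet> Dm x) + 0 * (x \<bullet> p x) * (x \<bullet> Z x)" for x
      by (intro tendsto_add tendsto_diff tendsto_mult cutoff_tendsto tendsto_const) auto
    have "integrable lebesgue (\<lambda>x. 1 / \<gamma> * ?K x + lam * m x + F (m x))"
      by (intro Bochner_Integration.integrable_add integrable_mult_right kinetic' mi Fm)
    hence Ei: "integrable lebesgue ?E" by (simp add: P_def algebra_simps)
    show "integrable lebesgue (\<lambda>x. (?N + 4) * \<bar>?E x\<bar> + \<bar>?N - 2\<bar> * ?d x + ?K x + 4 * ?d x + 4 * ?d x + 4 * (?d x + ?K x))"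
      by (intro Bochner_Integration.integrable_add integrable_mult_right[OF Bochner_Integration.integrable_abs[OF Ei]]
          integrable_mult_right[OF cross] integrable_mult_right[OF Bochner_Integration.integrable_add[OF cross kinetic']] kinetic')
    fix n x
    let ?h = "?\<eta> n x" and ?t = "?c n x * (norm x)\<^sup>2"
    have \<eta>: "0 \<le> ?h" "?h \<le> 1" by (rule cutoff_bounds)+
    have c0: "0 \<le> ?c n x" by (rule cutoff_slope_nonneg)
    have t: "0 \<le> ?t" "?t \<le> 4" using cutoff_slope_bound(1)[of "real (Suc n)" 2 x] c0 by auto
    have K: "?K x \<ge> 0" using m_nonneg by simp
    have dp: "\<bar>Dm x \<bullet> p x\<bar> \<le> ?d x" using Cauchy_Schwarz_ineq2[of "Dm x" "p x"] by (simp add: mult.commute)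
    \<comment> \<open>One factor |x| from each inner product completes slope times |x|^2, which is
      at most 2k = 4.\<close>
    have cross_term: "\<bar>?c n x * (x \<bullet> p x) * (x \<bullet> v)\<bar> \<le> 4 * (norm (p x) * norm v)" for v
    proof -
      have "\<bar>?c n x * (x \<bullet> p x) * (x \<bullet> v)\<bar> = ?c n x * (\<bar>x \<bullet> p x\<bar> * \<bar>x \<bullet> v\<bar>)"
        using c0 by (simp add: abs_mult)
      also have "\<dots> \<le> ?c n x * ((norm x * norm (p x)) * (norm x * norm v))"
        by (intro mult_left_mono mult_mono Cauchy_Schwarz_ineq2 c0) auto
      also have "\<dots> = ?t * (norm (p x) * norm v)" by (simp add: power2_eq_square)
      also have "\<dots> \<le> 4 * (norm (p x) * norm v)" using t by (intro mult_right_mono) auto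
      finally show ?thesis .
    qed
    have b1: "\<bar>?E x * (?N * ?h - ?t)\<bar> \<le> (?N + 4) * \<bar>?E x\<bar>"
    proof -
      have "?N * ?h \<le> ?N * 1" using \<eta> by (intro mult_left_mono) auto
      moreover have "0 \<le> ?N * ?h" using \<eta> by simp
      ultimately have "\<bar>?N * ?h - ?t\<bar> \<le> ?N + 4" using t by linarith
      from mult_right_mono[OF this abs_ge_zero[of "?E x"]] show ?thesis by (simp only: abs_mult mult.commute)
    qed
    \<comment> \<open>The absolute value is needed because N - 2 is negative in dimension
      one.\<close>
    have b2: "\<bar>(?N - 2) * ?h * (Dm x \<bullet> p x)\<bar> \<le> \<bar>?N - 2\<bar> * ?d x"
    proof -
      have "?h * \<bar>Dm x \<bullet> p x\<bar> \<le> 1 * ?d x" using \<eta> dp by (intro mult_mono) auto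
      from mult_left_mono[OF this abs_ge_zero[of "?N - 2"]] show ?thesis
        using \<eta> by (simp add: abs_mult mult.assoc)
    qed
    have b3: "\<bar>?h * ?K x\<bar> \<le> ?K x"
      using \<eta> K mult_right_mono[OF \<eta>(2) K] m_nonneg[of x] by (simp add: abs_mult)
    have b4: "\<bar>?t * (Dm x \<bullet> p x)\<bar> \<le> 4 * ?d x"
      unfolding abs_mult[of ?t] using t dp by (intro mult_mono) auto
    have b5: "\<bar>?c n x * (x \<bullet> p x) * (x \<bullet> Dm x)\<bar> \<le> 4 * ?d x" by (rule cross_term)
    have b6: "\<bar>?c n x * (x \<bullet> p x) * (x \<bullet> Z x)\<bar> \<le> 4 * (?d x + ?K x)"
    proof (rule order_trans[OF cross_term])
      have "norm (Z x) \<le> norm (Dm x) + m x * norm (b x)"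
        unfolding Z_def using norm_triangle_ineq[of "Dm x" "m x *\<^sub>R b x"] m_nonneg[of x] by simp
      from mult_left_mono[OF this norm_ge_zero[of "p x"]]
      have "norm (p x) * norm (Z x) \<le> ?d x + m x * (norm (b x) * norm (p x))" by (simp add: algebra_simps)
      thus "4 * (norm (p x) * norm (Z x)) \<le> 4 * (?d x + ?K x)" unfolding norm_b_p by simp
    qed
    have tri: "\<bar>a1 + a2 - a3 - a4 + a5 + a6\<bar> \<le> e1 + e2 + e3 + e4 + e5 + e6"
      if "\<bar>a1\<bar> \<le> e1" "\<bar>a2\<bar> \<le> e2" "\<bar>a3\<bar> \<le> e3" "\<bar>a4\<bar> \<le> e4" "\<bar>a5\<bar> \<le> e5" "\<bar>a6\<bar> \<le> e6"
      for a1 a2 a3 a4 a5 a6 e1 e2 e3 e4 e5 e6 :: real using that by linarith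
    show "\<bar>?E x * (?N * ?h - ?t) + (?N - 2) * ?h * (Dm x \<bullet> p x) - ?h * ?K x
      - ?t * (Dm x \<bullet> p x) + ?c n x * (x \<bullet> p x) * (x \<bullet> Dm x) + ?c n x * (x \<bullet> p x) * (x \<bullet> Z x)\<bar>
      \<le> (?N + 4) * \<bar>?E x\<bar> + \<bar>?N - 2\<bar> * ?d x + ?K x + 4 * ?d x + 4 * ?d x + 4 * (?d x + ?K x)"
      by (rule tri[OF b1 b2 b3 b4 b5 b6])
  qed
  thus ?thesis by (simp add: mult.commute)
qed

section \<open>Sign of the ergodic constant\<close>

text \<open>Integrating the first equation against a cutoff, Young's inequality lets
  \<open>P\<close> absorb the gradient term up to a constant of order R^(-q) on the ball. The left
  side is at least a fixed fraction of \<open>lam\<close> times the volume of that ball, which is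
  impossible for large R if \<open>lam\<close> is positive.\<close>

lemma lam_nonpos:
  assumes f0: "\<And>x. f (m x) \<ge> 0"
  shows "lam \<le> 0"
proof (rule ccontr)
  assume "\<not> lam \<le> 0"
  hence lam: "lam > 0" by simp
  define q where "q = \<gamma> / (\<gamma> - 1)"
  have q: "q > 1" "1 / \<gamma> + 1 / q = 1" using gamma by (auto simp: q_def field_simps)
  \<comment> \<open>Young's inequality costs t^k t^(-q) for a cutoff t^k, which is bounded by 1 once
    k is at least q; the extra 2 gives a C1 cutoff at once.\<close>
  obtain k :: nat where k: "q + 2 \<le> real k" using real_arch_simple by blast
  have k2: "k \<ge> 2" using k q by linarith
  let ?V = "\<lambda>R. LINT x|lebesgue. indicator (cball (0 :: real ^ 'n) R) x :: real"
  define \<omega> where "\<omega> = unit_ball_vol (real CARD('n))"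
  have \<omega>: "\<omega> > 0" unfolding \<omega>_def by simp
  have V: "?V R = \<omega> * R ^ CARD('n)" if "R \<ge> 0" for R
    using that content_cball[of R "0 :: real ^ 'n"] by (simp add: \<omega>_def measure_completion)
  \<comment> \<open>The volume of the ball of radius R has been cancelled. On the concentric half
    ball, a fraction 2^(-N) of the volume, the cutoff is at least (3/4)^k.\<close>
  have bound: "lam * ((3 / 4) ^ k / 2 ^ CARD('n)) \<le> (2 * real k / R) powr q / q" if R: "R > 0" for R
  proof -
    let ?\<eta> = "cutoff k R :: real ^ 'n \<Rightarrow> real" and ?c = "cutoff_slope k R :: real ^ 'n \<Rightarrow> real"
    let ?C = "(2 * real k / R) powr q / q"
    have s: "compsupp ?\<eta>" using R k2 by (intro compsupp_cutoff) auto
    have \<eta>i: "integrable lebesgue ?\<eta>"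
      by (rule integrable_compsupp[OF is_grad_imp_continuous[OF is_grad_cutoff[OF k2]] s])
    have "has_bochner_integral lebesgue (\<lambda>x. \<Sum>i\<in>UNIV. (?\<eta> x *\<^sub>R D i x + p x $ i *\<^sub>R (- ?c x *\<^sub>R x)) $ i) 0"
      by (intro has_bochner_integral_sum_0 integral_gradient_eq_0[OF is_grad_mult[OF is_grad_cutoff[OF k2] p]] compsupp_mult_left s)
    moreover have "(\<Sum>i\<in>UNIV. (?\<eta> x *\<^sub>R D i x + p x $ i *\<^sub>R (- ?c x *\<^sub>R x)) $ i) = ?\<eta> x * lap x - ?c x * (x \<bullet> p x)" for x
      by (simp add: lap_def inner_vec_def sum.distrib sum_subtractf sum_distrib_left algebra_simps)
    ultimately have I: "has_bochner_integral lebesgue (\<lambda>x. ?\<eta> x * lap x - ?c x * (x \<bullet> p x)) 0" by simp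
    have young: "lam * ?\<eta> x \<le> (?\<eta> x * lap x - ?c x * (x \<bullet> p x)) + ?C * indicator (cball 0 R) x" for x
    proof (cases "norm x < R")
      case False
      hence "1 - (norm x)\<^sup>2 / R\<^sup>2 \<le> 0" using R power_mono[of R "norm x" 2] by simp
      thus ?thesis using q k2 by (simp add: cutoff_def cutoff_slope_def max_def zero_power)
    next
      case True
      define t where "t = max 0 (1 - (norm x)\<^sup>2 / R\<^sup>2)"
      have t: "0 < t" "t \<le> 1" using True R power_strict_mono[of "norm x" R 2] by (auto simp: t_def)
      have \<eta>t: "?\<eta> x = t ^ k" by (simp add: cutoff_def t_def)
      have ct: "?c x = 2 * real k / R\<^sup>2 * t ^ (k - 1)" by (simp add: cutoff_slope_def t_def)
      \<comment> \<open>The second factor is what the slope times R leaves after the cutoff t^k is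
        pulled out, so that t^k P matches the term available from the equation.\<close>
      have "norm (p x) * (2 * real k / (R * t)) \<le> norm (p x) powr \<gamma> / \<gamma> + (2 * real k / (R * t)) powr q / q"
        by (rule Youngs_inequality[OF gamma q]) (use R t in auto)
      hence y: "norm (p x) * (2 * real k / (R * t)) \<le> P x + (2 * real k / (R * t)) powr q / q" by (simp add: P_def)
      have "?c x * (x \<bullet> p x) \<le> ?c x * (R * norm (p x))"
        using norm_cauchy_schwarz[of x "p x"] True cutoff_slope_nonneg[of k R x]
          mult_right_mono[of "norm x" R "norm (p x)"] by (intro mult_left_mono) auto
      also have "\<dots> = t ^ k * (norm (p x) * (2 * real k / (R * t)))"
      proof -
        have "t ^ k = t ^ (k - 1) * t" using k2 by (cases k) auto
        thus ?thesis unfolding ct using R t by (simp add: power2_eq_square field_simps)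
      qed
      also have "\<dots> \<le> t ^ k * (P x + (2 * real k / (R * t)) powr q / q)"
        using t by (intro mult_left_mono y) auto
      also have "\<dots> = t ^ k * P x + t ^ k * ((2 * real k / R) powr q / t powr q) / q"
        using R t by (simp add: powr_divide powr_mult algebra_simps)
      also have "t ^ k * ((2 * real k / R) powr q / t powr q) = (2 * real k / R) powr q * t powr (real k - q)"
        using t by (simp add: powr_diff powr_realpow)
      also have "t ^ k * P x + (2 * real k / R) powr q * t powr (real k - q) / q \<le> t ^ k * P x + (2 * real k / R) powr q * 1 / q"
      proof -
        have "t powr (real k - q) \<le> 1 powr (real k - q)" using t k by (intro powr_mono2) auto
        thus ?thesis using q by (intro add_left_mono divide_right_mono mult_left_mono) auto
      qed
      finally have "?c x * (x \<bullet> p x) \<le> t ^ k * P x + ?C" by simp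
      moreover have "t ^ k * lap x \<ge> t ^ k * (P x + lam)"
        using t f0[of x] by (intro mult_left_mono) (auto simp: lap_eq)
      ultimately show ?thesis using True by (simp add: \<eta>t algebra_simps)
    qed
    have Ci: "integrable lebesgue (\<lambda>x. ?C * indicator (cball (0 :: real ^ 'n) R) x)"
      by (intro integrable_mult_right integrable_indicator_cball)
    have "(LINT x|lebesgue. lam * ?\<eta> x) \<le> (LINT x|lebesgue. (?\<eta> x * lap x - ?c x * (x \<bullet> p x)) + ?C * indicator (cball 0 R) x)"
      by (rule integral_mono[OF _ _ young]) (use \<eta>i I Ci in \<open>auto simp: has_bochner_integral_iff\<close>)
    also have "\<dots> = ?C * ?V R"
      using I Ci by (subst Bochner_Integration.integral_add) (auto simp: has_bochner_integral_iff)
    finally have up: "lam * (LINT x|lebesgue. ?\<eta> x) \<le> ?C * ?V R" by simp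
    have "(3 / 4) ^ k * ?V (R / 2) = (LINT x|lebesgue. (3 / 4) ^ k * indicator (cball (0 :: real ^ 'n) (R / 2)) x)" by simp
    also have "\<dots> \<le> (LINT x|lebesgue. ?\<eta> x)"
    proof (rule integral_mono)
      show "integrable lebesgue (\<lambda>x. (3 / 4) ^ k * indicator (cball (0 :: real ^ 'n) (R / 2)) x :: real)"
        by (intro integrable_mult_right integrable_indicator_cball)
      show "(3 / 4) ^ k * indicator (cball (0 :: real ^ 'n) (R / 2)) x \<le> ?\<eta> x" for x
      proof (cases "norm x \<le> R / 2")
        case True
        hence "(norm x)\<^sup>2 \<le> (R / 2)\<^sup>2" by (intro power_mono) auto
        hence "(norm x)\<^sup>2 / R\<^sup>2 \<le> (R / 2)\<^sup>2 / R\<^sup>2" by (intro divide_right_mono) auto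
        also have "(R / 2)\<^sup>2 / R\<^sup>2 = 1 / 4" using R by (simp add: power2_eq_square)
        finally have "3 / 4 \<le> max 0 (1 - (norm x)\<^sup>2 / R\<^sup>2)" by linarith
        hence "(3 / 4) ^ k \<le> ?\<eta> x" unfolding cutoff_def by (rule power_mono) simp
        thus ?thesis using True by simp
      qed (use cutoff_bounds in simp)
    qed (rule \<eta>i)
    finally have "lam * ((3 / 4) ^ k * ?V (R / 2)) \<le> ?C * ?V R"
      using up mult_left_mono[of "(3 / 4) ^ k * ?V (R / 2)" "LINT x|lebesgue. ?\<eta> x" lam] lam by linarith
    hence "lam * ((3 / 4) ^ k * (\<omega> * (R / 2) ^ CARD('n))) \<le> ?C * (\<omega> * R ^ CARD('n))"
      using R by (simp only: V)
    hence "lam * ((3 / 4) ^ k / 2 ^ CARD('n)) * (\<omega> * R ^ CARD('n)) \<le> ?C * (\<omega> * R ^ CARD('n))"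
      by (simp add: power_divide algebra_simps)
    moreover have "\<omega> * R ^ CARD('n) > 0" using \<omega> R by simp
    ultimately show ?thesis by (rule mult_right_le_imp_le)
  qed
  have lim: "(\<lambda>n. (2 * real k * inverse (real (Suc n))) powr q / q) \<longlonglongrightarrow> 0 / q"
  proof (rule tendsto_divide)
    have "(\<lambda>n. 2 * real k * inverse (real (Suc n))) \<longlonglongrightarrow> 2 * real k * 0"
      by (intro tendsto_intros LIMSEQ_inverse_real_of_nat)
    thus "(\<lambda>n. (2 * real k * inverse (real (Suc n))) powr q) \<longlonglongrightarrow> 0"
      using q by (intro tendsto_zero_powrI[where b = q]) auto
  qed (use q in auto)
  have "lam * ((3 / 4) ^ k / 2 ^ CARD('n)) \<le> (2 * real k * inverse (real (Suc n))) powr q / q" for n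
    using bound[of "real (Suc n)"] unfolding divide_inverse[of "2 * real k"] by (simp only: of_nat_0_less_iff zero_less_Suc)
  hence "lam * ((3 / 4) ^ k / 2 ^ CARD('n)) \<le> 0 / q"
    by (intro LIMSEQ_le_const[OF lim]) blast
  moreover have "lam * ((3 / 4) ^ k / 2 ^ CARD('n)) > 0" using lam by simp
  ultimately show False by simp
qed

theorem nonexistence:
  assumes f0: "\<And>x. f (m x) \<ge> 0"
    and supercritical: "\<And>s. s > 0 \<Longrightarrow> (real CARD('n) - \<gamma> / (\<gamma> - 1)) * f s * s - real CARD('n) * F s > 0"
  shows False
proof -
  let ?N = "real CARD('n)"
  define B where "B = (LINT x|lebesgue. m x * norm (p x) powr \<gamma>)"
  define A where "A = (LINT x|lebesgue. Dm x \<bullet> p x)"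
  define S where "S = (LINT x|lebesgue. f (m x) * m x)"
  define I where "I = (LINT x|lebesgue. F (m x))"
  have hB: "has_bochner_integral lebesgue (\<lambda>x. m x * norm (p x) powr \<gamma>) B"
    and hA: "has_bochner_integral lebesgue (\<lambda>x. Dm x \<bullet> p x) A"
    and hS: "has_bochner_integral lebesgue (\<lambda>x. f (m x) * m x) S"
    and hI: "has_bochner_integral lebesgue (\<lambda>x. F (m x)) I"
    and hm: "has_bochner_integral lebesgue m 1"
    using kinetic' Dm_p_integrable fm Fm mi mass by (auto simp: has_bochner_integral_iff A_def B_def S_def I_def)
  have "has_bochner_integral lebesgue (\<lambda>x. Dm x \<bullet> p x + m x * norm (p x) powr \<gamma>) (A + B)"
    by (intro has_bochner_integral_add hA hB)
  from has_bochner_integral_eq[OF this gradient_tested_with_potential] have e1: "A + B = 0" .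
  have "has_bochner_integral lebesgue (\<lambda>x. 1 / \<gamma> * (m x * norm (p x) powr \<gamma>) + lam * m x + f (m x) * m x + Dm x \<bullet> p x)
      (1 / \<gamma> * B + lam * 1 + S + A)"
    by (intro has_bochner_integral_add has_bochner_integral_mult_right hA hB hS hm)
  moreover have "1 / \<gamma> * (m x * norm (p x) powr \<gamma>) + lam * m x + f (m x) * m x + Dm x \<bullet> p x
      = m x * (P x + lam + f (m x)) + Dm x \<bullet> p x" for x by (simp add: P_def algebra_simps)
  ultimately have "has_bochner_integral lebesgue (\<lambda>x. m x * (P x + lam + f (m x)) + Dm x \<bullet> p x) (1 / \<gamma> * B + lam * 1 + S + A)"
    by (simp only:)
  from has_bochner_integral_eq[OF this hjb_tested_with_density] have e2: "B / \<gamma> + lam + S + A = 0" by simp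
  have "has_bochner_integral lebesgue (\<lambda>x. ?N * (1 / \<gamma> * (m x * norm (p x) powr \<gamma>) + lam * m x + F (m x))
      + (?N - 2) * (Dm x \<bullet> p x) - m x * norm (p x) powr \<gamma>) (?N * (1 / \<gamma> * B + lam * 1 + I) + (?N - 2) * A - B)"
    by (intro has_bochner_integral_add has_bochner_integral_diff has_bochner_integral_mult_right hA hB hI hm)
  moreover have "1 / \<gamma> * (m x * norm (p x) powr \<gamma>) + lam * m x + F (m x) = m x * (P x + lam) + F (m x)" for x
    by (simp add: P_def algebra_simps)
  ultimately have "has_bochner_integral lebesgue (\<lambda>x. ?N * (m x * (P x + lam) + F (m x))
      + (?N - 2) * (Dm x \<bullet> p x) - m x * norm (p x) powr \<gamma>) (?N * (1 / \<gamma> * B + lam * 1 + I) + (?N - 2) * A - B)"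
    by (simp only:)
  from has_bochner_integral_eq[OF this pohozaev] have e3: "?N * (B / \<gamma> + lam + I) + (?N - 2) * A - B = 0" by simp
  \<comment> \<open>The combination B/\<gamma> + \<open>lam\<close> is also the one in the Pohozaev
    identity, so \<open>lam\<close> is eliminated from \<open>e3\<close>.\<close>
  have e4: "B / \<gamma> + lam = B - S" using e1 e2 by linarith
  have "?N * (B - S + I) - (?N - 2) * B - B = 0" using e3 e1 unfolding e4 by (simp add: eq_neg_iff_add_eq_0[symmetric])
  hence virial: "B = ?N * S - ?N * I" by (simp add: algebra_simps)

  let ?g = "\<lambda>x. (?N - \<gamma> / (\<gamma> - 1)) * (f (m x) * m x) - ?N * F (m x)"
  have hg: "has_bochner_integral lebesgue ?g ((?N - \<gamma> / (\<gamma> - 1)) * S - ?N * I)"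
    by (intro has_bochner_integral_diff has_bochner_integral_mult_right hS hI)
  have g0: "?g x > 0" for x using supercritical[OF pos[of x]] by (simp add: mult.assoc)
  have "(LINT x|lebesgue. ?g x) > 0"
  proof (rule ccontr)
    assume "\<not> ?thesis"
    moreover have "(LINT x|lebesgue. ?g x) \<ge> 0" using g0 by (intro integral_nonneg_AE AE_I2) (simp add: less_imp_le)
    ultimately have "(LINT x|lebesgue. ?g x) = 0" by simp
    hence "AE x in lebesgue. ?g x = 0"
      using integral_nonneg_eq_0_iff_AE[of lebesgue ?g] hg g0 by (auto simp: has_bochner_integral_iff less_imp_le)
    \<comment> \<open>The premise contradicts \<open>g0\<close> at every point. Concluding
      \<open>m x = 0\<close> turns this into a contradiction with unit mass, which rules out a space
      of measure zero.\<close>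
    hence "AE x in lebesgue. m x = 0"
      by (rule eventually_mono) (use g0 in \<open>metis less_irrefl\<close>)
    hence "(LINT x|lebesgue. m x) = 0" by (simp add: integral_eq_zero_AE)
    thus False using mass by simp
  qed
  hence "(?N - \<gamma> / (\<gamma> - 1)) * S - ?N * I > 0" using hg by (simp add: has_bochner_integral_iff)
  hence "B > \<gamma> / (\<gamma> - 1) * S" unfolding virial left_diff_distrib by linarith
  hence "B * (\<gamma> - 1) > \<gamma> * S" using gamma by (simp add: field_simps)
  \<comment> \<open>\<open>e4\<close> multiplied by \<open>\<gamma>\<close>: the sign of
    \<open>lam\<close> is that of B (\<gamma> - 1) - \<gamma> S.\<close>
  moreover have "\<gamma> * lam = B * (\<gamma> - 1) - \<gamma> * S"
  proof -
    have "\<gamma> * (B / \<gamma> + lam) = \<gamma> * (B - S)" using e4 by simp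
    thus ?thesis using gamma by (simp add: algebra_simps)
  qed
  ultimately have "\<gamma> * lam > 0" by linarith
  hence "lam > 0" using gamma by (simp add: zero_less_mult_iff)
  with lam_nonpos[OF f0] show False by simp
qed

end

theorem theorem1p3:
  fixes \<gamma> \<gamma>' \<alpha> Cf :: real and f F :: "real \<Rightarrow> real"
  assumes "\<gamma> > 1" and "\<gamma>' = \<gamma> / (\<gamma> - 1)"
    and "\<alpha> > 0" and "Cf > 0"
    and "f C1_differentiable_on {0<..}"
    and "\<And>s. s \<ge> 0 \<Longrightarrow> 0 \<le> f s \<and> f s \<le> Cf * (s powr \<alpha> + 1)"
    and "\<And>s. s \<ge> 0 \<Longrightarrow> F s = integral {0..s} f"
    and "\<And>s. s > 0 \<Longrightarrow> (real CARD('n) - \<gamma>') * f s * s - real CARD('n) * F s > 0"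
  shows "\<not> (\<exists>(u :: real ^ 'n::finite \<Rightarrow> real) lam m Dm.
           mfg_solution \<gamma> f u lam m Dm \<and>
           integrable lebesgue (\<lambda>x. norm (grad u x) powr \<gamma> * m x) \<and>
           integrable lebesgue (\<lambda>x. m x powr (\<alpha> + 1)) \<and>
           integrable lebesgue (\<lambda>x. norm (grad u x) * norm (Dm x)) \<and>
           filterlim u at_top at_infinity \<and>
           (\<exists>c \<eta>. c > 0 \<and> \<eta> > 0 \<and> (\<forall>x. norm (grad u x) \<le> c * (norm x powr \<eta> + 1))))"
proof safe
  fix u :: "real ^ 'n \<Rightarrow> real" and lam m Dm
  assume sol: "mfg_solution \<gamma> f u lam m Dm"
    and kin: "integrable lebesgue (\<lambda>x. norm (grad u x) powr \<gamma> * m x)"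
    and mpow: "integrable lebesgue (\<lambda>x. m x powr (\<alpha> + 1))"
    and cross: "integrable lebesgue (\<lambda>x. norm (grad u x) * norm (Dm x))"
    and coerc: "filterlim u at_top at_infinity"
  have "Ck (Suc (Suc 0)) u"
    and W: "W11 m Dm" and pos: "\<And>x. m x > 0" and mass: "(LINT x|lebesgue. m x) = 1"
    and hjb: "\<And>x. - laplacian u x + 1 / \<gamma> * norm (grad u x) powr \<gamma> + lam = - f (m x)"
    and kfp: "\<And>\<phi>. test_function \<phi> \<Longrightarrow> (LINT x|lebesgue. Dm x \<bullet> grad \<phi> x
           + m x * ((norm (grad u x) powr (\<gamma> - 2) *\<^sub>R grad u x) \<bullet> grad \<phi> x)) = 0"
    using sol unfolding mfg_solution_def numeral_2_eq_2 by blast+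
  from \<open>Ck (Suc (Suc 0)) u\<close> have C2: "u differentiable (at x)" "partial_deriv i u differentiable (at x)"
      "continuous_on UNIV (partial_deriv j (partial_deriv i u))" for x i j
    unfolding Ck.simps by blast+
  define D where "D i = grad (partial_deriv i u)" for i
  have pi: "(\<lambda>x. grad u x $ i) = partial_deriv i u" for i by (simp add: grad_def fun_eq_iff)
  have p: "is_grad (\<lambda>x. grad u x $ i) (D i)" for i
    unfolding pi D_def by (rule Ck_Suc_is_grad[OF C2(2,3)])
  \<comment> \<open>\<open>Ck\<close> records continuity only for derivatives of top order; for the
    first ones it follows from their own differentiability.\<close>
  have u: "is_grad u (grad u)"
    using is_grad_imp_continuous[OF p] unfolding pi by (rule Ck_Suc_is_grad[OF C2(1)])
  have lap: "laplacian u x = (\<Sum>i\<in>UNIV. D i x $ i)" for x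
    by (simp add: laplacian_def D_def grad_def)
  have hjb': "(\<Sum>i\<in>UNIV. D i x $ i) = 1 / \<gamma> * norm (grad u x) powr \<gamma> + lam + f (m x)" for x
    using hjb[of x] unfolding lap by linarith
  \<comment> \<open>The pointwise first equation writes \<open>f (m x)\<close> through derivatives
    of \<open>u\<close>, so it is continuous even if the representative \<open>m\<close> is
    not.\<close>
  have f_m_eq: "(\<lambda>x. f (m x)) = (\<lambda>x. (\<Sum>i\<in>UNIV. D i x $ i) - 1 / \<gamma> * norm (grad u x) powr \<gamma> - lam)"
    by (simp add: hjb')
  have cP: "continuous_on UNIV (\<lambda>x. 1 / \<gamma> * norm (grad u x) powr \<gamma>)"
    by (rule continuous_on_compose2[OF is_grad_imp_continuous[OF is_grad_norm_powr[OF assms(1)]] is_grad_continuous[OF u]]) auto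
  have cfm: "continuous_on UNIV (\<lambda>x. f (m x))"
    unfolding f_m_eq by (intro continuous_on_diff cP continuous_on_const continuous_on_sum is_grad_nth_continuous[OF p])
  have cf: "continuous_on {0<..} f"
    using C1_differentiable_imp_continuous_on[OF assms(5)] .
  have mi: "integrable lebesgue m" using W by (simp add: W11_def)
  have fmi: "integrable lebesgue (\<lambda>x. f (m x) * m x)"
  proof (rule Bochner_Integration.integrable_bound)
    show "integrable lebesgue (\<lambda>x. Cf * (m x powr (\<alpha> + 1) + m x))" using mi mpow by auto
    show "(\<lambda>x. f (m x) * m x) \<in> borel_measurable lebesgue"
      using mi continuous_lebesgue_measurable[OF cfm] by auto
    show "AE x in lebesgue. norm (f (m x) * m x) \<le> norm (Cf * (m x powr (\<alpha> + 1) + m x))"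
    proof (rule AE_I2)
      fix x
      have fb: "0 \<le> f (m x)" "f (m x) \<le> Cf * (m x powr \<alpha> + 1)" using assms(6)[of "m x"] pos[of x] by auto
      have "f (m x) * m x \<le> Cf * (m x powr \<alpha> + 1) * m x" using fb pos[of x] by (intro mult_right_mono) auto
      also have "\<dots> = Cf * (m x powr (\<alpha> + 1) + m x)" using pos[of x] by (simp add: powr_add algebra_simps)
      finally show "norm (f (m x) * m x) \<le> norm (Cf * (m x powr (\<alpha> + 1) + m x))"
        using fb pos[of x] by simp
    qed
  qed
  \<comment> \<open>The growth bound and the integrability of \<open>m x powr (\<alpha> + 1)\<close>
    yield the locale assumptions \<open>Fm\<close> and \<open>chain\<close>.\<close>
  note F_rules = W11_chain_rule_primitive[OF W pos assms(3,4) cf assms(6,7) cfm mpow]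
  interpret mfg_pair u "grad u" D m Dm f F \<gamma> lam
    by unfold_locales (use assms(1) u p W pos hjb' kfp mass kin cross fmi F_rules coerc in auto)
  show False
    by (rule nonexistence) (use assms(2,6,8) pos in \<open>auto simp: less_imp_le\<close>)
qed

end
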